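(* Let $G$ be an abelian group. The Vietoris-Rips homology $H_*^{VR}(X,A,\mathcal{F};G)$ and the Vietoris-Rips cohomology $H^*_{VR}(X,A,\mathcal{F};G)$ of semi-uniform pairs $(X,A,\mathcal{F})$ are functorial with respect to uniformly continuous maps of semi-uniform pairs. That is, every uniformly continuous map of semi-uniform pairs $f\colon (X,A,\mathcal{F}_X)\to (Y,B,\mathcal{F}_Y)$ induces well-defined homomorphisms $f_*\colon H_*^{VR}(X,A,\mathcal{F}_X;G)\to H_*^{VR}(Y,B,\mathcal{F}_Y;G)$ and $f^*\colon H^*_{VR}(Y,B,\mathcal{F}_Y;G)\to H^*_{VR}(X,A,\mathcal{F}_X;G)$ (as described in the context), such that $(\mathrm{id})_*=\mathrm{id}$, $(\mathrm{id})^*=\mathrm{id}$, $(g\circ f)_*=g_*\circ f_*$ and $(g\circ f)^*=f^*\circ g^*$ for all composable uniformly continuous maps of semi-uniform pairs $f,g$.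
   Context: A semi-uniform structure on a set $X$ is a filter $\mathcal{F}$ on $X\times X$ (a nonempty collection of subsets, not containing $\emptyset$, closed under finite intersections and supersets) such that every member contains the diagonal and, for every $U\in\mathcal{F}$, $U^{-1}=\{(y,x)\mid (x,y)\in U\}$ contains a member of $\mathcal{F}$. The pair $(X,\mathcal{F})$ is a semi-uniform space. A map $f\colon(X,\mathcal{F}_X)\to(Y,\mathcal{F}_Y)$ is uniformly continuous if for each $V\in\mathcal{F}_Y$ there is $U\in\mathcal{F}_X$ such that $(x,y)\in U$ implies $(f(x),f(y))\in V$ (written $f(U)\subset V$). For $A\subset X$ and $U\in\mathcal{F}$ put $U_A=U\cap(A\times A)$ and $\mathcal{F}_A=\{U_A\mid U\in\mathcal{F},\,U_A\neq\emptyset\}$. A semi-uniform pair $(X,A,\mathcal{F})$ is the pair $((X,\mathcal{F}),(A,\mathcal{F}_A))$. A uniformly continuous map of semi-uniform pairs $(X,A,\mathcal{F}_X)\to (Y,B,\mathcal{F}_Y)$ is a uniformly continuous map $f\colon (X,\mathcal{F}_X)\to (Y,\mathcal{F}_Y)$ with $f(A)\subset B$. For a relation $U\subset X\times X$, the Vietoris-Rips complex $\Sigma^X_U$ is the simplicial complex with vertex set $X$ in which a finite nonempty set is a simplex iff its elements can be ordered as $x_0,\dots,x_q$ (distinct) so that $(x_i,x_j)\in U$ for all $i<j$. (If $U$ is symmetric this is the clique complex of the graph with edge relation $U$.) Put $H_*^{VR}(X,A\colon U;G)=H_*(\Sigma^X_U,\Sigma^A_{U_A};G)$ and $H^*_{VR}(X,A\colon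 U;G)=H^*(\Sigma^X_U,\Sigma^A_{U_A};G)$ (simplicial (co)homology of a pair). For $U\subset U'$ in $\mathcal{F}$ the inclusion $(\Sigma^X_U,\Sigma^A_{U_A})\subset(\Sigma^X_{U'},\Sigma^A_{U'_A})$ induces maps on homology and cohomology, and one defines $H_*^{VR}(X,A,\mathcal{F};G)=\varprojlim_{U\in\mathcal{F}}H_*^{VR}(X,A\colon U;G)$ and $H^*_{VR}(X,A,\mathcal{F};G)=\varinjlim_{U\in\mathcal{F}}H^*_{VR}(X,A\colon U;G)$. Induced maps: whenever $U\in\mathcal{F}_X$, $V\in\mathcal{F}_Y$ and $f(U)\subset V$, the vertex map $f$ defines a simplicial map of pairs $\tilde f_{VU}\colon(\Sigma^X_U,\Sigma^A_{U_A})\to(\Sigma^Y_V,\Sigma^B_{V_B})$. The map $f_*$ sends a compatible family $(\xi_U)_U$ to the family whose $V$-component is $(\tilde f_{VU})_*(\xi_U)$ for any $U$ with $f(U)\subset V$; the map $f^*$ sends the class of $\eta\in H^*_{VR}(Y,B\colon V;G)$ to the class of $(\tilde f_{VU})^*(\eta)$ for any such $U$. *)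

theory Defs
  imports "HOL-Algebra.FiniteProduct" "HOL-Algebra.Product_Groups" "HOL-Combinatorics.Permutations"
begin

section \<open>Semi-uniform spaces and pairs\<close>

definition semi_uniform_space :: "'a set \<Rightarrow> ('a \<times> 'a) set set \<Rightarrow> bool" where
  "semi_uniform_space X F \<longleftrightarrow>
     F \<subseteq> Pow (X \<times> X) \<and> F \<noteq> {} \<and> {} \<notin> F \<and>
     (\<forall>U\<in>F. \<forall>V\<in>F. U \<inter> V \<in> F) \<and>
     (\<forall>U\<in>F. \<forall>V. U \<subseteq> V \<and> V \<subseteq> X \<times> X \<longrightarrow> V \<in> F) \<and>
     (\<forall>U\<in>F. Id_on X \<subseteq> U) \<and>
     (\<forall>U\<in>F. \<exists>V\<in>F. V \<subseteq> U\<inverse>)"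

definition rel_trace :: "('a \<times> 'a) set \<Rightarrow> 'a set \<Rightarrow> ('a \<times> 'a) set" where
  "rel_trace U A = U \<inter> (A \<times> A)"

definition trace_structure :: "('a \<times> 'a) set set \<Rightarrow> 'a set \<Rightarrow> ('a \<times> 'a) set set" where
  "trace_structure F A = {rel_trace U A | U. U \<in> F \<and> rel_trace U A \<noteq> {}}"

text \<open>The structure on \<open>A\<close> is always \<open>trace_structure F A\<close>, so it is not a separate
  datum.  The case \<open>A = {}\<close> (absolute homology) is allowed.\<close>

definition semi_uniform_pair :: "'a set \<Rightarrow> 'a set \<Rightarrow> ('a \<times> 'a) set set \<Rightarrow> bool" where
  "semi_uniform_pair X A F \<longleftrightarrow> semi_uniform_space X F \<and> A \<subseteq> X"

lemma semi_uniform_space_trace_structure: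
  assumes "semi_uniform_pair X A F" and "A \<noteq> {}"
  shows "semi_uniform_space A (trace_structure F A)"
proof -
  have F: "semi_uniform_space X F" and AX: "A \<subseteq> X"
    using assms by (auto simp: semi_uniform_pair_def)
  have diag: "Id_on A \<subseteq> rel_trace U A" if "U \<in> F" for U
  proof -
    have "Id_on X \<subseteq> U" using F that unfolding semi_uniform_space_def by blast
    then show ?thesis using AX by (auto simp: rel_trace_def)
  qed
  have ne: "rel_trace U A \<noteq> {}" if "U \<in> F" for U
    using diag[OF that] assms(2) by fastforce
  have eq: "trace_structure F A = (\<lambda>U. rel_trace U A) ` F"
    using ne by (auto simp: trace_structure_def)
  have up: "W \<in> trace_structure F A"
    if U: "U \<in> F" and W: "rel_trace U A \<subseteq> W" "W \<subseteq> A \<times> A" for U W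
  proof -
    have "\<And>V. U \<subseteq> V \<Longrightarrow> V \<subseteq> X \<times> X \<Longrightarrow> V \<in> F" and "U \<subseteq> X \<times> X"
      using F U unfolding semi_uniform_space_def by blast+
    then have "U \<union> W \<in> F" using W AX by blast
    moreover have "rel_trace (U \<union> W) A = W" using W by (auto simp: rel_trace_def)
    ultimately show ?thesis unfolding eq by (metis image_eqI)
  qed
  have int: "rel_trace U A \<inter> rel_trace V A \<in> trace_structure F A" if "U \<in> F" "V \<in> F" for U V
  proof -
    have "U \<inter> V \<in> F" using F that unfolding semi_uniform_space_def by blast
    moreover have "rel_trace (U \<inter> V) A = rel_trace U A \<inter> rel_trace V A"
      by (auto simp: rel_trace_def)
    ultimately show ?thesis unfolding eq by (metis image_eqI)
  qed
  have sym: "\<exists>V\<in>trace_structure F A. V \<subseteq> (rel_trace U A)\<inverse>" if "U \<in> F" for U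
  proof -
    obtain V where "V \<in> F" "V \<subseteq> U\<inverse>"
      using F \<open>U \<in> F\<close> unfolding semi_uniform_space_def by blast
    then have "rel_trace V A \<in> trace_structure F A" "rel_trace V A \<subseteq> (rel_trace U A)\<inverse>"
      unfolding eq by (auto simp: rel_trace_def)
    then show ?thesis by blast
  qed
  have nonempty: "F \<noteq> {}" using F unfolding semi_uniform_space_def by blast
  show ?thesis
    unfolding semi_uniform_space_def
  proof (intro conjI ballI allI impI)
    show "trace_structure F A \<subseteq> Pow (A \<times> A)" by (auto simp: eq rel_trace_def)
    show "trace_structure F A \<noteq> {}" using nonempty by (simp add: eq)
    show "{} \<notin> trace_structure F A" by (auto simp: trace_structure_def)
  next
    fix P Q assume "P \<in> trace_structure F A" "Q \<in> trace_structure F A"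
    then show "P \<inter> Q \<in> trace_structure F A"
      using int by (auto simp: trace_structure_def)
  next
    fix P Q assume "P \<in> trace_structure F A" "P \<subseteq> Q \<and> Q \<subseteq> A \<times> A"
    then show "Q \<in> trace_structure F A" using up by (auto simp: trace_structure_def)
  next
    fix P assume "P \<in> trace_structure F A"
    then show "Id_on A \<subseteq> P" using diag by (auto simp: trace_structure_def)
  next
    fix P assume "P \<in> trace_structure F A"
    then show "\<exists>V\<in>trace_structure F A. V \<subseteq> P\<inverse>"
      using sym by (auto simp: trace_structure_def)
  qed
qed

text \<open>\<open>rel_maps_into f U V\<close> is \<open>f(U) \<subseteq> V\<close>.\<close>

definition rel_maps_into ::
    "('a \<Rightarrow> 'b) \<Rightarrow> ('a \<times> 'a) set \<Rightarrow> ('b \<times> 'b) set \<Rightarrow> bool" where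
  "rel_maps_into f U V \<longleftrightarrow> (\<forall>x y. (x, y) \<in> U \<longrightarrow> (f x, f y) \<in> V)"

definition semi_uniformly_continuous ::
    "'a set \<Rightarrow> ('a \<times> 'a) set set \<Rightarrow> 'b set \<Rightarrow> ('b \<times> 'b) set set \<Rightarrow> ('a \<Rightarrow> 'b) \<Rightarrow> bool" where
  "semi_uniformly_continuous X F Y F' f \<longleftrightarrow>
     f ` X \<subseteq> Y \<and> (\<forall>V\<in>F'. \<exists>U\<in>F. rel_maps_into f U V)"

definition semi_uniform_pair_map ::
    "'a set \<Rightarrow> 'a set \<Rightarrow> ('a \<times> 'a) set set \<Rightarrow> 'b set \<Rightarrow> 'b set \<Rightarrow> ('b \<times> 'b) set set
      \<Rightarrow> ('a \<Rightarrow> 'b) \<Rightarrow> bool" where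
  "semi_uniform_pair_map X A F Y B F' f \<longleftrightarrow>
     semi_uniformly_continuous X F Y F' f \<and> f ` A \<subseteq> B"


section \<open>Simplicial homology and cohomology of a pair\<close>

text \<open>An abstract simplicial complex is given by its set \<open>K\<close> of (finite, nonempty) simplices.
  Coefficients are taken in a commutative group \<open>G\<close>, which HOL-Algebra writes
  multiplicatively.

  Chains and cochains are oriented: a \<open>q\<close>-chain is a finitely supported function \<open>c\<close>
  on the ordered \<open>q\<close>-simplices (lists of \<open>q + 1\<close> distinct vertices spanning a simplex) such
  that permuting the vertices changes the value by the sign of the permutation; a
  \<open>q\<close>-cochain is such a function without the finiteness condition.  All these functions
  are extended by the neutral element to arbitrary lists of vertices.\<close>

definition ordered_simplices :: "nat \<Rightarrow> 'a set set \<Rightarrow> 'a list set" where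
  "ordered_simplices q K = {xs. length xs = Suc q \<and> distinct xs \<and> set xs \<in> K}"

definition oriented_functions ::
    "('g, 'm) monoid_scheme \<Rightarrow> nat \<Rightarrow> 'a set set \<Rightarrow> ('a list \<Rightarrow> 'g) set" where
  "oriented_functions G q K =
     {c. (\<forall>xs\<in>ordered_simplices q K. c xs \<in> carrier G) \<and>
         (\<forall>xs. xs \<notin> ordered_simplices q K \<longrightarrow> c xs = \<one>\<^bsub>G\<^esub>) \<and>
         (\<forall>xs\<in>ordered_simplices q K. \<forall>p. p permutes {..<Suc q} \<longrightarrow>
            c (permute_list p xs) = (if evenperm p then c xs else inv\<^bsub>G\<^esub> (c xs)))}"

definition pointwise_group ::
    "('g, 'm) monoid_scheme \<Rightarrow> ('a list \<Rightarrow> 'g) set \<Rightarrow> ('a list \<Rightarrow> 'g) monoid" where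
  "pointwise_group G C =
     \<lparr>carrier = C, monoid.mult = (\<lambda>c d xs. c xs \<otimes>\<^bsub>G\<^esub> d xs), one = (\<lambda>xs. \<one>\<^bsub>G\<^esub>)\<rparr>"

subsection \<open>Homology\<close>

definition simplicial_chains ::
    "('g, 'm) monoid_scheme \<Rightarrow> nat \<Rightarrow> 'a set set \<Rightarrow> ('a list \<Rightarrow> 'g) set" where
  "simplicial_chains G q K = {c \<in> oriented_functions G q K. finite {xs. c xs \<noteq> \<one>\<^bsub>G\<^esub>}}"

text \<open>The boundary \<open>\<partial>[v\<^sub>0,\<dots>,v\<^sub>q] = \<Sum>\<^sub>i (-1)\<^sup>i [v\<^sub>0,\<dots>,v\<^sub>i\<^sub>-\<^sub>1,v\<^sub>i\<^sub>+\<^sub>1,\<dots>,v\<^sub>q]\<close>,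
  read off as a function: an oriented simplex with face \<open>w\<close> can be reordered as \<open>v # w\<close>,
  and then \<open>w\<close> occurs in its boundary with sign \<open>+1\<close>.  The value at the empty list is
  neutral because 0-chains have zero boundary (homology is not reduced).\<close>

definition simplicial_boundary ::
    "('g, 'm) monoid_scheme \<Rightarrow> ('a list \<Rightarrow> 'g) \<Rightarrow> 'a list \<Rightarrow> 'g" where
  "simplicial_boundary G c =
     (\<lambda>w. if w = [] then \<one>\<^bsub>G\<^esub>
          else finprod G (\<lambda>v. c (v # w)) {v. c (v # w) \<noteq> \<one>\<^bsub>G\<^esub>})"

definition relative_cycles ::
    "('g, 'm) monoid_scheme \<Rightarrow> nat \<Rightarrow> 'a set set \<Rightarrow> 'a set set \<Rightarrow> ('a list \<Rightarrow> 'g) set" where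
  "relative_cycles G q K L =
     {c \<in> simplicial_chains G q K.
        q = 0 \<or> simplicial_boundary G c \<in> simplicial_chains G (q - 1) L}"

definition relative_boundaries ::
    "('g, 'm) monoid_scheme \<Rightarrow> nat \<Rightarrow> 'a set set \<Rightarrow> 'a set set \<Rightarrow> ('a list \<Rightarrow> 'g) set" where
  "relative_boundaries G q K L =
     (simplicial_boundary G ` simplicial_chains G (Suc q) K)
       <#>\<^bsub>pointwise_group G (simplicial_chains G q K)\<^esub> simplicial_chains G q L"

definition simplicial_homology ::
    "('g, 'm) monoid_scheme \<Rightarrow> nat \<Rightarrow> 'a set set \<Rightarrow> 'a set set \<Rightarrow> ('a list \<Rightarrow> 'g) set monoid" where
  "simplicial_homology G q K L =
     pointwise_group G (relative_cycles G q K L) Mod relative_boundaries G q K L"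

text \<open>The chain map \<open>[v\<^sub>0,\<dots>,v\<^sub>q] \<mapsto> [f v\<^sub>0,\<dots>,f v\<^sub>q]\<close>, where the image is zero if the
  \<open>f v\<^sub>i\<close> are not distinct.\<close>

definition simplicial_chain_map ::
    "('g, 'm) monoid_scheme \<Rightarrow> ('a \<Rightarrow> 'b) \<Rightarrow> ('a list \<Rightarrow> 'g) \<Rightarrow> 'b list \<Rightarrow> 'g" where
  "simplicial_chain_map G f c =
     (\<lambda>ys. if distinct ys then finprod G c {xs. map f xs = ys \<and> c xs \<noteq> \<one>\<^bsub>G\<^esub>} else \<one>\<^bsub>G\<^esub>)"

text \<open>\<open>simplicial_homology_map G q f K' L'\<close> is the homomorphism into the homology of
  \<open>(K', L')\<close> induced by the vertex map \<open>f\<close>.  It sends a class \<open>C\<close>, which is a coset of cycles,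
  to the sum of its image and the boundaries of the target, which is the coset of
  \<open>f\<^sub>#(c)\<close> for every \<open>c \<in> C\<close>.\<close>

definition simplicial_homology_map ::
    "('g, 'm) monoid_scheme \<Rightarrow> nat \<Rightarrow> ('a \<Rightarrow> 'b) \<Rightarrow> 'b set set \<Rightarrow> 'b set set
      \<Rightarrow> ('a list \<Rightarrow> 'g) set \<Rightarrow> ('b list \<Rightarrow> 'g) set" where
  "simplicial_homology_map G q f K' L' C =
     relative_boundaries G q K' L'
       <#>\<^bsub>pointwise_group G (relative_cycles G q K' L')\<^esub> (simplicial_chain_map G f ` C)"

subsection \<open>Cohomology\<close>

definition relative_cochains ::
    "('g, 'm) monoid_scheme \<Rightarrow> nat \<Rightarrow> 'a set set \<Rightarrow> 'a set set \<Rightarrow> ('a list \<Rightarrow> 'g) set" where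
  "relative_cochains G q K L =
     {\<phi> \<in> oriented_functions G q K. \<forall>xs\<in>ordered_simplices q L. \<phi> xs = \<one>\<^bsub>G\<^esub>}"

definition simplicial_coboundary ::
    "('g, 'm) monoid_scheme \<Rightarrow> nat \<Rightarrow> 'a set set \<Rightarrow> ('a list \<Rightarrow> 'g) \<Rightarrow> 'a list \<Rightarrow> 'g" where
  "simplicial_coboundary G q K \<phi> =
     (\<lambda>xs. if xs \<in> ordered_simplices (Suc q) K
           then finprod G (\<lambda>i. if even i then \<phi> (take i xs @ drop (Suc i) xs)
                               else inv\<^bsub>G\<^esub> (\<phi> (take i xs @ drop (Suc i) xs))) {..Suc q}
           else \<one>\<^bsub>G\<^esub>)"

definition relative_cocycles ::
    "('g, 'm) monoid_scheme \<Rightarrow> nat \<Rightarrow> 'a set set \<Rightarrow> 'a set set \<Rightarrow> ('a list \<Rightarrow> 'g) set" where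
  "relative_cocycles G q K L =
     {\<phi> \<in> relative_cochains G q K L. simplicial_coboundary G q K \<phi> = (\<lambda>xs. \<one>\<^bsub>G\<^esub>)}"

definition relative_coboundaries ::
    "('g, 'm) monoid_scheme \<Rightarrow> nat \<Rightarrow> 'a set set \<Rightarrow> 'a set set \<Rightarrow> ('a list \<Rightarrow> 'g) set" where
  "relative_coboundaries G q K L =
     (case q of 0 \<Rightarrow> {\<lambda>xs. \<one>\<^bsub>G\<^esub>}
      | Suc p \<Rightarrow> simplicial_coboundary G p K ` relative_cochains G p K L)"

definition simplicial_cohomology ::
    "('g, 'm) monoid_scheme \<Rightarrow> nat \<Rightarrow> 'a set set \<Rightarrow> 'a set set \<Rightarrow> ('a list \<Rightarrow> 'g) set monoid" where
  "simplicial_cohomology G q K L =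
     pointwise_group G (relative_cocycles G q K L) Mod relative_coboundaries G q K L"

text \<open>If the vertices in \<open>map f xs\<close> are not distinct, \<open>\<phi> (map f xs)\<close> is neutral, because
  \<open>\<phi>\<close> is supported on ordered simplices.\<close>

definition simplicial_cochain_map ::
    "('g, 'm) monoid_scheme \<Rightarrow> nat \<Rightarrow> ('a \<Rightarrow> 'b) \<Rightarrow> 'a set set \<Rightarrow> ('b list \<Rightarrow> 'g)
      \<Rightarrow> 'a list \<Rightarrow> 'g" where
  "simplicial_cochain_map G q f K \<phi> =
     (\<lambda>xs. if xs \<in> ordered_simplices q K then \<phi> (map f xs) else \<one>\<^bsub>G\<^esub>)"

definition simplicial_cohomology_map ::
    "('g, 'm) monoid_scheme \<Rightarrow> nat \<Rightarrow> ('a \<Rightarrow> 'b) \<Rightarrow> 'a set set \<Rightarrow> 'a set set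
      \<Rightarrow> ('b list \<Rightarrow> 'g) set \<Rightarrow> ('a list \<Rightarrow> 'g) set" where
  "simplicial_cohomology_map G q f K L C =
     relative_coboundaries G q K L
       <#>\<^bsub>pointwise_group G (relative_cocycles G q K L)\<^esub> (simplicial_cochain_map G q f K ` C)"


section \<open>Limits of groups over a directed set\<close>

text \<open>In both definitions \<open>t i j : G i \<rightarrow> G j\<close> is the transition map for \<open>i, j \<in> I\<close>
  with \<open>r i j\<close>.\<close>

definition inverse_limit_group ::
    "'i set \<Rightarrow> ('i \<Rightarrow> 'i \<Rightarrow> bool) \<Rightarrow> ('i \<Rightarrow> ('h, 'm) monoid_scheme) \<Rightarrow> ('i \<Rightarrow> 'i \<Rightarrow> 'h \<Rightarrow> 'h)
      \<Rightarrow> ('i \<Rightarrow> 'h) monoid" where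
  "inverse_limit_group I r G t =
     (product_group I G)
       \<lparr>carrier := {\<xi> \<in> carrier (product_group I G).
                     \<forall>i\<in>I. \<forall>j\<in>I. r i j \<longrightarrow> t i j (\<xi> i) = \<xi> j}\<rparr>"

definition direct_limit_rel ::
    "'i set \<Rightarrow> ('i \<Rightarrow> 'i \<Rightarrow> bool) \<Rightarrow> ('i \<Rightarrow> ('h, 'm) monoid_scheme) \<Rightarrow> ('i \<Rightarrow> 'i \<Rightarrow> 'h \<Rightarrow> 'h)
      \<Rightarrow> (('i \<times> 'h) \<times> ('i \<times> 'h)) set" where
  "direct_limit_rel I r G t =
     {((i, a), (j, b)). i \<in> I \<and> a \<in> carrier (G i) \<and> j \<in> I \<and> b \<in> carrier (G j) \<and>
        (\<exists>k\<in>I. r i k \<and> r j k \<and> t i k a = t j k b)}"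

definition direct_limit_class ::
    "'i set \<Rightarrow> ('i \<Rightarrow> 'i \<Rightarrow> bool) \<Rightarrow> ('i \<Rightarrow> ('h, 'm) monoid_scheme) \<Rightarrow> ('i \<Rightarrow> 'i \<Rightarrow> 'h \<Rightarrow> 'h)
      \<Rightarrow> 'i \<Rightarrow> 'h \<Rightarrow> ('i \<times> 'h) set" where
  "direct_limit_class I r G t i a = direct_limit_rel I r G t `` {(i, a)}"

text \<open>The product of two classes is computed in any \<open>G k\<close> to which both representatives
  can be moved.  The unions below are unions of equal sets.\<close>

definition direct_limit_group ::
    "'i set \<Rightarrow> ('i \<Rightarrow> 'i \<Rightarrow> bool) \<Rightarrow> ('i \<Rightarrow> ('h, 'm) monoid_scheme) \<Rightarrow> ('i \<Rightarrow> 'i \<Rightarrow> 'h \<Rightarrow> 'h)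
      \<Rightarrow> ('i \<times> 'h) set monoid" where
  "direct_limit_group I r G t =
     \<lparr>carrier = (SIGMA i:I. carrier (G i)) // direct_limit_rel I r G t,
      monoid.mult = (\<lambda>P Q. \<Union> {direct_limit_class I r G t k (t i k a \<otimes>\<^bsub>G k\<^esub> t j k b) | i a j b k.
                        (i, a) \<in> P \<and> (j, b) \<in> Q \<and> k \<in> I \<and> r i k \<and> r j k}),
      one = (\<Union>i\<in>I. direct_limit_class I r G t i \<one>\<^bsub>G i\<^esub>)\<rparr>"


section \<open>Vietoris-Rips homology and cohomology\<close>

definition vr_complex :: "'a set \<Rightarrow> ('a \<times> 'a) set \<Rightarrow> 'a set set" where
  "vr_complex X U =
     {set xs | xs. xs \<noteq> [] \<and> set xs \<subseteq> X \<and> distinct xs \<and> sorted_wrt (\<lambda>x y. (x, y) \<in> U) xs}"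

definition vr_homology_at ::
    "('g, 'm) monoid_scheme \<Rightarrow> nat \<Rightarrow> 'a set \<Rightarrow> 'a set \<Rightarrow> ('a \<times> 'a) set
      \<Rightarrow> ('a list \<Rightarrow> 'g) set monoid" where
  "vr_homology_at G q X A U =
     simplicial_homology G q (vr_complex X U) (vr_complex A (rel_trace U A))"

definition vr_cohomology_at ::
    "('g, 'm) monoid_scheme \<Rightarrow> nat \<Rightarrow> 'a set \<Rightarrow> 'a set \<Rightarrow> ('a \<times> 'a) set
      \<Rightarrow> ('a list \<Rightarrow> 'g) set monoid" where
  "vr_cohomology_at G q X A U =
     simplicial_cohomology G q (vr_complex X U) (vr_complex A (rel_trace U A))"

text \<open>The maps \<open>(f\<^sub>V\<^sub>U)\<^sub>*\<close> and \<open>(f\<^sub>V\<^sub>U)\<^sup>*\<close> induced by \<open>f\<close> on the complexes of relations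
  \<open>U\<close> and \<open>V\<close>.  The first does not depend on the source complex except through its
  argument, and the second not on the target complex, so only \<open>(Y, B, V)\<close> and
  \<open>(X, A, U)\<close>, respectively, are parameters.\<close>

definition vr_homology_map_at ::
    "('g, 'm) monoid_scheme \<Rightarrow> nat \<Rightarrow> ('a \<Rightarrow> 'b) \<Rightarrow> 'b set \<Rightarrow> 'b set \<Rightarrow> ('b \<times> 'b) set
      \<Rightarrow> ('a list \<Rightarrow> 'g) set \<Rightarrow> ('b list \<Rightarrow> 'g) set" where
  "vr_homology_map_at G q f Y B V =
     simplicial_homology_map G q f (vr_complex Y V) (vr_complex B (rel_trace V B))"

definition vr_cohomology_map_at ::
    "('g, 'm) monoid_scheme \<Rightarrow> nat \<Rightarrow> ('a \<Rightarrow> 'b) \<Rightarrow> 'a set \<Rightarrow> 'a set \<Rightarrow> ('a \<times> 'a) set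
      \<Rightarrow> ('b list \<Rightarrow> 'g) set \<Rightarrow> ('a list \<Rightarrow> 'g) set" where
  "vr_cohomology_map_at G q f X A U =
     simplicial_cohomology_map G q f (vr_complex X U) (vr_complex A (rel_trace U A))"

definition vr_homology ::
    "('g, 'm) monoid_scheme \<Rightarrow> nat \<Rightarrow> 'a set \<Rightarrow> 'a set \<Rightarrow> ('a \<times> 'a) set set
      \<Rightarrow> (('a \<times> 'a) set \<Rightarrow> ('a list \<Rightarrow> 'g) set) monoid" where
  "vr_homology G q X A F =
     inverse_limit_group F (\<lambda>U U'. U \<subseteq> U') (vr_homology_at G q X A)
       (\<lambda>U U'. vr_homology_map_at G q id X A U')"

definition vr_cohomology ::
    "('g, 'm) monoid_scheme \<Rightarrow> nat \<Rightarrow> 'a set \<Rightarrow> 'a set \<Rightarrow> ('a \<times> 'a) set set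
      \<Rightarrow> (('a \<times> 'a) set \<times> ('a list \<Rightarrow> 'g) set) set monoid" where
  "vr_cohomology G q X A F =
     direct_limit_group F (\<lambda>U' U. U \<subseteq> U') (vr_cohomology_at G q X A)
       (\<lambda>U' U. vr_cohomology_map_at G q id X A U)"

definition vr_cohomology_class ::
    "('g, 'm) monoid_scheme \<Rightarrow> nat \<Rightarrow> 'a set \<Rightarrow> 'a set \<Rightarrow> ('a \<times> 'a) set set
      \<Rightarrow> ('a \<times> 'a) set \<Rightarrow> ('a list \<Rightarrow> 'g) set \<Rightarrow> (('a \<times> 'a) set \<times> ('a list \<Rightarrow> 'g) set) set" where
  "vr_cohomology_class G q X A F =
     direct_limit_class F (\<lambda>U' U. U \<subseteq> U') (vr_cohomology_at G q X A)
       (\<lambda>U' U. vr_cohomology_map_at G q id X A U)"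

definition vr_homology_map ::
    "('g, 'm) monoid_scheme \<Rightarrow> nat \<Rightarrow> ('a \<times> 'a) set set \<Rightarrow> 'b set \<Rightarrow> 'b set \<Rightarrow> ('b \<times> 'b) set set
      \<Rightarrow> ('a \<Rightarrow> 'b) \<Rightarrow> (('a \<times> 'a) set \<Rightarrow> ('a list \<Rightarrow> 'g) set)
      \<Rightarrow> (('b \<times> 'b) set \<Rightarrow> ('b list \<Rightarrow> 'g) set)" where
  "vr_homology_map G q F Y B F' f \<xi> =
     (\<lambda>V\<in>F'. vr_homology_map_at G q f Y B V (\<xi> (SOME U. U \<in> F \<and> rel_maps_into f U V)))"

definition vr_cohomology_map ::
    "('g, 'm) monoid_scheme \<Rightarrow> nat \<Rightarrow> 'a set \<Rightarrow> 'a set \<Rightarrow> ('a \<times> 'a) set set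
      \<Rightarrow> ('a \<Rightarrow> 'b) \<Rightarrow> (('b \<times> 'b) set \<times> ('b list \<Rightarrow> 'g) set) set
      \<Rightarrow> (('a \<times> 'a) set \<times> ('a list \<Rightarrow> 'g) set) set" where
  "vr_cohomology_map G q X A F f P =
     \<Union> {vr_cohomology_class G q X A F U (vr_cohomology_map_at G q f X A U \<eta>) | V \<eta> U.
          (V, \<eta>) \<in> P \<and> U \<in> F \<and> rel_maps_into f U V}"

end

theory Submission
  imports Defs
begin

text \<open>Functoriality on a single complex is the classical fact that a simplicial map induces a chain
  map; a simplex on which the vertex map is not injective goes to zero, and the signs cancel because
  oriented (co)chains alternate.  Applied to the identity it gives the transition maps of the two
  limits.  For \<open>f\<close> uniformly continuous, any two relations \<open>U\<^sub>1, U\<^sub>2\<close> with \<open>f(U\<^sub>i) \<subseteq> V\<close> are compared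
  through \<open>U\<^sub>1 \<inter> U\<^sub>2\<close>, so the maps induced on \<open>U\<^sub>1\<close> and \<open>U\<^sub>2\<close> agree on compatible families and on
  classes in the direct limit.\<close>

section \<open>Finitely supported products\<close>

text \<open>A chain is a function on vertex lists, so the boundary and the map induced by
  \<open>f\<close> are sums over the fibres of \<open>tl\<close> and of \<open>map f\<close>. The
  chain level identities thus become comparisons of iterated fibre sums, in which leftover terms
  cancel under a sign-reversing involution of lists. Two obstacles shape the details. The fibres can
  be infinite while \<open>finprod\<close> over an infinite set is neutral by default, so sums are
  cut down to the support: this is \<open>supp_prod\<close>, and it has the form in which the
  boundary and the chain map are defined. Moreover \<open>G\<close> may contain elements of order
  two, so \<open>x = inv x\<close> does not give \<open>x = \<one>\<close>. Vanishing on lists with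
  repetitions therefore comes from the support condition and not from alternation, and each
  involution has to move every list that it pairs. On cochains the same point makes the alternating
  sum over a list with repeated entries a separate calculation.\<close>

definition (in comm_monoid) supp_prod :: "('c \<Rightarrow> 'a) \<Rightarrow> 'c set \<Rightarrow> 'a" where
  "supp_prod c S = finprod G c {x \<in> S. c x \<noteq> \<one>}"

context comm_group
begin

lemma supp_prod_closed:
  "(\<And>x. x \<in> S \<Longrightarrow> c x \<in> carrier G) \<Longrightarrow> supp_prod c S \<in> carrier G"
  unfolding supp_prod_def by (rule finprod_closed) auto

lemma supp_prod_eq_finprod:
  assumes "finite F" "F \<subseteq> S" "\<And>x. x \<in> S \<Longrightarrow> x \<notin> F \<Longrightarrow> c x = \<one>" "\<And>x. x \<in> S \<Longrightarrow> c x \<in> carrier G"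
  shows "supp_prod c S = finprod G c F"
  unfolding supp_prod_def
  by (rule finprod_mono_neutral_cong_left) (use assms in auto)

lemma supp_prod_cong:
  assumes "S = T" "\<And>x. x \<in> T \<Longrightarrow> c x = d x" "\<And>x. x \<in> T \<Longrightarrow> d x \<in> carrier G"
  shows "supp_prod c S = supp_prod d T"
  unfolding supp_prod_def
  by (rule finprod_cong') (use assms in auto)

lemma supp_prod_one:
  assumes "\<And>x. x \<in> S \<Longrightarrow> c x = \<one>" shows "supp_prod c S = \<one>"
  unfolding supp_prod_def by (rule finprod_one_eqI) (use assms in auto)

lemma supp_prod_ne_oneE:
  assumes "supp_prod c S \<noteq> \<one>"
  obtains x where "x \<in> S" "c x \<noteq> \<one>"
  using assms supp_prod_one by metis

lemma supp_prod_singleton: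
  assumes "c a \<in> carrier G" shows "supp_prod c {a} = c a"
  by (subst supp_prod_eq_finprod[of "{a}"]) (use assms in \<open>auto simp: Pi_def\<close>)

lemma supp_prod_restrict:
  assumes "T \<subseteq> S" "\<And>x. x \<in> S \<Longrightarrow> x \<notin> T \<Longrightarrow> c x = \<one>"
  shows "supp_prod c S = supp_prod c T"
proof -
  have "{x \<in> S. c x \<noteq> \<one>} = {x \<in> T. c x \<noteq> \<one>}" using assms by auto
  then show ?thesis by (simp add: supp_prod_def)
qed

text \<open>Summation in two stages along the fibres of \<open>h\<close>. This one identity lies
  behind \<open>\<partial>\<partial> = 0\<close>, the compatibility of \<open>f\<close> with the
  boundary and the functoriality of the chain map. The outer set \<open>T\<close> may be infinite
  and larger than the image, since a fibre without support contributes the neutral element.\<close>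

lemma supp_prod_fibre:
  assumes fin: "finite {x \<in> S. c x \<noteq> \<one>}" and c: "\<And>x. x \<in> S \<Longrightarrow> c x \<in> carrier G"
    and h: "h ` S \<subseteq> T"
  shows "supp_prod (\<lambda>y. supp_prod c {x \<in> S. h x = y}) T = supp_prod c S"
proof -
  define F where "F = {x \<in> S. c x \<noteq> \<one>}"
  have F: "finite F" "F \<subseteq> S" using fin by (auto simp: F_def)
  have inner: "supp_prod c {x \<in> S. h x = y} = finprod G c {x \<in> F. h x = y}" for y
    unfolding supp_prod_def F_def by (rule arg_cong[where f = "finprod G c"]) auto
  have "supp_prod (\<lambda>y. supp_prod c {x \<in> S. h x = y}) T
      = finprod G (\<lambda>y. supp_prod c {x \<in> S. h x = y}) (h ` F)"
  proof (rule supp_prod_eq_finprod)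
    fix y assume "y \<notin> h ` F"
    then have "{x \<in> F. h x = y} = {}" by auto
    then show "supp_prod c {x \<in> S. h x = y} = \<one>" by (simp only: inner finprod_empty)
  qed (use F h c in \<open>auto intro!: supp_prod_closed\<close>)
  also have "\<dots> = finprod G (\<lambda>y. finprod G c {x \<in> F. h x = y}) (h ` F)"
    by (simp only: inner)
  also have "\<dots> = finprod G c (\<Union>y\<in>h ` F. {x \<in> F. h x = y})"
    by (rule finprod_UN_disjoint[symmetric]) (use F c in \<open>auto simp: pairwise_def disjnt_def\<close>)
  also have "(\<Union>y\<in>h ` F. {x \<in> F. h x = y}) = F" by auto
  finally show ?thesis by (simp add: supp_prod_def F_def)
qed

lemma supp_prod_reindex:
  assumes "inj_on h S" "\<And>x. x \<in> S \<Longrightarrow> c (h x) \<in> carrier G"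
  shows "supp_prod c (h ` S) = supp_prod (\<lambda>x. c (h x)) S"
proof -
  have "{y \<in> h ` S. c y \<noteq> \<one>} = h ` {x \<in> S. c (h x) \<noteq> \<one>}" by auto
  then show ?thesis unfolding supp_prod_def
    by (simp only:) (rule finprod_reindex, use assms in \<open>auto intro: inj_on_subset\<close>)
qed

lemma supp_prod_mult:
  assumes "finite {x \<in> S. c x \<noteq> \<one>}" "finite {x \<in> S. d x \<noteq> \<one>}"
    and "\<And>x. x \<in> S \<Longrightarrow> c x \<in> carrier G" "\<And>x. x \<in> S \<Longrightarrow> d x \<in> carrier G"
  shows "supp_prod (\<lambda>x. c x \<otimes> d x) S = supp_prod c S \<otimes> supp_prod d S"
proof -
  \<comment> \<open>Cancellation can make the support of the product differ from those of the
    factors, so all three sums are moved to one finite set.\<close>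
  define F where "F = {x \<in> S. c x \<noteq> \<one>} \<union> {x \<in> S. d x \<noteq> \<one>}"
  have F: "finite F" "F \<subseteq> S" using assms by (auto simp: F_def)
  have "supp_prod (\<lambda>x. c x \<otimes> d x) S = finprod G (\<lambda>x. c x \<otimes> d x) F"
    "supp_prod c S = finprod G c F" "supp_prod d S = finprod G d F"
    by (rule supp_prod_eq_finprod; use F assms in \<open>auto simp: F_def\<close>)+
  then show ?thesis using F assms by (simp add: Pi_def subset_iff)
qed

lemma supp_prod_inv:
  assumes "finite {x \<in> S. c x \<noteq> \<one>}" "\<And>x. x \<in> S \<Longrightarrow> c x \<in> carrier G"
  shows "supp_prod (\<lambda>x. inv (c x)) S = inv (supp_prod c S)"
proof (rule inv_equality[symmetric])
  have "{x \<in> S. inv (c x) \<noteq> \<one>} = {x \<in> S. c x \<noteq> \<one>}" using assms(2) by auto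
  then have "supp_prod (\<lambda>x. inv (c x)) S \<otimes> supp_prod c S = supp_prod (\<lambda>x. inv (c x) \<otimes> c x) S"
    by (intro supp_prod_mult[symmetric]) (use assms in auto)
  also have "\<dots> = \<one>" by (rule supp_prod_one) (use assms in auto)
  finally show "supp_prod (\<lambda>x. inv (c x)) S \<otimes> supp_prod c S = \<one>" .
qed (use assms in \<open>auto intro!: supp_prod_closed\<close>)

text \<open>Induction removes the pair \<open>x\<close>, \<open>s x\<close>, whose values multiply
  to the neutral element. The condition \<open>s x \<noteq> x\<close> matters: a fixed point would
  leave a value of which it is only known that it equals its own inverse.\<close>

lemma finprod_involution:
  assumes "finite F"
    and "\<And>x. x \<in> F \<Longrightarrow> c x \<in> carrier G"
    and "\<And>x. x \<in> F \<Longrightarrow> s x \<in> F \<and> s x \<noteq> x \<and> s (s x) = x \<and> c (s x) = inv (c x)"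
  shows "finprod G c F = \<one>"
  using assms
proof (induction F rule: finite_psubset_induct)
  case (psubset F)
  show ?case
  proof (cases "F = {}")
    case False
    then obtain x where x: "x \<in> F" by auto
    define H where "H = F - {x, s x}"
    note inv' = psubset.prems(2)
    have sx: "s x \<in> F" "s x \<noteq> x" "c (s x) = inv (c x)" using inv' x by blast+
    have FH: "F = insert x (insert (s x) H)" "x \<notin> insert (s x) H" "s x \<notin> H" "finite H"
      using x sx psubset.hyps by (auto simp: H_def)
    have c: "c \<in> H \<rightarrow> carrier G" "c x \<in> carrier G" using psubset.prems(1) x by (auto simp: H_def)
    have "finprod G c H = \<one>"
    proof (rule psubset.IH)
      show "H \<subset> F" using x by (auto simp: H_def)
    next
      fix y assume y: "y \<in> H"
      \<comment> \<open>Since \<open>s\<close> is its own inverse on \<open>F\<close>,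
        \<open>s y\<close> can be neither \<open>x\<close> nor \<open>s x\<close> unless
        \<open>y\<close> is one of them.\<close>
      then show "s y \<in> H \<and> s y \<noteq> y \<and> s (s y) = y \<and> c (s y) = inv (c y)"
        using y inv'[of y] inv'[of x] x unfolding H_def by (metis Diff_iff insert_iff empty_iff)
    qed (use c in auto)
    then show ?thesis
      using c FH sx by (simp add: Pi_def)
  qed simp
qed

text \<open>Partners are demanded only where \<open>c\<close> is not neutral. In the applications
  this is where the list is known to be distinct, which gives \<open>s x \<noteq> x\<close>.\<close>

lemma supp_prod_involution:
  assumes "finite {x \<in> S. c x \<noteq> \<one>}" "\<And>x. x \<in> S \<Longrightarrow> c x \<in> carrier G"
    and "\<And>x. x \<in> S \<Longrightarrow> c x \<noteq> \<one> \<Longrightarrow> s x \<in> S \<and> s x \<noteq> x \<and> s (s x) = x \<and> c (s x) = inv (c x)"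
  shows "supp_prod c S = \<one>"
  unfolding supp_prod_def
  by (rule finprod_involution[where s = s]) (use assms in auto)

end

section \<open>Oriented functions\<close>

text \<open>Translates the index transposition of \<open>permute_list\<close> into an exchange of
  two entries of a list written out in pieces; the second index is the place of the entry after
  \<open>vs\<close>. The reason is that a transposed list is a double list update.\<close>

lemma permute_list_transpose:
  "permute_list (transpose (length us) (Suc (length us + length vs))) (us @ a # vs @ b # ws)
    = us @ b # vs @ a # ws"
proof -
  have "permute_list (transpose i j) xs = xs[i := xs ! j, j := xs ! i]"
    if "i < length xs" "j < length xs" for i j and xs :: "'a list"
    by (rule nth_equalityI)
      (use that in \<open>auto simp: permute_list_def nth_list_update transpose_def\<close>)
  then show ?thesis by (simp add: list_update_append nth_append)
qed

lemma list_split_at_two: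
  assumes "i < j" "j < length xs"
  shows "\<exists>us a vs b ws. xs = us @ a # vs @ b # ws \<and> length us = i \<and> length vs = j - Suc i"
proof -
  have "xs = take j xs @ xs ! j # drop (Suc j) xs" using assms by (simp add: id_take_nth_drop)
  moreover have "take j xs = take i (take j xs) @ take j xs ! i # drop (Suc i) (take j xs)"
    using assms by (intro id_take_nth_drop) simp
  ultimately have "xs = take i (take j xs) @ take j xs ! i # drop (Suc i) (take j xs) @ xs ! j # drop (Suc j) xs"
    by (metis append.assoc append_Cons)
  then show ?thesis using assms by (intro exI conjI) (assumption, auto)
qed

text \<open>Reordering the vertices neither creates nor destroys an ordered simplex, so off the
  simplices both sides of an alternation identity are neutral.\<close>

lemma ordered_simplices_mset_eq:
  assumes "mset xs = mset ys"
  shows "xs \<in> ordered_simplices q K \<longleftrightarrow> ys \<in> ordered_simplices q K"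
  using assms mset_eq_length[OF assms] mset_eq_setD[OF assms] mset_eq_imp_distinct_iff[OF assms]
  by (simp add: ordered_simplices_def)

context comm_group
begin

text \<open>Induction on the block between the two entries: moving \<open>v\<close> out of the way,
  exchanging, and moving \<open>v\<close> back costs three sign changes, that is one.\<close>

lemma alternating_transpose:
  assumes carr: "\<And>xs. c xs \<in> carrier G"
    and adj: "\<And>us a b vs. c (us @ a # b # vs) = inv (c (us @ b # a # vs))"
  shows "c (us @ a # vs @ b # ws) = inv (c (us @ b # vs @ a # ws))"
proof (induction vs arbitrary: us)
  case Nil
  show ?case using adj[of us a b ws] by (simp only: append_Nil)
next
  case (Cons v vs)
  have "c (us @ a # v # vs @ b # ws) = inv (c ((us @ [v]) @ a # vs @ b # ws))"
    using adj[of us a v "vs @ b # ws"] by simp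
  also have "\<dots> = c ((us @ [v]) @ b # vs @ a # ws)"
    by (subst Cons) (rule inv_inv, rule carr)
  also have "\<dots> = inv (c (us @ b # v # vs @ a # ws))"
    using adj[of us v b "vs @ a # ws"] by simp
  finally show ?case by simp
qed

text \<open>Alternation under adjacent transpositions is stated for all lists, also with repeated
  entries; there both sides are neutral.\<close>

lemma oriented_functions_iff:
  "c \<in> oriented_functions G q K \<longleftrightarrow>
     (\<forall>xs. c xs \<in> carrier G) \<and> (\<forall>xs. xs \<notin> ordered_simplices q K \<longrightarrow> c xs = \<one>) \<and>
     (\<forall>us a b vs. c (us @ a # b # vs) = inv (c (us @ b # a # vs)))"
  (is "_ \<longleftrightarrow> ?carr \<and> ?supp \<and> ?adj")
proof (intro iffI conjI)
  assume c: "c \<in> oriented_functions G q K"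
  show supp: ?supp using c by (simp add: oriented_functions_def)
  show ?carr
  proof
    fix xs show "c xs \<in> carrier G"
      using c by (cases "xs \<in> ordered_simplices q K") (auto simp: oriented_functions_def)
  qed
  show ?adj
  proof (intro allI)
    fix us vs :: "'c list" and a b
    show "c (us @ a # b # vs) = inv (c (us @ b # a # vs))"
    proof (cases "us @ b # a # vs \<in> ordered_simplices q K")
      case True
      define p where "p = transpose (length us) (Suc (length us))"
      have "Suc (length us) < Suc q" using True by (auto simp: ordered_simplices_def)
      then have "p permutes {..<Suc q}" unfolding p_def by (intro permutes_swap_id) auto
      then have "c (permute_list p (us @ b # a # vs))
          = (if evenperm p then c (us @ b # a # vs) else inv (c (us @ b # a # vs)))"
        using c True unfolding oriented_functions_def by blast
      then show ?thesis using permute_list_transpose[of us "[]" b a vs] by (simp add: p_def evenperm_swap)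
    next
      case False
      moreover from False have "us @ a # b # vs \<notin> ordered_simplices q K"
        by (subst ordered_simplices_mset_eq[of _ "us @ b # a # vs"]) auto
      ultimately show ?thesis using supp by simp
    qed
  qed
next
  assume "?carr \<and> ?supp \<and> ?adj"
  then have carr: "\<And>xs. c xs \<in> carrier G" and supp: ?supp
    and adj: "\<And>us a b vs. c (us @ a # b # vs) = inv (c (us @ b # a # vs))" by blast+
  \<comment> \<open>Equal indices are excluded because they give the identity permutation, which is
    even.\<close>
  have transp: "c (permute_list (transpose i j) xs) = inv (c xs)"
    if "i < length xs" "j < length xs" "i \<noteq> j" for i j xs
    using that
  proof (induction i j rule: linorder_wlog)
    case (le i j)
    then obtain us a vs b ws where "xs = us @ a # vs @ b # ws" "length us = i" "length vs = j - Suc i"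
      using list_split_at_two[of i j xs] by auto
    with le show ?case
      using permute_list_transpose[of us vs a b ws]
        alternating_transpose[of c us b vs a ws, OF carr adj] by simp
  next
    case (sym i j)
    then show ?case by (simp add: transpose_commute)
  qed
  have "c (permute_list p xs) = (if evenperm p then c xs else inv (c xs))"
    if len: "length xs = Suc q" and p: "p permutes {..<Suc q}" for xs p
    using finite_lessThan p len
  proof (induction arbitrary: xs rule: permutes_rev_induct)
    \<comment> \<open>A transposition composed on the right of \<open>p\<close> acts on the list
      after \<open>p\<close> has acted, so \<open>transp\<close> applies to the reordered list, and
      the parity flips once.\<close>
    case (swap i j p)
    have "permute_list (p \<circ> transpose i j) xs = permute_list (transpose i j) (permute_list p xs)"
      using swap by (intro permute_list_compose permutes_swap_id) auto
    moreover have "evenperm (p \<circ> transpose i j) = (\<not> evenperm p)"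
      using swap permutes_imp_permutation[OF finite_lessThan swap.hyps(4)]
      by (subst evenperm_comp) (auto simp: evenperm_swap permutation_swap_id)
    ultimately show ?case
      using swap.IH[of xs] swap.hyps swap.prems carr by (simp add: transp o_def)
  qed simp
  then show "c \<in> oriented_functions G q K"
    using carr supp by (auto simp: oriented_functions_def ordered_simplices_def)
qed

end

section \<open>The chain complex of a simplicial complex\<close>

definition subset_closed :: "'a set set \<Rightarrow> bool" where
  "subset_closed K \<longleftrightarrow> (\<forall>S\<in>K. \<forall>T. T \<noteq> {} \<and> T \<subseteq> S \<longrightarrow> T \<in> K)"

text \<open>A total function on lists, so that it can serve both as a reindexing of the fibres of
  \<open>map f\<close> and as the pairing in the proof of
  \<open>\<partial>\<partial> = 0\<close>.\<close>

definition adjacent_swap :: "nat \<Rightarrow> 'a list \<Rightarrow> 'a list" where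
  "adjacent_swap k xs = take k xs @ xs ! Suc k # xs ! k # drop (Suc (Suc k)) xs"

lemma adjacent_swap_append [simp]:
  "adjacent_swap (length us) (us @ a # b # vs) = us @ b # a # vs"
  by (simp add: adjacent_swap_def nth_append)

lemma ordered_simplices_mono: "L \<subseteq> K \<Longrightarrow> ordered_simplices q L \<subseteq> ordered_simplices q K"
  by (auto simp: ordered_simplices_def)

lemma ordered_simplices_face:
  assumes "subset_closed K" "us @ a # vs \<in> ordered_simplices (Suc q) K"
  shows "us @ vs \<in> ordered_simplices q K"
proof -
  \<comment> \<open>The face still has \<open>Suc q\<close> entries, hence is nonempty as
    \<open>subset_closed\<close> demands; this is why the simplex is taken in degree
    \<open>Suc q\<close>.\<close>
  have "us @ vs \<noteq> []" using assms(2) by (auto simp: ordered_simplices_def)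
  then have "set (us @ vs) \<noteq> {}" by (metis set_empty)
  moreover have "set (us @ vs) \<subseteq> set (us @ a # vs)" by auto
  ultimately have "set (us @ vs) \<in> K"
    using assms(1)[unfolded subset_closed_def, rule_format, of "set (us @ a # vs)"] assms(2)
    by (simp add: ordered_simplices_def)
  then show ?thesis using assms(2) by (auto simp: ordered_simplices_def)
qed

lemma ordered_simplices_map:
  assumes "\<And>S. S \<in> K \<Longrightarrow> f ` S \<in> K'" "xs \<in> ordered_simplices q K" "distinct (map f xs)"
  shows "map f xs \<in> ordered_simplices q K'"
  using assms(1)[of "set xs"] assms(2,3) by (auto simp: ordered_simplices_def)

context comm_group
begin

lemma simplicial_chains_iff:
  "c \<in> simplicial_chains G q K \<longleftrightarrow>
     (\<forall>xs. c xs \<in> carrier G) \<and> (\<forall>xs. xs \<notin> ordered_simplices q K \<longrightarrow> c xs = \<one>) \<and>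
     (\<forall>us a b vs. c (us @ a # b # vs) = inv (c (us @ b # a # vs))) \<and> finite {xs. c xs \<noteq> \<one>}"
  by (auto simp: simplicial_chains_def oriented_functions_iff)

lemma simplicial_chainsD:
  assumes "c \<in> simplicial_chains G q K"
  shows "c xs \<in> carrier G" "c xs \<noteq> \<one> \<Longrightarrow> xs \<in> ordered_simplices q K" "\<not> distinct xs \<Longrightarrow> c xs = \<one>"
    "c (us @ a # b # vs) = inv (c (us @ b # a # vs))"
    "finite {xs. c xs \<noteq> \<one>}" "finite {xs \<in> S. c xs \<noteq> \<one>}"
proof -
  note c = assms[unfolded simplicial_chains_iff]
  show "c xs \<in> carrier G" "c (us @ a # b # vs) = inv (c (us @ b # a # vs))"
    and fin: "finite {xs. c xs \<noteq> \<one>}" using c by blast+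
  show supp: "c xs \<noteq> \<one> \<Longrightarrow> xs \<in> ordered_simplices q K" using c by blast
  show "\<not> distinct xs \<Longrightarrow> c xs = \<one>" using supp by (auto simp: ordered_simplices_def)
  show "finite {xs \<in> S. c xs \<noteq> \<one>}" by (rule finite_subset[OF _ fin]) auto
qed

lemma simplicial_chains_mono:
  "L \<subseteq> K \<Longrightarrow> simplicial_chains G q L \<subseteq> simplicial_chains G q K"
  unfolding simplicial_chains_iff subset_iff using ordered_simplices_mono[of L K q] by blast

lemma simplicial_boundary_Nil [simp]: "simplicial_boundary G c [] = \<one>"
  by (simp add: simplicial_boundary_def)

lemma simplicial_boundary_eq:
  assumes "w \<noteq> []"
  shows "simplicial_boundary G c w = supp_prod (\<lambda>v. c (v # w)) UNIV"
  using assms by (simp add: simplicial_boundary_def supp_prod_def)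

text \<open>Prepending a vertex to \<open>w\<close> parametrises the fibre of \<open>tl\<close> over
  \<open>w\<close>. In this form iterated boundaries fall under
  \<open>supp_prod_fibre\<close>.\<close>

lemma simplicial_boundary_eq_fibre:
  assumes "\<And>xs. c xs \<in> carrier G" "w \<noteq> []"
  shows "simplicial_boundary G c w = supp_prod c {xs. xs \<noteq> [] \<and> tl xs = w}"
proof -
  have "{xs. xs \<noteq> [] \<and> tl xs = w} = (\<lambda>v. v # w) ` UNIV"
    by (force simp: neq_Nil_conv)
  then show ?thesis
    using assms by (simp add: simplicial_boundary_eq supp_prod_reindex inj_on_def)
qed

lemma simplicial_boundary_closed [simp]:
  "(\<And>xs. c xs \<in> carrier G) \<Longrightarrow> simplicial_boundary G c w \<in> carrier G"
  by (cases "w = []") (auto simp: simplicial_boundary_eq intro: supp_prod_closed)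

lemma simplicial_boundary_ne_oneE:
  assumes "simplicial_boundary G c w \<noteq> \<one>"
  obtains v where "w \<noteq> []" "c (v # w) \<noteq> \<one>"
proof -
  have "w \<noteq> []" using assms by auto
  with assms that show ?thesis by (auto simp: simplicial_boundary_eq elim: supp_prod_ne_oneE)
qed

lemma finite_support_Cons:
  "finite {xs. c xs \<noteq> \<one>} \<Longrightarrow> finite {v. c (v # w) \<noteq> \<one>}"
  by (rule finite_subset[of _ "hd ` {xs. c xs \<noteq> \<one>}"]) (force, simp)

lemma simplicial_boundary_mult:
  assumes "finite {xs. c xs \<noteq> \<one>}" "finite {xs. d xs \<noteq> \<one>}"
    and "\<And>xs. c xs \<in> carrier G" "\<And>xs. d xs \<in> carrier G"
  shows "simplicial_boundary G (\<lambda>xs. c xs \<otimes> d xs)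
    = (\<lambda>w. simplicial_boundary G c w \<otimes> simplicial_boundary G d w)"
proof
  fix w show "simplicial_boundary G (\<lambda>xs. c xs \<otimes> d xs) w
    = simplicial_boundary G c w \<otimes> simplicial_boundary G d w"
    using assms by (cases "w = []")
      (auto simp: simplicial_boundary_eq finite_support_Cons intro!: supp_prod_mult)
qed

lemma simplicial_boundary_inv:
  assumes "finite {xs. c xs \<noteq> \<one>}" "\<And>xs. c xs \<in> carrier G"
  shows "simplicial_boundary G (\<lambda>xs. inv (c xs)) = (\<lambda>w. inv (simplicial_boundary G c w))"
proof
  fix w show "simplicial_boundary G (\<lambda>xs. inv (c xs)) w = inv (simplicial_boundary G c w)"
    using assms by (cases "w = []")
      (auto simp: simplicial_boundary_eq finite_support_Cons intro!: supp_prod_inv)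
qed

lemma simplicial_boundary_one: "simplicial_boundary G (\<lambda>xs. \<one>) = (\<lambda>w. \<one>)"
  by (auto simp: simplicial_boundary_def fun_eq_iff intro: finprod_one_eqI)

text \<open>A nonneutral value at \<open>w\<close> has a witness \<open>v # w\<close> in the support
  of \<open>c\<close>. Hence \<open>w\<close> is a face of a simplex and lies in the image of a
  finite set under \<open>tl\<close>. Alternation passes on because the summed vertex stands in
  front of both exchanged entries.\<close>

lemma simplicial_boundary_in_chains:
  assumes K: "subset_closed K" and c: "c \<in> simplicial_chains G (Suc q) K"
  shows "simplicial_boundary G c \<in> simplicial_chains G q K"
proof -
  note cD = simplicial_chainsD[OF c]
  have supp: "w \<in> ordered_simplices q K" if "simplicial_boundary G c w \<noteq> \<one>" for w
    using simplicial_boundary_ne_oneE[OF that] cD(2) ordered_simplices_face[OF K, of "[]"]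
    by (metis append_Nil)
  have "{w. simplicial_boundary G c w \<noteq> \<one>} \<subseteq> tl ` {xs. c xs \<noteq> \<one>}"
    by (force elim: simplicial_boundary_ne_oneE)
  then have fin: "finite {w. simplicial_boundary G c w \<noteq> \<one>}"
    using cD(5) finite_surj by blast
  have "simplicial_boundary G c (us @ a # b # vs) = inv (simplicial_boundary G c (us @ b # a # vs))"
    for us a b vs
  proof -
    have "simplicial_boundary G c (us @ a # b # vs)
        = supp_prod (\<lambda>v. inv (c (v # us @ b # a # vs))) UNIV"
      using cD(1) cD(4)[of "_ # us" a b vs]
      by (auto simp: simplicial_boundary_eq intro!: supp_prod_cong)
    also have "\<dots> = inv (simplicial_boundary G c (us @ b # a # vs))"
      using cD(1,5) by (simp add: simplicial_boundary_eq finite_support_Cons supp_prod_inv)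
    finally show ?thesis .
  qed
  then show ?thesis
    unfolding simplicial_chains_iff using supp fin simplicial_boundary_closed[of c, OF cD(1)]
    by (intro conjI allI impI) (assumption | blast)+
qed

text \<open>The two sums merge into one over the lists \<open>a # b # w\<close>, and exchanging
  \<open>a\<close> and \<open>b\<close> pairs these lists with opposite signs. No signs from face
  positions occur, since the removed vertex always stands at the front.\<close>

lemma simplicial_boundary_boundary:
  assumes c: "c \<in> simplicial_chains G q K"
  shows "simplicial_boundary G (simplicial_boundary G c) = (\<lambda>w. \<one>)"
proof
  fix w :: "'c list"
  note cD = simplicial_chainsD[OF c]
  define S where "S = {xs. xs \<noteq> [] \<and> tl xs \<noteq> [] \<and> tl (tl xs) = w}"
  show "simplicial_boundary G (simplicial_boundary G c) w = \<one>"
  proof (cases "w = []")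
    case False
    have "simplicial_boundary G (simplicial_boundary G c) w
        = supp_prod (\<lambda>ys. supp_prod c {xs. xs \<noteq> [] \<and> tl xs = ys}) {ys. ys \<noteq> [] \<and> tl ys = w}"
      using False cD(1)
      by (auto simp: simplicial_boundary_eq_fibre intro!: supp_prod_cong supp_prod_closed)
    also have "\<dots> = supp_prod (\<lambda>ys. supp_prod c {xs \<in> S. tl xs = ys}) {ys. ys \<noteq> [] \<and> tl ys = w}"
      by (intro supp_prod_cong arg_cong[where f = "supp_prod c"] supp_prod_closed)
        (auto simp: S_def cD(1))
    also have "\<dots> = supp_prod c S"
      by (rule supp_prod_fibre) (use cD in \<open>auto simp: S_def\<close>)
    also have "\<dots> = \<one>"
    proof (rule supp_prod_involution[where s = "adjacent_swap 0"])
      fix xs assume xs: "xs \<in> S" "c xs \<noteq> \<one>"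
      then obtain a b where "xs = [] @ a # b # w" by (auto simp: S_def neq_Nil_conv)
      \<comment> \<open>\<open>c\<close> is neutral on lists with a repetition, so the exchange
        fixes no list in the support.\<close>
      moreover from this have "a \<noteq> b" using xs cD(3)[of xs] by auto
      ultimately show "adjacent_swap 0 xs \<in> S \<and> adjacent_swap 0 xs \<noteq> xs
          \<and> adjacent_swap 0 (adjacent_swap 0 xs) = xs \<and> c (adjacent_swap 0 xs) = inv (c xs)"
        using cD(4)[of "[]" b a w] by (auto simp: adjacent_swap_def S_def)
    qed (use cD in auto)
    finally show ?thesis .
  qed simp
qed

section \<open>Chain maps induced by vertex maps\<close>

lemma simplicial_chain_map_eq:
  "distinct ys \<Longrightarrow> simplicial_chain_map G f c ys = supp_prod c {xs. map f xs = ys}"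
  by (simp add: simplicial_chain_map_def supp_prod_def)

lemma simplicial_chain_map_not_distinct [simp]:
  "\<not> distinct ys \<Longrightarrow> simplicial_chain_map G f c ys = \<one>"
  by (simp add: simplicial_chain_map_def)

lemma simplicial_chain_map_closed:
  "(\<And>xs. c xs \<in> carrier G) \<Longrightarrow> simplicial_chain_map G f c ys \<in> carrier G"
  by (cases "distinct ys") (auto simp: simplicial_chain_map_eq intro: supp_prod_closed)

lemma simplicial_chain_map_ne_oneE:
  assumes "simplicial_chain_map G f c ys \<noteq> \<one>"
  obtains xs where "distinct ys" "map f xs = ys" "c xs \<noteq> \<one>"
proof -
  have "distinct ys" using assms by (metis simplicial_chain_map_not_distinct)
  with assms that show ?thesis by (auto simp: simplicial_chain_map_eq elim: supp_prod_ne_oneE)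
qed

lemma simplicial_chain_map_mult:
  assumes "finite {xs. c xs \<noteq> \<one>}" "finite {xs. d xs \<noteq> \<one>}"
    and "\<And>xs. c xs \<in> carrier G" "\<And>xs. d xs \<in> carrier G"
  shows "simplicial_chain_map G f (\<lambda>xs. c xs \<otimes> d xs)
    = (\<lambda>ys. simplicial_chain_map G f c ys \<otimes> simplicial_chain_map G f d ys)"
proof
  fix ys show "simplicial_chain_map G f (\<lambda>xs. c xs \<otimes> d xs) ys
    = simplicial_chain_map G f c ys \<otimes> simplicial_chain_map G f d ys"
    using assms by (cases "distinct ys") (auto simp: simplicial_chain_map_eq intro!: supp_prod_mult)
qed

text \<open>For alternation, the exchange at position \<open>length us\<close> is a bijection
  between the fibres of \<open>map f\<close> over a list and over the exchanged list, and
  \<open>c\<close> changes sign along it. Collapsed simplices do not enter, since the chain map is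
  neutral at lists with repetitions.\<close>

lemma simplicial_chain_map_in_chains:
  assumes f: "\<And>S. S \<in> K \<Longrightarrow> f ` S \<in> K'" and c: "c \<in> simplicial_chains G q K"
  shows "simplicial_chain_map G f c \<in> simplicial_chains G q K'"
proof -
  note cD = simplicial_chainsD[OF c]
  have supp: "ys \<in> ordered_simplices q K'" if "simplicial_chain_map G f c ys \<noteq> \<one>" for ys
    using that cD(2) ordered_simplices_map[of K f K', OF f] by (metis simplicial_chain_map_ne_oneE)
  have "{ys. simplicial_chain_map G f c ys \<noteq> \<one>} \<subseteq> map f ` {xs. c xs \<noteq> \<one>}"
    by (auto elim!: simplicial_chain_map_ne_oneE)
  then have fin: "finite {ys. simplicial_chain_map G f c ys \<noteq> \<one>}"
    using cD(5) finite_surj by blast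
  have "simplicial_chain_map G f c (us @ a # b # vs)
      = inv (simplicial_chain_map G f c (us @ b # a # vs))" for us a b vs
  proof (cases "distinct (us @ a # b # vs)")
    case True
    then have dist: "distinct (us @ b # a # vs)" by auto
    let ?s = "adjacent_swap (length us)"
    \<comment> \<open>A preimage under \<open>map f\<close> breaks at the same positions as its
      image, so the exchange can be carried out on the preimage.\<close>
    have split: "\<exists>us' a' b' vs'. xs = us' @ a' # b' # vs' \<and> length us' = length us
        \<and> map f us' = us \<and> f a' = a \<and> f b' = b \<and> map f vs' = vs"
      if "map f xs = us @ a # b # vs" for xs a b
      using that by (fastforce simp: map_eq_append_conv map_eq_Cons_conv)
    have maps: "map f (?s xs) = us @ b # a # vs" and swap2: "?s (?s xs) = xs"
      and csw: "c (?s xs) = inv (c xs)"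
      if xs: "map f xs = us @ a # b # vs" for xs a b
    proof -
      obtain us' a' b' vs' where *: "xs = us' @ a' # b' # vs'" "length us' = length us"
        "map f us' = us" "f a' = a" "f b' = b" "map f vs' = vs" using split[OF xs] by blast
      have s: "?s xs = us' @ b' # a' # vs'" "?s (us' @ b' # a' # vs') = xs"
        unfolding *(1) *(2)[symmetric] by (rule adjacent_swap_append)+
      show "map f (?s xs) = us @ b # a # vs" using s(1) * by simp
      show "?s (?s xs) = xs" using s by simp
      show "c (?s xs) = inv (c xs)" unfolding s(1) unfolding *(1) by (rule cD(4))
    qed
    have "{xs. map f xs = us @ a # b # vs} = ?s ` {xs. map f xs = us @ b # a # vs}"
    proof (intro equalityI subsetI)
      fix xs assume "xs \<in> {xs. map f xs = us @ a # b # vs}"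
      then show "xs \<in> ?s ` {xs. map f xs = us @ b # a # vs}"
        using maps[of xs a b] swap2[of xs a b] by (intro image_eqI[of _ _ "?s xs"]) auto
    qed (use maps in auto)
    then have "simplicial_chain_map G f c (us @ a # b # vs)
        = supp_prod c (?s ` {xs. map f xs = us @ b # a # vs})"
      using True by (simp only: simplicial_chain_map_eq)
    also have "\<dots> = supp_prod (\<lambda>xs. c (?s xs)) {xs. map f xs = us @ b # a # vs}"
      by (rule supp_prod_reindex, rule inj_on_inverseI[of _ ?s]) (use swap2 cD(1) in auto)
    also have "\<dots> = supp_prod (\<lambda>xs. inv (c xs)) {xs. map f xs = us @ b # a # vs}"
      by (rule supp_prod_cong) (use csw cD(1) in auto)
    also have "\<dots> = inv (simplicial_chain_map G f c (us @ b # a # vs))"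
      using dist cD by (simp only: simplicial_chain_map_eq) (rule supp_prod_inv, auto)
    finally show ?thesis .
  next
    case False
    then have "\<not> distinct (us @ b # a # vs)" by auto
    with False show ?thesis by (simp del: distinct_append)
  qed
  then show ?thesis
    unfolding simplicial_chains_iff using supp fin simplicial_chain_map_closed[of c f, OF cD(1)]
    by (intro conjI allI impI) (assumption | blast)+
qed

text \<open>The simplices that \<open>f\<close> collapses contribute to \<open>f\<^sub>#(\<partial>c)\<close> only through the faces on which
  \<open>f\<close> is injective, and exchanging the two vertices with the same image cancels these in pairs.\<close>

lemma simplicial_chain_map_boundary:
  assumes c: "c \<in> simplicial_chains G q K"
  shows "simplicial_chain_map G f (simplicial_boundary G c)
    = simplicial_boundary G (simplicial_chain_map G f c)"
proof
  fix w :: "'d list"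
  note cD = simplicial_chainsD[OF c]
  note fcD = simplicial_chain_map_closed[of c f, OF cD(1)]
  \<comment> \<open>\<open>S\<close> consists of the lists formed by a vertex in front of a preimage
    of \<open>w\<close>, and \<open>D\<close> of those among them on which \<open>f\<close> is
    injective. The sum over \<open>S - D\<close> is to cancel.\<close>
  define S where "S = {xs. xs \<noteq> [] \<and> map f (tl xs) = w}"
  define D where "D = {xs \<in> S. distinct (map f xs)}"
  \<comment> \<open>Unless \<open>w\<close> is nonempty and distinct, both sides are neutral: at the
    empty list by the unreduced convention, and at a repeating \<open>w\<close> because the chain
    map is neutral at \<open>w\<close> and at every \<open>v # w\<close>.\<close>
  consider "w = []" | "w \<noteq> []" "\<not> distinct w" | "w \<noteq> []" "distinct w" by blast
  then show "simplicial_chain_map G f (simplicial_boundary G c) w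
    = simplicial_boundary G (simplicial_chain_map G f c) w"
  proof cases
    case 1
    then show ?thesis by (auto simp: simplicial_chain_map_eq intro: supp_prod_one)
  next
    case 2
    then show ?thesis by (auto simp: simplicial_boundary_eq intro!: supp_prod_one[symmetric])
  next
    case 3
    have "simplicial_chain_map G f (simplicial_boundary G c) w
        = supp_prod (\<lambda>zs. supp_prod c {xs. xs \<noteq> [] \<and> tl xs = zs}) {zs. map f zs = w}"
      unfolding simplicial_chain_map_eq[OF 3(2)]
    proof (rule supp_prod_cong[OF refl])
      fix zs assume "zs \<in> {zs. map f zs = w}"
      then have "zs \<noteq> []" using 3 by auto
      then show "simplicial_boundary G c zs = supp_prod c {xs. xs \<noteq> [] \<and> tl xs = zs}"
        by (rule simplicial_boundary_eq_fibre[OF cD(1)])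
    qed (use cD in \<open>auto intro: supp_prod_closed\<close>)
    also have "\<dots> = supp_prod (\<lambda>zs. supp_prod c {xs \<in> S. tl xs = zs}) {zs. map f zs = w}"
      by (intro supp_prod_cong arg_cong[where f = "supp_prod c"] supp_prod_closed)
        (auto simp: S_def cD(1))
    also have "\<dots> = supp_prod c S"
      by (rule supp_prod_fibre) (use cD in \<open>auto simp: S_def\<close>)
    also have "S = D \<union> (S - D)" by (auto simp: D_def)
    also have "supp_prod c \<dots> = supp_prod c D \<otimes> supp_prod c (S - D)"
    proof -
      have "{xs \<in> D \<union> (S - D). c xs \<noteq> \<one>} = {xs \<in> D. c xs \<noteq> \<one>} \<union> {xs \<in> S - D. c xs \<noteq> \<one>}"
        by auto
      then show ?thesis unfolding supp_prod_def
        by (simp only:) (rule finprod_Un_disjoint, use cD in auto)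
    qed
    also have "supp_prod c (S - D) = \<one>"
    proof (rule supp_prod_involution)
      \<comment> \<open>\<open>Suc (k xs)\<close> is the position of the vertex with the same image
        as the head. It is unique because the tail maps to the distinct list
        \<open>w\<close>.\<close>
      define k where "k xs = (THE k. Suc k < length xs \<and> f (xs ! Suc k) = f (hd xs))" for xs
      let ?s = "\<lambda>xs. xs[0 := xs ! Suc (k xs), Suc (k xs) := xs ! 0]"
      fix xs assume xs: "xs \<in> S - D" "c xs \<noteq> \<one>"
      have dist: "distinct xs" using xs(2) cD(3) by blast
      obtain v zs where v: "xs = v # zs" "map f zs = w" using xs by (auto simp: S_def neq_Nil_conv)
      have "f v \<in> set w" using xs(1) v 3 by (auto simp: S_def D_def)
      then obtain b where "b \<in> set zs" "f b = f v" using v(2) by auto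
      then obtain us ws where zs: "zs = us @ b # ws" "f b = f v" by (meson split_list)
      have xs_eq: "xs = [] @ v # us @ b # ws" using v zs by simp
      have inj: "distinct (map f (us @ b # ws))" using v zs 3 by simp
      \<comment> \<open>Needed for both orders of the two vertices, because applying the exchange
        twice recomputes the position after the first exchange.\<close>
      have kk: "k (x # us @ y # ws) = length us" if "f x = f v" "f y = f v" for x y
        unfolding k_def
      proof (rule the_equality)
        fix l assume l: "Suc l < length (x # us @ y # ws) \<and> f ((x # us @ y # ws) ! Suc l) = f (hd (x # us @ y # ws))"
        then have "map f (us @ b # ws) ! l = map f (us @ b # ws) ! length us"
          using that zs by (auto simp: nth_append nth_Cons' split: if_splits)
        then show "l = length us"
          using l inj by (subst (asm) nth_eq_iff_index_eq) auto
      qed (use that in \<open>auto simp: nth_append\<close>)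
      have s1: "?s xs = b # us @ v # ws" using kk[of v b] zs unfolding v
        by (simp add: nth_append list_update_append)
      have s2: "?s (b # us @ v # ws) = xs" using kk[of b v] zs unfolding v
        by (simp add: nth_append list_update_append)
      show "?s xs \<in> S - D \<and> ?s xs \<noteq> xs \<and> ?s (?s xs) = xs \<and> c (?s xs) = inv (c xs)"
      proof (intro conjI)
        show "?s xs \<in> S - D" unfolding s1 using v zs by (auto simp: S_def D_def)
        show "?s xs \<noteq> xs" unfolding s1 using dist by (auto simp: xs_eq)
        show "?s (?s xs) = xs" unfolding s1 by (rule s2)
        show "c (?s xs) = inv (c xs)" unfolding s1
          using alternating_transpose[of c "[]" b us v ws, OF cD(1,4)] by (simp add: xs_eq)
      qed
    qed (use cD in auto)
    also have "supp_prod c D \<otimes> \<one> = supp_prod c D" using cD(1) by (simp add: supp_prod_closed)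
    \<comment> \<open>The remaining lists are grouped by their image, which is distinct with tail
      \<open>w\<close>.\<close>
    also have "\<dots> = supp_prod (\<lambda>ys. supp_prod c {xs \<in> D. map f xs = ys})
        {ys. distinct ys \<and> ys \<noteq> [] \<and> tl ys = w}"
      by (rule supp_prod_fibre[symmetric]) (use cD in \<open>auto simp: D_def S_def map_tl\<close>)
    also have "\<dots> = supp_prod (simplicial_chain_map G f c) {ys. distinct ys \<and> ys \<noteq> [] \<and> tl ys = w}"
    proof (rule supp_prod_cong[OF refl])
      fix ys assume ys: "ys \<in> {ys. distinct ys \<and> ys \<noteq> [] \<and> tl ys = w}"
      then have "{xs \<in> D. map f xs = ys} = {xs. map f xs = ys}" by (auto simp: D_def S_def map_tl)
      with ys show "supp_prod c {xs \<in> D. map f xs = ys} = simplicial_chain_map G f c ys"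
        by (simp add: simplicial_chain_map_eq)
    qed (use fcD in auto)
    \<comment> \<open>The chain map is neutral at the lists added here, which have
      repetitions.\<close>
    also have "\<dots> = supp_prod (simplicial_chain_map G f c) {ys. ys \<noteq> [] \<and> tl ys = w}"
      by (rule supp_prod_restrict[symmetric]) auto
    also have "\<dots> = simplicial_boundary G (simplicial_chain_map G f c) w"
      by (rule simplicial_boundary_eq_fibre[symmetric]) (use fcD 3 in auto)
    finally show ?thesis .
  qed
qed

text \<open>The fibre of \<open>map (g \<circ> f)\<close> over \<open>zs\<close> is the union of the
  fibres of \<open>map f\<close> over the preimages \<open>ys\<close> of \<open>zs\<close>. If
  \<open>zs\<close> is distinct then so is every such \<open>ys\<close>, so the neutral default of
  the inner chain map never intervenes.\<close>

lemma simplicial_chain_map_comp: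
  assumes c: "c \<in> simplicial_chains G q K"
  shows "simplicial_chain_map G g (simplicial_chain_map G f c) = simplicial_chain_map G (g \<circ> f) c"
proof
  fix zs
  note cD = simplicial_chainsD[OF c]
  show "simplicial_chain_map G g (simplicial_chain_map G f c) zs = simplicial_chain_map G (g \<circ> f) c zs"
  proof (cases "distinct zs")
    case True
    have "simplicial_chain_map G g (simplicial_chain_map G f c) zs
        = supp_prod (\<lambda>ys. supp_prod c {xs \<in> {xs. map (g \<circ> f) xs = zs}. map f xs = ys})
            {ys. map g ys = zs}"
      unfolding simplicial_chain_map_eq[OF True]
    proof (rule supp_prod_cong[OF refl])
      fix ys assume ys: "ys \<in> {ys. map g ys = zs}"
      then have "{xs \<in> {xs. map (g \<circ> f) xs = zs}. map f xs = ys} = {xs. map f xs = ys}"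
        by auto
      moreover have "distinct ys" using ys True by (auto simp: distinct_map)
      ultimately show "simplicial_chain_map G f c ys
        = supp_prod c {xs \<in> {xs. map (g \<circ> f) xs = zs}. map f xs = ys}"
        by (simp only: simplicial_chain_map_eq)
    qed (use cD in \<open>auto intro: supp_prod_closed\<close>)
    also have "\<dots> = supp_prod c {xs. map (g \<circ> f) xs = zs}"
      by (rule supp_prod_fibre) (use cD in auto)
    finally show ?thesis using True by (simp add: simplicial_chain_map_eq)
  qed simp
qed

lemma simplicial_chain_map_id:
  assumes c: "c \<in> simplicial_chains G q K"
  shows "simplicial_chain_map G id c = c"
proof
  fix xs
  show "simplicial_chain_map G id c xs = c xs"
    using simplicial_chainsD[OF c]
    by (cases "distinct xs") (auto simp: simplicial_chain_map_eq supp_prod_singleton)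
qed

end

section \<open>The cochain complex of a simplicial complex\<close>

context comm_group
begin

lemma finprod_inv:
  assumes "\<And>i. i \<in> A \<Longrightarrow> f i \<in> carrier G"
  shows "finprod G (\<lambda>i. inv (f i)) A = inv (finprod G f A)"
proof (rule inv_equality[symmetric])
  have "finprod G (\<lambda>i. inv (f i)) A \<otimes> finprod G f A = finprod G (\<lambda>i. inv (f i) \<otimes> f i) A"
    by (rule finprod_multf[symmetric]) (use assms in auto)
  also have "\<dots> = \<one>" by (rule finprod_one_eqI) (use assms in auto)
  finally show "finprod G (\<lambda>i. inv (f i)) A \<otimes> finprod G f A = \<one>" .
qed (use assms in auto)

text \<open>The alternating sum over the faces of a list.  In this recursive form \<open>\<delta> \<circ> \<delta> = 0\<close> needs no
  index manipulation.\<close>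

primrec alternating_sum :: "('c list \<Rightarrow> 'a) \<Rightarrow> 'c list \<Rightarrow> 'a" where
  "alternating_sum \<phi> [] = \<one>"
| "alternating_sum \<phi> (x # xs) = \<phi> xs \<otimes> inv (alternating_sum (\<lambda>ys. \<phi> (x # ys)) xs)"

lemma alternating_sum_closed [simp]:
  "(\<And>xs. \<phi> xs \<in> carrier G) \<Longrightarrow> alternating_sum \<phi> xs \<in> carrier G"
  by (induction xs arbitrary: \<phi>) auto

text \<open>The face without the head is the term of index 0. In the remaining faces the position
  shifts by one, which reverses every sign and accounts for the inverse in the recursion.\<close>

lemma alternating_sum_eq_finprod:
  assumes "\<And>xs. \<phi> xs \<in> carrier G" "length xs = Suc n"
  shows "alternating_sum \<phi> xs
    = finprod G (\<lambda>i. if even i then \<phi> (take i xs @ drop (Suc i) xs)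
                       else inv (\<phi> (take i xs @ drop (Suc i) xs))) {..n}"
  using assms
proof (induction n arbitrary: \<phi> xs)
  case 0
  then show ?case by (auto simp: length_Suc_conv)
next
  case (Suc n)
  then obtain x ys where xs: "xs = x # ys" "length ys = Suc n" by (auto simp: length_Suc_conv)
  define F where "F i = (if even i then \<phi> (take i xs @ drop (Suc i) xs)
                       else inv (\<phi> (take i xs @ drop (Suc i) xs)))" for i
  define H where "H i = (if even i then \<phi> (x # take i ys @ drop (Suc i) ys)
                       else inv (\<phi> (x # take i ys @ drop (Suc i) ys)))" for i
  have carr: "F i \<in> carrier G" "H i \<in> carrier G" for i using Suc.prems by (auto simp: F_def H_def)
  have "alternating_sum \<phi> xs = \<phi> ys \<otimes> inv (finprod G H {..n})"
    using Suc.IH[of "\<lambda>ys. \<phi> (x # ys)" ys] Suc.prems xs by (simp add: H_def[abs_def])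
  also have "inv (finprod G H {..n}) = finprod G (\<lambda>i. inv (H i)) {..n}"
    using carr by (intro finprod_inv[symmetric])
  also have "(\<lambda>i. inv (H i)) = (\<lambda>i. F (Suc i))"
    using Suc.prems by (auto simp: H_def F_def xs)
  also have "\<phi> ys = F 0" by (simp add: F_def xs)
  also have "F 0 \<otimes> finprod G (\<lambda>i. F (Suc i)) {..n} = finprod G F {..Suc n}"
    using carr by (subst finprod_Suc2) (auto simp: m_comm)
  finally show ?case by (simp only: F_def[abs_def])
qed

text \<open>Only the values at faces enter the sum. This allows a function to be replaced by one
  that agrees with it on the faces of a simplex, such as the coboundary by the unguarded alternating
  sum.\<close>

lemma alternating_sum_cong:
  assumes "\<And>us a vs. xs = us @ a # vs \<Longrightarrow> \<phi> (us @ vs) = \<psi> (us @ vs)"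
  shows "alternating_sum \<phi> xs = alternating_sum \<psi> xs"
  using assms
proof (induction xs arbitrary: \<phi> \<psi>)
  case (Cons x xs)
  have "alternating_sum (\<lambda>ys. \<phi> (x # ys)) xs = alternating_sum (\<lambda>ys. \<psi> (x # ys)) xs"
    using Cons.prems[of "x # _"] by (intro Cons.IH) simp
  then show ?case using Cons.prems[of "[]"] by simp
qed simp

lemma alternating_sum_mult:
  assumes "\<And>xs. \<phi> xs \<in> carrier G" "\<And>xs. \<psi> xs \<in> carrier G"
  shows "alternating_sum (\<lambda>ys. \<phi> ys \<otimes> \<psi> ys) xs = alternating_sum \<phi> xs \<otimes> alternating_sum \<psi> xs"
  using assms by (induction xs arbitrary: \<phi> \<psi>) (auto simp: inv_mult m_ac)

lemma alternating_sum_one: "alternating_sum (\<lambda>ys. \<one>) xs = \<one>"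
  by (induction xs) auto

lemma alternating_sum_inv:
  assumes "\<And>xs. \<phi> xs \<in> carrier G"
  shows "alternating_sum (\<lambda>ys. inv (\<phi> ys)) xs = inv (alternating_sum \<phi> xs)"
  using assms by (induction xs arbitrary: \<phi>) (auto simp: inv_mult)

lemma alternating_sum_map:
  "alternating_sum \<phi> (map f xs) = alternating_sum (\<lambda>ys. \<phi> (map f ys)) xs"
  by (induction xs arbitrary: \<phi>) auto

lemma alternating_sum_alternating_sum:
  assumes "\<And>xs. \<phi> xs \<in> carrier G"
  shows "alternating_sum (alternating_sum \<phi>) xs = \<one>"
  using assms
proof (induction xs arbitrary: \<phi>)
  case (Cons x xs)
  \<comment> \<open>Unfolding the inner sum at \<open>x # ys\<close> splits off
    \<open>\<phi> ys\<close>, whose sum cancels the leading term of the outer recursion; the other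
    part is an iterated sum for \<open>\<phi> (x # _)\<close>, neutral by induction.\<close>
  have "alternating_sum (\<lambda>ys. alternating_sum \<phi> (x # ys)) xs
      = alternating_sum \<phi> xs \<otimes> inv (alternating_sum (alternating_sum (\<lambda>ys. \<phi> (x # ys))) xs)"
    using Cons.prems by (simp add: alternating_sum_mult alternating_sum_inv)
  also have "\<dots> = alternating_sum \<phi> xs"
    using Cons by (simp del: alternating_sum.simps)
  finally show ?case using Cons.prems by simp
qed simp

text \<open>In the base case the two faces omitting one of the exchanged entries trade places and
  thereby signs; in all other faces both entries survive and \<open>\<phi>\<close> itself changes
  sign.\<close>

lemma alternating_sum_swap:
  assumes "\<And>xs. \<phi> xs \<in> carrier G" "\<And>us a b vs. \<phi> (us @ a # b # vs) = inv (\<phi> (us @ b # a # vs))"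
  shows "alternating_sum \<phi> (us @ a # b # vs) = inv (alternating_sum \<phi> (us @ b # a # vs))"
  using assms
proof (induction us arbitrary: \<phi>)
  case Nil
  have "(\<lambda>ys. \<phi> (a # b # ys)) = (\<lambda>ys. inv (\<phi> (b # a # ys)))"
  proof
    fix ys show "\<phi> (a # b # ys) = inv (\<phi> (b # a # ys))"
      using Nil(2)[of "[]" a b ys] by (simp only: append_Nil)
  qed
  then show ?case using Nil(1) by (simp add: alternating_sum_inv inv_mult m_ac)
next
  case (Cons u us)
  have "alternating_sum (\<lambda>ys. \<phi> (u # ys)) (us @ a # b # vs)
      = inv (alternating_sum (\<lambda>ys. \<phi> (u # ys)) (us @ b # a # vs))"
  proof (rule Cons.IH)
    fix us a b vs
    show "\<phi> (u # us @ a # b # vs) = inv (\<phi> (u # us @ b # a # vs))"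
      using Cons.prems(2)[of "u # us" a b vs] by (simp only: append_Cons)
  qed (rule Cons.prems(1))
  moreover have "\<phi> (us @ a # b # vs) = inv (\<phi> (us @ b # a # vs))" by (rule Cons.prems(2))
  ultimately show ?case using Cons.prems(1) by (simp add: inv_mult)
qed

text \<open>The two faces omitting one copy of \<open>a\<close> coincide and have opposite signs,
  while every other face still repeats \<open>a\<close>. Alternation alone would only show that the
  sum is its own inverse.\<close>

lemma alternating_sum_repeat:
  assumes "\<And>xs. \<phi> xs \<in> carrier G" "\<And>xs. \<not> distinct xs \<Longrightarrow> \<phi> xs = \<one>"
  shows "alternating_sum \<phi> (us @ a # a # vs) = \<one>"
  using assms
proof (induction us arbitrary: \<phi>)
  case Nil
  then show ?case by (simp add: alternating_sum_one)
next
  case (Cons u us)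
  have "alternating_sum (\<lambda>ys. \<phi> (u # ys)) (us @ a # a # vs) = \<one>"
    by (rule Cons.IH) (use Cons.prems in auto)
  then show ?case using Cons.prems by simp
qed

text \<open>Adjacent exchanges bring two equal entries together. A cochain map needs this on a
  collapsed simplex, where the coboundary is neutral by default and the alternating sum has to be
  neutral as well.\<close>

lemma alternating_sum_not_distinct:
  assumes carr: "\<And>xs. \<phi> xs \<in> carrier G"
    and adj: "\<And>us a b vs. \<phi> (us @ a # b # vs) = inv (\<phi> (us @ b # a # vs))"
    and dist: "\<And>xs. \<not> distinct xs \<Longrightarrow> \<phi> xs = \<one>"
    and "\<not> distinct xs"
  shows "alternating_sum \<phi> xs = \<one>"
proof -
  have *: "alternating_sum \<phi> (us @ a # vs @ a # ws) = \<one>" for us a vs ws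
  proof (induction vs arbitrary: us)
    case Nil
    show ?case using alternating_sum_repeat[of \<phi> us a ws, OF carr dist] by simp
  next
    case (Cons v vs)
    have "alternating_sum \<phi> (us @ a # v # vs @ a # ws)
        = inv (alternating_sum \<phi> ((us @ [v]) @ a # vs @ a # ws))"
      using alternating_sum_swap[of \<phi> us a v "vs @ a # ws", OF carr adj] by simp
    then show ?case unfolding Cons by simp
  qed
  obtain us a vs ws where "xs = us @ [a] @ vs @ [a] @ ws"
    using not_distinct_decomp[OF assms(4)] by blast
  then show ?thesis using *[of us a vs ws] by simp
qed

section \<open>Relative cochains, the coboundary and cochain maps\<close>

lemma relative_cochains_iff:
  "\<phi> \<in> relative_cochains G q K L \<longleftrightarrow>
     (\<forall>xs. \<phi> xs \<in> carrier G) \<and> (\<forall>xs. xs \<notin> ordered_simplices q K \<longrightarrow> \<phi> xs = \<one>) \<and>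
     (\<forall>us a b vs. \<phi> (us @ a # b # vs) = inv (\<phi> (us @ b # a # vs))) \<and>
     (\<forall>xs\<in>ordered_simplices q L. \<phi> xs = \<one>)"
  by (auto simp: relative_cochains_def oriented_functions_iff)

lemma relative_cochainsD:
  assumes "\<phi> \<in> relative_cochains G q K L"
  shows "\<phi> xs \<in> carrier G" "xs \<notin> ordered_simplices q K \<Longrightarrow> \<phi> xs = \<one>" "\<not> distinct xs \<Longrightarrow> \<phi> xs = \<one>"
    "\<phi> (us @ a # b # vs) = inv (\<phi> (us @ b # a # vs))"
    "xs \<in> ordered_simplices q L \<Longrightarrow> \<phi> xs = \<one>"
proof -
  note c = assms[unfolded relative_cochains_iff]
  show "\<phi> xs \<in> carrier G" "\<phi> (us @ a # b # vs) = inv (\<phi> (us @ b # a # vs))"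
    "xs \<in> ordered_simplices q L \<Longrightarrow> \<phi> xs = \<one>" using c by blast+
  show supp: "xs \<notin> ordered_simplices q K \<Longrightarrow> \<phi> xs = \<one>" using c by blast
  show "\<not> distinct xs \<Longrightarrow> \<phi> xs = \<one>" using supp by (auto simp: ordered_simplices_def)
qed

lemma simplicial_coboundary_eq:
  assumes "\<And>xs. \<phi> xs \<in> carrier G"
  shows "simplicial_coboundary G q K \<phi>
    = (\<lambda>xs. if xs \<in> ordered_simplices (Suc q) K then alternating_sum \<phi> xs else \<one>)"
  using alternating_sum_eq_finprod[of \<phi> _ "Suc q"] assms
  by (auto simp: simplicial_coboundary_def ordered_simplices_def)

lemma simplicial_coboundary_mult:
  assumes "\<And>xs. \<phi> xs \<in> carrier G" "\<And>xs. \<psi> xs \<in> carrier G"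
  shows "simplicial_coboundary G q K (\<lambda>xs. \<phi> xs \<otimes> \<psi> xs)
    = (\<lambda>xs. simplicial_coboundary G q K \<phi> xs \<otimes> simplicial_coboundary G q K \<psi> xs)"
  using assms by (auto simp: simplicial_coboundary_eq alternating_sum_mult)

lemma simplicial_coboundary_inv:
  assumes "\<And>xs. \<phi> xs \<in> carrier G"
  shows "simplicial_coboundary G q K (\<lambda>xs. inv (\<phi> xs)) = (\<lambda>xs. inv (simplicial_coboundary G q K \<phi> xs))"
  using assms by (auto simp: simplicial_coboundary_eq alternating_sum_inv)

lemma simplicial_coboundary_one: "simplicial_coboundary G q K (\<lambda>xs. \<one>) = (\<lambda>xs. \<one>)"
  by (auto simp: simplicial_coboundary_eq alternating_sum_one)

text \<open>The faces of a simplex of \<open>L\<close> lie in \<open>L\<close>, where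
  \<open>\<phi>\<close> is neutral, so the coboundary vanishes on \<open>L\<close> again.\<close>

lemma simplicial_coboundary_in_cochains:
  assumes L: "subset_closed L" and \<phi>: "\<phi> \<in> relative_cochains G q K L"
  shows "simplicial_coboundary G q K \<phi> \<in> relative_cochains G (Suc q) K L"
proof -
  note \<phi>D = relative_cochainsD[OF \<phi>]
  note eq = simplicial_coboundary_eq[of \<phi> q K, OF \<phi>D(1)]
  have "simplicial_coboundary G q K \<phi> (us @ a # b # vs)
      = inv (simplicial_coboundary G q K \<phi> (us @ b # a # vs))" for us a b vs
    using ordered_simplices_mset_eq[of "us @ a # b # vs" "us @ b # a # vs" "Suc q" K]
      alternating_sum_swap[of \<phi> us a b vs, OF \<phi>D(1,4)] by (simp add: eq)
  moreover have "simplicial_coboundary G q K \<phi> xs = \<one>" if "xs \<in> ordered_simplices (Suc q) L" for xs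
  proof -
    have "alternating_sum \<phi> xs = alternating_sum (\<lambda>ys. \<one>) xs"
      using that \<phi>D(5) ordered_simplices_face[OF L] by (intro alternating_sum_cong) auto
    then show ?thesis by (simp add: eq alternating_sum_one)
  qed
  moreover have "simplicial_coboundary G q K \<phi> xs \<in> carrier G" for xs
    using \<phi>D(1) by (simp add: eq)
  moreover have "simplicial_coboundary G q K \<phi> xs = \<one>" if "xs \<notin> ordered_simplices (Suc q) K" for xs
    using that by (simp add: eq)
  ultimately show ?thesis
    unfolding relative_cochains_iff by (intro conjI allI impI ballI) (assumption | blast)+
qed

text \<open>The inner coboundary is set to neutral off \<open>K\<close>, but the outer one evaluates
  it only at faces of simplices of \<open>K\<close>, where it is the plain alternating sum.\<close>

lemma simplicial_coboundary_coboundary: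
  assumes K: "subset_closed K" and \<phi>: "\<And>xs. \<phi> xs \<in> carrier G"
  shows "simplicial_coboundary G (Suc q) K (simplicial_coboundary G q K \<phi>) = (\<lambda>xs. \<one>)"
proof
  fix xs
  have "alternating_sum (simplicial_coboundary G q K \<phi>) xs = alternating_sum (alternating_sum \<phi>) xs"
    if "xs \<in> ordered_simplices (Suc (Suc q)) K"
    using that \<phi> ordered_simplices_face[OF K]
    by (intro alternating_sum_cong) (auto simp: simplicial_coboundary_eq)
  then show "simplicial_coboundary G (Suc q) K (simplicial_coboundary G q K \<phi>) xs = \<one>"
    using \<phi> alternating_sum_alternating_sum[of \<phi>]
    by (subst simplicial_coboundary_eq) (auto simp: simplicial_coboundary_eq)
qed

lemma simplicial_cochain_map_in_cochains:
  assumes f: "\<And>S. S \<in> K \<Longrightarrow> f ` S \<in> K'" "\<And>S. S \<in> L \<Longrightarrow> f ` S \<in> L'"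
    and \<phi>: "\<phi> \<in> relative_cochains G q K' L'"
  shows "simplicial_cochain_map G q f K \<phi> \<in> relative_cochains G q K L"
proof -
  note \<phi>D = relative_cochainsD[OF \<phi>]
  have "simplicial_cochain_map G q f K \<phi> (us @ a # b # vs)
      = inv (simplicial_cochain_map G q f K \<phi> (us @ b # a # vs))" for us a b vs
    using ordered_simplices_mset_eq[of "us @ a # b # vs" "us @ b # a # vs" q K]
      \<phi>D(4)[of "map f us" "f a" "f b" "map f vs"] by (simp add: simplicial_cochain_map_def)
  \<comment> \<open>The simplex either maps to a simplex of \<open>L'\<close> or is collapsed;
    \<open>\<phi>\<close> is neutral in both cases.\<close>
  moreover have "simplicial_cochain_map G q f K \<phi> xs = \<one>" if "xs \<in> ordered_simplices q L" for xs
    using ordered_simplices_map[of L f L', OF f(2) that] \<phi>D(3,5)[of "map f xs"]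
    by (auto simp: simplicial_cochain_map_def)
  moreover have "simplicial_cochain_map G q f K \<phi> xs \<in> carrier G" for xs
    using \<phi>D(1) by (simp add: simplicial_cochain_map_def)
  moreover have "simplicial_cochain_map G q f K \<phi> xs = \<one>" if "xs \<notin> ordered_simplices q K" for xs
    using that by (simp add: simplicial_cochain_map_def)
  ultimately show ?thesis
    unfolding relative_cochains_iff by (intro conjI allI impI ballI) (assumption | blast)+
qed

text \<open>Faces of \<open>xs\<close> go to faces of \<open>map f xs\<close>, so only the guard of
  the coboundary is at issue. It fails when \<open>map f xs\<close> has a repetition, and then the
  alternating sum is neutral too by \<open>alternating_sum_not_distinct\<close>.\<close>

lemma simplicial_cochain_map_coboundary:
  assumes K: "subset_closed K" and f: "\<And>S. S \<in> K \<Longrightarrow> f ` S \<in> K'"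
    and \<phi>: "\<phi> \<in> relative_cochains G q K' L'"
  shows "simplicial_cochain_map G (Suc q) f K (simplicial_coboundary G q K' \<phi>)
    = simplicial_coboundary G q K (simplicial_cochain_map G q f K \<phi>)"
proof
  fix xs
  note \<phi>D = relative_cochainsD[OF \<phi>]
  have carr: "simplicial_cochain_map G q f K \<phi> xs \<in> carrier G" for xs
    using \<phi>D(1) by (simp add: simplicial_cochain_map_def)
  show "simplicial_cochain_map G (Suc q) f K (simplicial_coboundary G q K' \<phi>) xs
    = simplicial_coboundary G q K (simplicial_cochain_map G q f K \<phi>) xs"
  proof (cases "xs \<in> ordered_simplices (Suc q) K")
    case True
    have "simplicial_coboundary G q K' \<phi> (map f xs) = alternating_sum \<phi> (map f xs)"
      using ordered_simplices_map[of K f K', OF f True]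
        alternating_sum_not_distinct[of \<phi> "map f xs", OF \<phi>D(1,4,3)]
      by (cases "distinct (map f xs)") (auto simp: simplicial_coboundary_eq[of \<phi>, OF \<phi>D(1)])
    also have "\<dots> = alternating_sum (simplicial_cochain_map G q f K \<phi>) xs"
      unfolding alternating_sum_map using True ordered_simplices_face[OF K]
      by (intro alternating_sum_cong) (auto simp: simplicial_cochain_map_def)
    finally show ?thesis
      using True carr by (simp add: simplicial_cochain_map_def[of G "Suc q"] simplicial_coboundary_eq)
  next
    case False
    then show ?thesis using carr
      by (simp add: simplicial_cochain_map_def[of G "Suc q"] simplicial_coboundary_eq)
  qed
qed

lemma simplicial_cochain_map_mult:
  "simplicial_cochain_map G q f K (\<lambda>xs. \<phi> xs \<otimes> \<psi> xs)
    = (\<lambda>xs. simplicial_cochain_map G q f K \<phi> xs \<otimes> simplicial_cochain_map G q f K \<psi> xs)"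
  by (auto simp: simplicial_cochain_map_def)

lemma simplicial_cochain_map_one: "simplicial_cochain_map G q f K (\<lambda>xs. \<one>) = (\<lambda>xs. \<one>)"
  by (auto simp: simplicial_cochain_map_def)

lemma simplicial_cochain_map_comp:
  assumes f: "\<And>S. S \<in> K \<Longrightarrow> f ` S \<in> K'" and \<phi>: "\<phi> \<in> relative_cochains G q K'' L''"
  shows "simplicial_cochain_map G q f K (simplicial_cochain_map G q g K' \<phi>)
    = simplicial_cochain_map G q (g \<circ> f) K \<phi>"
proof
  fix xs
  note \<phi>D = relative_cochainsD[OF \<phi>]
  show "simplicial_cochain_map G q f K (simplicial_cochain_map G q g K' \<phi>) xs
    = simplicial_cochain_map G q (g \<circ> f) K \<phi> xs"
  \<comment> \<open>For a simplex \<open>xs\<close> of \<open>K\<close>, the guard for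
    \<open>K'\<close> in the inner map can fail only if \<open>f\<close> identifies vertices of
    \<open>xs\<close>; then \<open>g \<circ> f\<close> identifies them too and \<open>\<phi>\<close>
    is neutral.\<close>
  proof (cases "xs \<in> ordered_simplices q K \<and> \<not> distinct (map f xs)")
    case True
    then have "\<not> distinct (map g (map f xs))" by (metis distinct_map)
    then have "\<phi> (map g (map f xs)) = \<one>" by (rule \<phi>D(3))
    with True show ?thesis by (simp add: simplicial_cochain_map_def)
  next
    case False
    then show ?thesis
      using ordered_simplices_map[of K f K', OF f] by (auto simp: simplicial_cochain_map_def)
  qed
qed

lemma simplicial_cochain_map_id:
  assumes "\<phi> \<in> relative_cochains G q K L"
  shows "simplicial_cochain_map G q id K \<phi> = \<phi>"
  using relative_cochainsD(2)[OF assms] by (auto simp: simplicial_cochain_map_def)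

end

section \<open>Homology and cohomology of simplicial pairs\<close>

lemma carrier_pointwise_group [simp]: "carrier (pointwise_group G C) = C"
  and mult_pointwise_group [simp]: "c \<otimes>\<^bsub>pointwise_group G C\<^esub> d = (\<lambda>xs. c xs \<otimes>\<^bsub>G\<^esub> d xs)"
  and one_pointwise_group [simp]: "\<one>\<^bsub>pointwise_group G C\<^esub> = (\<lambda>xs. \<one>\<^bsub>G\<^esub>)"
  by (simp_all add: pointwise_group_def)

text \<open>This explains the form of \<open>simplicial_homology_map\<close>: the image of a coset
  of \<open>N\<close> is only a coset of the image of \<open>N\<close>, and multiplying by
  \<open>N'\<close> enlarges it to the coset of \<open>N'\<close> through \<open>h x\<close>. The
  induced map is thus given without choosing representatives.\<close>

lemma hom_quotient_coset:
  assumes "comm_group H" "comm_group H'" "h \<in> hom H H'" "subgroup N H" "subgroup N' H'"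
    and "h ` N \<subseteq> N'" "x \<in> carrier H"
  shows "N' <#>\<^bsub>H'\<^esub> (h ` (N #>\<^bsub>H\<^esub> x)) = N' #>\<^bsub>H'\<^esub> h x"
proof -
  interpret H: comm_group H by fact
  interpret H': comm_group H' by fact
  interpret N: subgroup N H by fact
  interpret N': subgroup N' H' by fact
  have hx: "h x \<in> carrier H'" using assms by (auto simp: hom_def)
  have hn: "h (n \<otimes>\<^bsub>H\<^esub> x) = h n \<otimes>\<^bsub>H'\<^esub> h x" if "n \<in> N" for n
    using assms that by (auto simp: hom_def)
  show ?thesis
  proof (intro equalityI subsetI)
    fix y assume "y \<in> N' <#>\<^bsub>H'\<^esub> (h ` (N #>\<^bsub>H\<^esub> x))"
    then obtain n' n where n: "n' \<in> N'" "n \<in> N" "y = n' \<otimes>\<^bsub>H'\<^esub> (h n \<otimes>\<^bsub>H'\<^esub> h x)"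
      using hn by (auto simp: set_mult_def r_coset_def)
    then have "h n \<in> N'" using assms(6) by blast
    then have "y = (n' \<otimes>\<^bsub>H'\<^esub> h n) \<otimes>\<^bsub>H'\<^esub> h x" "n' \<otimes>\<^bsub>H'\<^esub> h n \<in> N'"
      using n hx by (auto simp: H'.m_assoc)
    then show "y \<in> N' #>\<^bsub>H'\<^esub> h x" by (auto simp: r_coset_def)
  next
    fix y assume "y \<in> N' #>\<^bsub>H'\<^esub> h x"
    then obtain n' where n': "n' \<in> N'" "y = n' \<otimes>\<^bsub>H'\<^esub> h x" by (auto simp: r_coset_def)
    have "\<one>\<^bsub>H\<^esub> \<otimes>\<^bsub>H\<^esub> x \<in> N #>\<^bsub>H\<^esub> x" using N.one_closed by (auto simp: r_coset_def)
    then have "x \<in> N #>\<^bsub>H\<^esub> x" using assms by simp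
    with n' show "y \<in> N' <#>\<^bsub>H'\<^esub> (h ` (N #>\<^bsub>H\<^esub> x))" by (auto simp: set_mult_def)
  qed
qed

lemma hom_quotient_hom:
  assumes "comm_group H" "comm_group H'" "h \<in> hom H H'" "subgroup N H" "subgroup N' H'" "h ` N \<subseteq> N'"
  shows "(\<lambda>C. N' <#>\<^bsub>H'\<^esub> (h ` C)) \<in> hom (H Mod N) (H' Mod N')"
proof (rule homI)
  interpret H: comm_group H by fact
  interpret H': comm_group H' by fact
  interpret N: normal N H using assms by (simp add: H.subgroup_imp_normal)
  interpret N': normal N' H' using assms by (simp add: H'.subgroup_imp_normal)
  note coset = hom_quotient_coset[OF assms]
  have h: "h x \<in> carrier H'" if "x \<in> carrier H" for x using assms(3) that by (auto simp: hom_def)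
  fix C assume "C \<in> carrier (H Mod N)"
  then obtain x where x: "x \<in> carrier H" "C = N #>\<^bsub>H\<^esub> x" by (auto simp: carrier_FactGroup)
  then show "N' <#>\<^bsub>H'\<^esub> (h ` C) \<in> carrier (H' Mod N')"
    using h by (auto simp: coset carrier_FactGroup)
  fix D assume "D \<in> carrier (H Mod N)"
  then obtain y where y: "y \<in> carrier H" "D = N #>\<^bsub>H\<^esub> y" by (auto simp: carrier_FactGroup)
  have hxy: "h (x \<otimes>\<^bsub>H\<^esub> y) = h x \<otimes>\<^bsub>H'\<^esub> h y" using assms(3) x y by (auto simp: hom_def)
  have "N' <#>\<^bsub>H'\<^esub> (h ` (C <#>\<^bsub>H\<^esub> D)) = N' #>\<^bsub>H'\<^esub> (h x \<otimes>\<^bsub>H'\<^esub> h y)"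
    unfolding x(2) y(2) using x y by (simp add: N.rcos_sum coset hxy)
  also have "\<dots> = (N' #>\<^bsub>H'\<^esub> h x) <#>\<^bsub>H'\<^esub> (N' #>\<^bsub>H'\<^esub> h y)"
    using h x y by (simp add: N'.rcos_sum)
  finally show "N' <#>\<^bsub>H'\<^esub> (h ` (C \<otimes>\<^bsub>H Mod N\<^esub> D))
      = (N' <#>\<^bsub>H'\<^esub> (h ` C)) \<otimes>\<^bsub>H' Mod N'\<^esub> (N' <#>\<^bsub>H'\<^esub> (h ` D))"
    using x y by (simp add: coset)
qed

definition simplicial_pair :: "'a set set \<Rightarrow> 'a set set \<Rightarrow> bool" where
  "simplicial_pair K L \<longleftrightarrow> subset_closed K \<and> subset_closed L \<and> L \<subseteq> K"

definition simplicial_pair_map ::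
    "('a \<Rightarrow> 'b) \<Rightarrow> 'a set set \<Rightarrow> 'a set set \<Rightarrow> 'b set set \<Rightarrow> 'b set set \<Rightarrow> bool" where
  "simplicial_pair_map f K L K' L' \<longleftrightarrow> (\<forall>S\<in>K. f ` S \<in> K') \<and> (\<forall>S\<in>L. f ` S \<in> L')"

lemma simplicial_pair_map_comp:
  "simplicial_pair_map f K L K' L' \<Longrightarrow> simplicial_pair_map g K' L' K'' L'' \<Longrightarrow>
    simplicial_pair_map (g \<circ> f) K L K'' L''"
  by (simp add: simplicial_pair_map_def image_image[symmetric, of g f] o_def)

section \<open>Function groups and their quotients\<close>

context comm_group
begin

text \<open>All the groups of chains and cochains carry the same pointwise operations on different
  carriers. One closure condition thus yields both the commutative group on \<open>C\<close> and its
  subgroups.\<close>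

definition pointwise_closed :: "('c list \<Rightarrow> 'a) set \<Rightarrow> bool" where
  "pointwise_closed C \<longleftrightarrow> (\<forall>c\<in>C. \<forall>xs. c xs \<in> carrier G) \<and> (\<lambda>xs. \<one>) \<in> C \<and>
     (\<forall>c\<in>C. \<forall>d\<in>C. (\<lambda>xs. c xs \<otimes> d xs) \<in> C) \<and> (\<forall>c\<in>C. (\<lambda>xs. inv (c xs)) \<in> C)"

lemma pointwise_closedD:
  assumes "pointwise_closed C"
  shows "c \<in> C \<Longrightarrow> c xs \<in> carrier G" "(\<lambda>xs. \<one>) \<in> C"
    "c \<in> C \<Longrightarrow> d \<in> C \<Longrightarrow> (\<lambda>xs. c xs \<otimes> d xs) \<in> C" "c \<in> C \<Longrightarrow> (\<lambda>xs. inv (c xs)) \<in> C"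
  using assms unfolding pointwise_closed_def by blast+

lemma comm_group_pointwise_group:
  assumes "pointwise_closed C"
  shows "comm_group (pointwise_group G C)"
proof (rule comm_groupI)
  note CD = pointwise_closedD[OF assms]
  fix c assume "c \<in> carrier (pointwise_group G C)"
  then show "\<exists>d\<in>carrier (pointwise_group G C). d \<otimes>\<^bsub>pointwise_group G C\<^esub> c = \<one>\<^bsub>pointwise_group G C\<^esub>"
    using CD by (intro bexI[of _ "\<lambda>xs. inv (c xs)"]) auto
qed (use pointwise_closedD[OF assms] in \<open>auto simp: m_ac\<close>)

lemma subgroup_pointwise_group:
  assumes "pointwise_closed C" "pointwise_closed N" "N \<subseteq> C"
  shows "subgroup N (pointwise_group G C)"
proof -
  interpret P: comm_group "pointwise_group G C" by (rule comm_group_pointwise_group) fact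
  note ND = pointwise_closedD[OF assms(2)]
  show ?thesis
  proof (rule P.subgroupI)
    fix c assume c: "c \<in> N"
    have "inv\<^bsub>pointwise_group G C\<^esub> c = (\<lambda>xs. inv (c xs))"
      by (rule P.inv_equality) (use c ND assms(3) in auto)
    then show "inv\<^bsub>pointwise_group G C\<^esub> c \<in> N" using c ND by simp
  qed (use assms(3) ND in auto)
qed

text \<open>\<open>E\<close> is left free because relative boundaries are formed as a product inside
  the chains, but are divided out of the cycles.\<close>

lemma pointwise_closed_set_mult:
  assumes "pointwise_closed C" "pointwise_closed D"
  shows "pointwise_closed (C <#>\<^bsub>pointwise_group G E\<^esub> D)"
proof -
  note CD = pointwise_closedD[OF assms(1)] pointwise_closedD[OF assms(2)]
  have eq: "C <#>\<^bsub>pointwise_group G E\<^esub> D = {\<lambda>xs. c xs \<otimes> d xs | c d. c \<in> C \<and> d \<in> D}"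
    by (auto simp: set_mult_def)
  show ?thesis
    unfolding pointwise_closed_def
  proof (intro conjI ballI allI)
    fix x xs assume "x \<in> C <#>\<^bsub>pointwise_group G E\<^esub> D"
    then show "x xs \<in> carrier G" using CD by (auto simp: eq)
  next
    show "(\<lambda>xs. \<one>) \<in> C <#>\<^bsub>pointwise_group G E\<^esub> D"
      unfolding eq mem_Collect_eq
      by (rule exI[of _ "\<lambda>xs. \<one>"], rule exI[of _ "\<lambda>xs. \<one>"]) (use CD in auto)
  next
    fix x y assume "x \<in> C <#>\<^bsub>pointwise_group G E\<^esub> D" "y \<in> C <#>\<^bsub>pointwise_group G E\<^esub> D"
    then obtain c d c' d' where *: "c \<in> C" "d \<in> D" "c' \<in> C" "d' \<in> D"
      "x = (\<lambda>xs. c xs \<otimes> d xs)" "y = (\<lambda>xs. c' xs \<otimes> d' xs)" by (auto simp: eq)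
    \<comment> \<open>Commutativity of \<open>G\<close> allows the factors from \<open>C\<close> and
      those from \<open>D\<close> to be collected.\<close>
    then have "(\<lambda>xs. x xs \<otimes> y xs) = (\<lambda>xs. (c xs \<otimes> c' xs) \<otimes> (d xs \<otimes> d' xs))"
      using CD by (auto simp: m_ac)
    then show "(\<lambda>xs. x xs \<otimes> y xs) \<in> C <#>\<^bsub>pointwise_group G E\<^esub> D"
      unfolding eq mem_Collect_eq using CD(3)[OF *(1,3)] CD(7)[OF *(2,4)] by (intro exI conjI)
  next
    fix x assume "x \<in> C <#>\<^bsub>pointwise_group G E\<^esub> D"
    then obtain c d where *: "c \<in> C" "d \<in> D" "x = (\<lambda>xs. c xs \<otimes> d xs)" by (auto simp: eq)
    then have "(\<lambda>xs. inv (x xs)) = (\<lambda>xs. inv (c xs) \<otimes> inv (d xs))"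
      using CD by (auto simp: inv_mult)
    then show "(\<lambda>xs. inv (x xs)) \<in> C <#>\<^bsub>pointwise_group G E\<^esub> D"
      unfolding eq mem_Collect_eq using CD(4)[OF *(1)] CD(8)[OF *(2)] by (intro exI conjI)
  qed
qed

subsection \<open>Homology\<close>

lemma pointwise_closed_chains: "pointwise_closed (simplicial_chains G q K)"
  unfolding pointwise_closed_def
proof (intro conjI ballI allI)
  show "(\<lambda>xs. \<one>) \<in> simplicial_chains G q K" by (auto simp: simplicial_chains_iff)
next
  fix c d assume c: "c \<in> simplicial_chains G q K" and d: "d \<in> simplicial_chains G q K"
  note cD = simplicial_chainsD[OF c] and dD = simplicial_chainsD[OF d]
  show "(\<lambda>xs. c xs \<otimes> d xs) \<in> simplicial_chains G q K"
    unfolding simplicial_chains_iff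
  proof (intro conjI allI impI)
    fix xs show "c xs \<otimes> d xs \<in> carrier G" using cD(1) dD(1) by simp
    assume "xs \<notin> ordered_simplices q K"
    then have "c xs = \<one>" "d xs = \<one>" using cD(2) dD(2) by blast+
    then show "c xs \<otimes> d xs = \<one>" by simp
  next
    fix us a b vs
    show "c (us @ a # b # vs) \<otimes> d (us @ a # b # vs) = inv (c (us @ b # a # vs) \<otimes> d (us @ b # a # vs))"
      using cD(4)[of us a b vs] dD(4)[of us a b vs] cD(1) dD(1) by (simp add: inv_mult)
  next
    have "{xs. c xs \<otimes> d xs \<noteq> \<one>} \<subseteq> {xs. c xs \<noteq> \<one>} \<union> {xs. d xs \<noteq> \<one>}" by auto
    then show "finite {xs. c xs \<otimes> d xs \<noteq> \<one>}" using cD(5) dD(5) finite_subset by blast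
  qed
next
  fix c assume c: "c \<in> simplicial_chains G q K"
  note cD = simplicial_chainsD[OF c]
  show "(\<lambda>xs. inv (c xs)) \<in> simplicial_chains G q K"
    unfolding simplicial_chains_iff
  proof (intro conjI allI impI)
    fix xs show "inv (c xs) \<in> carrier G" using cD(1) by simp
    assume "xs \<notin> ordered_simplices q K"
    then have "c xs = \<one>" using cD(2) by blast
    then show "inv (c xs) = \<one>" by simp
  next
    fix us a b vs
    show "inv (c (us @ a # b # vs)) = inv (inv (c (us @ b # a # vs)))"
      using cD(4)[of us a b vs] by (rule arg_cong)
  next
    have "{xs. inv (c xs) \<noteq> \<one>} = {xs. c xs \<noteq> \<one>}" using cD(1) by auto
    then show "finite {xs. inv (c xs) \<noteq> \<one>}" using cD(5) by simp
  qed
qed (rule simplicial_chainsD)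

lemmas chains_closed = pointwise_closedD[OF pointwise_closed_chains]

lemma simplicial_boundary_mult_chains:
  assumes "c \<in> simplicial_chains G q K" "d \<in> simplicial_chains G p K'"
  shows "simplicial_boundary G (\<lambda>xs. c xs \<otimes> d xs)
    = (\<lambda>w. simplicial_boundary G c w \<otimes> simplicial_boundary G d w)"
  using assms by (intro simplicial_boundary_mult) (rule simplicial_chainsD, assumption)+

lemma simplicial_boundary_inv_chains:
  assumes "c \<in> simplicial_chains G q K"
  shows "simplicial_boundary G (\<lambda>xs. inv (c xs)) = (\<lambda>w. inv (simplicial_boundary G c w))"
  using assms by (intro simplicial_boundary_inv) (rule simplicial_chainsD, assumption)+

lemma pointwise_closed_cycles: "pointwise_closed (relative_cycles G q K L)"
  unfolding pointwise_closed_def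
proof (intro conjI ballI allI)
  fix c xs assume "c \<in> relative_cycles G q K L"
  then show "c xs \<in> carrier G" by (auto simp: relative_cycles_def intro: chains_closed)
next
  show "(\<lambda>xs. \<one>) \<in> relative_cycles G q K L"
    by (auto simp: relative_cycles_def simplicial_boundary_one intro: chains_closed)
next
  fix c d assume c: "c \<in> relative_cycles G q K L" and d: "d \<in> relative_cycles G q K L"
  then have *: "c \<in> simplicial_chains G q K" "d \<in> simplicial_chains G q K"
    by (simp_all add: relative_cycles_def)
  show "(\<lambda>xs. c xs \<otimes> d xs) \<in> relative_cycles G q K L"
    using c d chains_closed(3)[OF *] simplicial_boundary_mult_chains[OF *]
    by (auto simp: relative_cycles_def intro: chains_closed)
next
  fix c assume c: "c \<in> relative_cycles G q K L"
  then have *: "c \<in> simplicial_chains G q K" by (simp add: relative_cycles_def)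
  show "(\<lambda>xs. inv (c xs)) \<in> relative_cycles G q K L"
    using c chains_closed(4)[OF *] simplicial_boundary_inv_chains[OF *]
    by (auto simp: relative_cycles_def intro: chains_closed)
qed

lemma pointwise_closed_boundary_image:
  "pointwise_closed (simplicial_boundary G ` simplicial_chains G q K)"
  unfolding pointwise_closed_def
proof (intro conjI ballI allI; (elim imageE, hypsubst)?)
  show "(\<lambda>xs. \<one>) \<in> simplicial_boundary G ` simplicial_chains G q K"
    by (rule image_eqI[where x = "\<lambda>xs. \<one>"]) (simp_all add: simplicial_boundary_one chains_closed)
next
  fix c d assume c: "c \<in> simplicial_chains G q K" and d: "d \<in> simplicial_chains G q K"
  show "(\<lambda>xs. simplicial_boundary G c xs \<otimes> simplicial_boundary G d xs)
      \<in> simplicial_boundary G ` simplicial_chains G q K"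
    unfolding simplicial_boundary_mult_chains[OF c d, symmetric] using chains_closed(3)[OF c d] by (rule imageI)
next
  fix c assume c: "c \<in> simplicial_chains G q K"
  show "(\<lambda>xs. inv (simplicial_boundary G c xs)) \<in> simplicial_boundary G ` simplicial_chains G q K"
    unfolding simplicial_boundary_inv_chains[OF c, symmetric] using chains_closed(4)[OF c] by (rule imageI)
qed (auto intro!: simplicial_boundary_closed intro: simplicial_chainsD(1))

lemma pointwise_closed_boundaries: "pointwise_closed (relative_boundaries G q K L)"
  unfolding relative_boundaries_def
  by (intro pointwise_closed_set_mult pointwise_closed_boundary_image pointwise_closed_chains)

lemma relative_boundariesE:
  assumes "b \<in> relative_boundaries G q K L"
  obtains c l where "c \<in> simplicial_chains G (Suc q) K" "l \<in> simplicial_chains G q L"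
    "b = (\<lambda>xs. simplicial_boundary G c xs \<otimes> l xs)"
  using assms by (auto simp: relative_boundaries_def set_mult_def)

lemma relative_boundariesI:
  assumes "c \<in> simplicial_chains G (Suc q) K" "l \<in> simplicial_chains G q L"
  shows "(\<lambda>xs. simplicial_boundary G c xs \<otimes> l xs) \<in> relative_boundaries G q K L"
  unfolding relative_boundaries_def set_mult_def using assms by auto

text \<open>The boundary of \<open>\<partial>c \<otimes> l\<close> is \<open>\<partial>l\<close> by
  \<open>\<partial>\<partial> = 0\<close>, and this is a chain of \<open>L\<close>. In degree 0 the
  cycle condition is empty, so the boundary is examined only for \<open>q = Suc p\<close>.\<close>

lemma relative_boundaries_subset_cycles:
  assumes "simplicial_pair K L"
  shows "relative_boundaries G q K L \<subseteq> relative_cycles G q K L"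
proof
  have K: "subset_closed K" and L: "subset_closed L" and LK: "L \<subseteq> K"
    using assms by (auto simp: simplicial_pair_def)
  fix b assume "b \<in> relative_boundaries G q K L"
  then obtain c l where c: "c \<in> simplicial_chains G (Suc q) K" and l: "l \<in> simplicial_chains G q L"
    and b: "b = (\<lambda>xs. simplicial_boundary G c xs \<otimes> l xs)" by (rule relative_boundariesE)
  have dc: "simplicial_boundary G c \<in> simplicial_chains G q K"
    by (rule simplicial_boundary_in_chains[OF K c])
  have "b \<in> simplicial_chains G q K"
    unfolding b using dc l simplicial_chains_mono[OF LK] by (intro chains_closed) auto
  moreover have "simplicial_boundary G b \<in> simplicial_chains G p L" if "q = Suc p" for p
  proof -
    have l': "l \<in> simplicial_chains G (Suc p) L" using l that by simp
    have "simplicial_boundary G b = simplicial_boundary G l"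
      unfolding b using simplicial_boundary_mult_chains[OF dc l] simplicial_chainsD(1)[OF l]
      by (simp add: simplicial_boundary_boundary[OF c])
    then show ?thesis using simplicial_boundary_in_chains[OF L l'] by simp
  qed
  ultimately show "b \<in> relative_cycles G q K L" by (cases q) (auto simp: relative_cycles_def)
qed

lemma subgroup_boundaries:
  "simplicial_pair K L \<Longrightarrow>
    subgroup (relative_boundaries G q K L) (pointwise_group G (relative_cycles G q K L))"
  by (intro subgroup_pointwise_group pointwise_closed_cycles pointwise_closed_boundaries
      relative_boundaries_subset_cycles)

lemma comm_group_simplicial_homology:
  "simplicial_pair K L \<Longrightarrow> comm_group (simplicial_homology G q K L)"
  unfolding simplicial_homology_def
  by (intro comm_group.abelian_FactGroup comm_group_pointwise_group pointwise_closed_cycles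
      subgroup_boundaries)

lemma simplicial_chain_map_cycles:
  assumes f: "simplicial_pair_map f K L K' L'" and c: "c \<in> relative_cycles G q K L"
  shows "simplicial_chain_map G f c \<in> relative_cycles G q K' L'"
  using c f simplicial_chain_map_in_chains[of K f K' c q]
    simplicial_chain_map_in_chains[of L f L' "simplicial_boundary G c" "q - 1"]
    simplicial_chain_map_boundary[of c q K f]
  by (auto simp: relative_cycles_def simplicial_pair_map_def)

lemma simplicial_chain_map_boundaries:
  assumes "simplicial_pair K L" "simplicial_pair_map f K L K' L'" and b: "b \<in> relative_boundaries G q K L"
  shows "simplicial_chain_map G f b \<in> relative_boundaries G q K' L'"
proof -
  obtain c l where c: "c \<in> simplicial_chains G (Suc q) K" and l: "l \<in> simplicial_chains G q L"
    and b: "b = (\<lambda>xs. simplicial_boundary G c xs \<otimes> l xs)" using b by (rule relative_boundariesE)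
  have "simplicial_boundary G c \<in> simplicial_chains G q K"
    using assms(1) c by (auto simp: simplicial_pair_def intro: simplicial_boundary_in_chains)
  then have "simplicial_chain_map G f b
      = (\<lambda>xs. simplicial_boundary G (simplicial_chain_map G f c) xs \<otimes> simplicial_chain_map G f l xs)"
    unfolding b simplicial_chain_map_boundary[OF c, symmetric]
    using l by (intro simplicial_chain_map_mult) (auto dest: simplicial_chainsD)
  moreover have "simplicial_chain_map G f c \<in> simplicial_chains G (Suc q) K'"
    "simplicial_chain_map G f l \<in> simplicial_chains G q L'"
    using assms(2) c l simplicial_chain_map_in_chains[of K f K'] simplicial_chain_map_in_chains[of L f L']
    by (auto simp: simplicial_pair_map_def)
  ultimately show ?thesis by (simp add: relative_boundariesI)
qed

lemma simplicial_chain_map_hom: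
  assumes "simplicial_pair_map f K L K' L'"
  shows "simplicial_chain_map G f
    \<in> hom (pointwise_group G (relative_cycles G q K L)) (pointwise_group G (relative_cycles G q K' L'))"
proof (rule homI)
  fix c d assume "c \<in> carrier (pointwise_group G (relative_cycles G q K L))"
    "d \<in> carrier (pointwise_group G (relative_cycles G q K L))"
  then have "c \<in> simplicial_chains G q K" "d \<in> simplicial_chains G q K"
    by (auto simp: relative_cycles_def)
  then show "simplicial_chain_map G f (c \<otimes>\<^bsub>pointwise_group G (relative_cycles G q K L)\<^esub> d)
    = simplicial_chain_map G f c \<otimes>\<^bsub>pointwise_group G (relative_cycles G q K' L')\<^esub> simplicial_chain_map G f d"
    by (simp add: simplicial_chain_map_mult simplicial_chainsD)
qed (use simplicial_chain_map_cycles[OF assms] in auto)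

lemma simplicial_homology_map_hom:
  assumes "simplicial_pair K L" "simplicial_pair K' L'" "simplicial_pair_map f K L K' L'"
  shows "simplicial_homology_map G q f K' L'
    \<in> hom (simplicial_homology G q K L) (simplicial_homology G q K' L')"
  unfolding simplicial_homology_def simplicial_homology_map_def[abs_def]
  by (rule hom_quotient_hom)
    (use assms in \<open>auto intro: comm_group_pointwise_group pointwise_closed_cycles subgroup_boundaries
        simplicial_chain_map_hom simplicial_chain_map_boundaries\<close>)

abbreviation homology_class where
  "homology_class q K L c \<equiv> relative_boundaries G q K L #>\<^bsub>pointwise_group G (relative_cycles G q K L)\<^esub> c"

lemma simplicial_homologyE:
  assumes "C \<in> carrier (simplicial_homology G q K L)"
  obtains c where "c \<in> relative_cycles G q K L" "C = homology_class q K L c"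
  using assms by (auto simp: simplicial_homology_def carrier_FactGroup)

text \<open>Evaluation on a representative, by which identities between induced maps reduce to
  identities between chain maps.\<close>

lemma simplicial_homology_map_class:
  assumes "simplicial_pair K L" "simplicial_pair K' L'" "simplicial_pair_map f K L K' L'"
    and "c \<in> relative_cycles G q K L"
  shows "simplicial_homology_map G q f K' L' (homology_class q K L c)
    = homology_class q K' L' (simplicial_chain_map G f c)"
  unfolding simplicial_homology_map_def
  by (rule hom_quotient_coset)
    (use assms in \<open>auto intro: comm_group_pointwise_group pointwise_closed_cycles subgroup_boundaries
        simplicial_chain_map_hom simplicial_chain_map_boundaries\<close>)

lemma simplicial_homology_map_comp:
  assumes "simplicial_pair K L" "simplicial_pair K' L'" "simplicial_pair K'' L''"
    and "simplicial_pair_map f K L K' L'" "simplicial_pair_map g K' L' K'' L''"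
    and "C \<in> carrier (simplicial_homology G q K L)"
  shows "simplicial_homology_map G q g K'' L'' (simplicial_homology_map G q f K' L' C)
    = simplicial_homology_map G q (g \<circ> f) K'' L'' C"
proof -
  obtain c where c: "c \<in> relative_cycles G q K L" "C = homology_class q K L c"
    using assms(6) by (rule simplicial_homologyE)
  then have "c \<in> simplicial_chains G q K" by (simp add: relative_cycles_def)
  then show ?thesis
    using assms c simplicial_pair_map_comp[OF assms(4,5)] simplicial_chain_map_cycles[OF assms(4) c(1)]
    by (simp add: simplicial_homology_map_class simplicial_chain_map_comp)
qed

lemma simplicial_homology_map_id:
  assumes "simplicial_pair K L" "C \<in> carrier (simplicial_homology G q K L)"
  shows "simplicial_homology_map G q id K L C = C"
proof -
  obtain c where c: "c \<in> relative_cycles G q K L" "C = homology_class q K L c"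
    using assms(2) by (rule simplicial_homologyE)
  then have "c \<in> simplicial_chains G q K" by (simp add: relative_cycles_def)
  moreover have "simplicial_pair_map id K L K L" by (simp add: simplicial_pair_map_def)
  ultimately show ?thesis
    using assms c by (simp add: simplicial_homology_map_class simplicial_chain_map_id)
qed

subsection \<open>Cohomology\<close>

lemma pointwise_closed_cochains: "pointwise_closed (relative_cochains G q K L)"
  unfolding pointwise_closed_def
proof (intro conjI ballI allI)
  show "(\<lambda>xs. \<one>) \<in> relative_cochains G q K L" by (auto simp: relative_cochains_iff)
next
  fix c d assume c: "c \<in> relative_cochains G q K L" and d: "d \<in> relative_cochains G q K L"
  note cD = relative_cochainsD[OF c] and dD = relative_cochainsD[OF d]
  show "(\<lambda>xs. c xs \<otimes> d xs) \<in> relative_cochains G q K L"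
    unfolding relative_cochains_iff
  proof (intro conjI allI impI ballI)
    fix us a b vs
    show "c (us @ a # b # vs) \<otimes> d (us @ a # b # vs) = inv (c (us @ b # a # vs) \<otimes> d (us @ b # a # vs))"
      using cD(4)[of us a b vs] dD(4)[of us a b vs] cD(1) dD(1) by (simp add: inv_mult)
  qed (simp_all add: cD(1,2,5) dD(1,2,5))
next
  fix c assume c: "c \<in> relative_cochains G q K L"
  note cD = relative_cochainsD[OF c]
  show "(\<lambda>xs. inv (c xs)) \<in> relative_cochains G q K L"
    unfolding relative_cochains_iff
  proof (intro conjI allI impI ballI)
    fix us a b vs
    show "inv (c (us @ a # b # vs)) = inv (inv (c (us @ b # a # vs)))"
      using cD(4)[of us a b vs] by (rule arg_cong)
  qed (simp_all add: cD(1,2,5))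
qed (rule relative_cochainsD)

lemmas cochains_closed = pointwise_closedD[OF pointwise_closed_cochains]

lemma pointwise_closed_cocycles: "pointwise_closed (relative_cocycles G q K L)"
  unfolding pointwise_closed_def
proof (intro conjI ballI allI)
  fix c xs assume "c \<in> relative_cocycles G q K L"
  then show "c xs \<in> carrier G" by (auto simp: relative_cocycles_def intro: cochains_closed)
next
  show "(\<lambda>xs. \<one>) \<in> relative_cocycles G q K L"
    by (auto simp: relative_cocycles_def simplicial_coboundary_one intro: cochains_closed)
next
  fix c d assume "c \<in> relative_cocycles G q K L" "d \<in> relative_cocycles G q K L"
  then show "(\<lambda>xs. c xs \<otimes> d xs) \<in> relative_cocycles G q K L"
    using simplicial_coboundary_mult[of c d q K] cochains_closed(1)[of c q K L] cochains_closed(1)[of d q K L]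
    by (simp add: relative_cocycles_def cochains_closed)
next
  fix c assume "c \<in> relative_cocycles G q K L"
  then show "(\<lambda>xs. inv (c xs)) \<in> relative_cocycles G q K L"
    using simplicial_coboundary_inv[of c q K] cochains_closed(1)[of c q K L]
    by (simp add: relative_cocycles_def cochains_closed)
qed

lemma pointwise_closed_coboundaries: "pointwise_closed (relative_coboundaries G q K L)"
proof (cases q)
  \<comment> \<open>There are no cochains below degree 0, so the coboundaries form the trivial
    group.\<close>
  case 0
  then show ?thesis by (simp add: relative_coboundaries_def pointwise_closed_def)
next
  case (Suc p)
  have "pointwise_closed (simplicial_coboundary G p K ` relative_cochains G p K L)"
    unfolding pointwise_closed_def
  proof (intro conjI ballI allI; (elim imageE, hypsubst)?)
    show "(\<lambda>xs. \<one>) \<in> simplicial_coboundary G p K ` relative_cochains G p K L"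
      by (rule image_eqI[where x = "\<lambda>xs. \<one>"]) (simp_all add: simplicial_coboundary_one cochains_closed)
  next
    fix \<phi> xs assume "\<phi> \<in> relative_cochains G p K L"
    then show "simplicial_coboundary G p K \<phi> xs \<in> carrier G"
      by (simp add: simplicial_coboundary_eq cochains_closed)
  next
    fix \<phi> \<psi> assume c: "\<phi> \<in> relative_cochains G p K L" and d: "\<psi> \<in> relative_cochains G p K L"
    show "(\<lambda>xs. simplicial_coboundary G p K \<phi> xs \<otimes> simplicial_coboundary G p K \<psi> xs)
        \<in> simplicial_coboundary G p K ` relative_cochains G p K L"
      using cochains_closed(3)[OF c d] c d
      by (intro image_eqI[of _ _ "\<lambda>xs. \<phi> xs \<otimes> \<psi> xs"])
        (simp_all add: simplicial_coboundary_mult cochains_closed)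
  next
    fix \<phi> assume c: "\<phi> \<in> relative_cochains G p K L"
    show "(\<lambda>xs. inv (simplicial_coboundary G p K \<phi> xs))
        \<in> simplicial_coboundary G p K ` relative_cochains G p K L"
      using cochains_closed(4)[OF c] c
      by (intro image_eqI[of _ _ "\<lambda>xs. inv (\<phi> xs)"])
        (simp_all add: simplicial_coboundary_inv cochains_closed)
  qed
  with Suc show ?thesis by (simp add: relative_coboundaries_def)
qed

lemma relative_coboundaries_subset_cocycles:
  assumes "simplicial_pair K L"
  shows "relative_coboundaries G q K L \<subseteq> relative_cocycles G q K L"
proof (cases q)
  case 0
  then show ?thesis
    using pointwise_closedD(2)[OF pointwise_closed_cocycles] by (auto simp: relative_coboundaries_def)
next
  case (Suc p)
  then show ?thesis using assms
    by (auto simp: relative_coboundaries_def relative_cocycles_def simplicial_pair_def cochains_closed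
        simplicial_coboundary_coboundary intro!: simplicial_coboundary_in_cochains)
qed

lemma subgroup_coboundaries:
  "simplicial_pair K L \<Longrightarrow>
    subgroup (relative_coboundaries G q K L) (pointwise_group G (relative_cocycles G q K L))"
  by (intro subgroup_pointwise_group pointwise_closed_cocycles pointwise_closed_coboundaries
      relative_coboundaries_subset_cocycles)

lemma comm_group_simplicial_cohomology:
  "simplicial_pair K L \<Longrightarrow> comm_group (simplicial_cohomology G q K L)"
  unfolding simplicial_cohomology_def
  by (intro comm_group.abelian_FactGroup comm_group_pointwise_group pointwise_closed_cocycles
      subgroup_coboundaries)

lemma simplicial_cochain_map_cocycles:
  assumes "simplicial_pair K L" "simplicial_pair_map f K L K' L'" and \<phi>: "\<phi> \<in> relative_cocycles G q K' L'"
  shows "simplicial_cochain_map G q f K \<phi> \<in> relative_cocycles G q K L"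
proof -
  have \<phi>': "\<phi> \<in> relative_cochains G q K' L'" "simplicial_coboundary G q K' \<phi> = (\<lambda>xs. \<one>)"
    using \<phi> by (auto simp: relative_cocycles_def)
  show ?thesis
    using assms simplicial_cochain_map_in_cochains[of K f K' L L' \<phi> q] \<phi>'
      simplicial_cochain_map_coboundary[of K f K' \<phi> q L']
    by (simp add: relative_cocycles_def simplicial_pair_def simplicial_pair_map_def simplicial_cochain_map_one)
qed

lemma simplicial_cochain_map_coboundaries:
  assumes "simplicial_pair K L" "simplicial_pair_map f K L K' L'" and "\<phi> \<in> relative_coboundaries G q K' L'"
  shows "simplicial_cochain_map G q f K \<phi> \<in> relative_coboundaries G q K L"
proof (cases q)
  case 0
  then show ?thesis using assms by (simp add: relative_coboundaries_def simplicial_cochain_map_one)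
next
  case (Suc p)
  then obtain \<psi> where \<psi>: "\<psi> \<in> relative_cochains G p K' L'" "\<phi> = simplicial_coboundary G p K' \<psi>"
    using assms(3) by (auto simp: relative_coboundaries_def)
  then show ?thesis
    using assms Suc simplicial_cochain_map_in_cochains[of K f K' L L' \<psi> p]
      simplicial_cochain_map_coboundary[of K f K' \<psi> p L']
    by (simp add: relative_coboundaries_def simplicial_pair_def simplicial_pair_map_def)
qed

lemma simplicial_cochain_map_hom:
  assumes "simplicial_pair K L" "simplicial_pair_map f K L K' L'"
  shows "simplicial_cochain_map G q f K
    \<in> hom (pointwise_group G (relative_cocycles G q K' L')) (pointwise_group G (relative_cocycles G q K L))"
  by (rule homI) (use simplicial_cochain_map_cocycles[OF assms] in \<open>auto simp: simplicial_cochain_map_mult\<close>)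

lemma simplicial_cohomology_map_hom:
  assumes "simplicial_pair K L" "simplicial_pair K' L'" "simplicial_pair_map f K L K' L'"
  shows "simplicial_cohomology_map G q f K L
    \<in> hom (simplicial_cohomology G q K' L') (simplicial_cohomology G q K L)"
  unfolding simplicial_cohomology_def simplicial_cohomology_map_def[abs_def]
  by (rule hom_quotient_hom)
    (use assms in \<open>auto intro: comm_group_pointwise_group pointwise_closed_cocycles subgroup_coboundaries
        simplicial_cochain_map_hom simplicial_cochain_map_coboundaries\<close>)

abbreviation cohomology_class where
  "cohomology_class q K L \<phi> \<equiv>
     relative_coboundaries G q K L #>\<^bsub>pointwise_group G (relative_cocycles G q K L)\<^esub> \<phi>"

lemma simplicial_cohomologyE:
  assumes "C \<in> carrier (simplicial_cohomology G q K L)"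
  obtains \<phi> where "\<phi> \<in> relative_cocycles G q K L" "C = cohomology_class q K L \<phi>"
  using assms by (auto simp: simplicial_cohomology_def carrier_FactGroup)

lemma simplicial_cohomology_map_class:
  assumes "simplicial_pair K L" "simplicial_pair K' L'" "simplicial_pair_map f K L K' L'"
    and "\<phi> \<in> relative_cocycles G q K' L'"
  shows "simplicial_cohomology_map G q f K L (cohomology_class q K' L' \<phi>)
    = cohomology_class q K L (simplicial_cochain_map G q f K \<phi>)"
  unfolding simplicial_cohomology_map_def
  by (rule hom_quotient_coset)
    (use assms in \<open>auto intro: comm_group_pointwise_group pointwise_closed_cocycles subgroup_coboundaries
        simplicial_cochain_map_hom simplicial_cochain_map_coboundaries\<close>)

lemma simplicial_cohomology_map_comp:
  assumes "simplicial_pair K L" "simplicial_pair K' L'" "simplicial_pair K'' L''"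
    and "simplicial_pair_map f K L K' L'" "simplicial_pair_map g K' L' K'' L''"
    and "C \<in> carrier (simplicial_cohomology G q K'' L'')"
  shows "simplicial_cohomology_map G q f K L (simplicial_cohomology_map G q g K' L' C)
    = simplicial_cohomology_map G q (g \<circ> f) K L C"
proof -
  obtain \<phi> where \<phi>: "\<phi> \<in> relative_cocycles G q K'' L''" "C = cohomology_class q K'' L'' \<phi>"
    using assms(6) by (rule simplicial_cohomologyE)
  then have "\<phi> \<in> relative_cochains G q K'' L''" by (simp add: relative_cocycles_def)
  then have "simplicial_cochain_map G q f K (simplicial_cochain_map G q g K' \<phi>)
      = simplicial_cochain_map G q (g \<circ> f) K \<phi>"
    using assms(4) by (intro simplicial_cochain_map_comp) (auto simp: simplicial_pair_map_def)
  then show ?thesis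
    using assms \<phi> simplicial_pair_map_comp[OF assms(4,5)]
      simplicial_cochain_map_cocycles[OF assms(2,5) \<phi>(1)]
    by (simp add: simplicial_cohomology_map_class)
qed

lemma simplicial_cohomology_map_id:
  assumes "simplicial_pair K L" "C \<in> carrier (simplicial_cohomology G q K L)"
  shows "simplicial_cohomology_map G q id K L C = C"
proof -
  obtain \<phi> where \<phi>: "\<phi> \<in> relative_cocycles G q K L" "C = cohomology_class q K L \<phi>"
    using assms(2) by (rule simplicial_cohomologyE)
  then have "\<phi> \<in> relative_cochains G q K L" by (simp add: relative_cocycles_def)
  moreover have "simplicial_pair_map id K L K L" by (simp add: simplicial_pair_map_def)
  ultimately show ?thesis
    using assms \<phi> by (simp add: simplicial_cohomology_map_class simplicial_cochain_map_id)
qed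

end

section \<open>Limits of directed systems of commutative groups\<close>

lemma inverse_limit_group_simps [simp]:
  "\<xi> \<otimes>\<^bsub>inverse_limit_group I r G t\<^esub> \<eta> = (\<lambda>i\<in>I. \<xi> i \<otimes>\<^bsub>G i\<^esub> \<eta> i)"
  "\<one>\<^bsub>inverse_limit_group I r G t\<^esub> = (\<lambda>i\<in>I. \<one>\<^bsub>G i\<^esub>)"
  by (simp_all add: inverse_limit_group_def)

lemma carrier_inverse_limit_group:
  "\<xi> \<in> carrier (inverse_limit_group I r G t) \<longleftrightarrow>
     \<xi> \<in> (\<Pi>\<^sub>E i\<in>I. carrier (G i)) \<and> (\<forall>i\<in>I. \<forall>j\<in>I. r i j \<longrightarrow> t i j (\<xi> i) = \<xi> j)"
  by (simp add: inverse_limit_group_def)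

text \<open>Multiplication is componentwise, and compatible families are stable under it and under
  inverses because the transition maps are homomorphisms. Families are extensional on
  \<open>I\<close>, so agreement on \<open>I\<close> is equality.\<close>

lemma comm_group_inverse_limit_group:
  assumes G: "\<And>i. i \<in> I \<Longrightarrow> comm_group (G i)"
    and t: "\<And>i j. i \<in> I \<Longrightarrow> j \<in> I \<Longrightarrow> r i j \<Longrightarrow> t i j \<in> hom (G i) (G j)"
  shows "comm_group (inverse_limit_group I r G t)"
proof (rule comm_groupI)
  have group: "Group.group (G i)" if "i \<in> I" for i using G[OF that] by (simp add: comm_group_def)
  have monoid: "monoid (G i)" if "i \<in> I" for i using group[OF that] by (simp add: group.is_monoid)
  fix \<xi> assume \<xi>: "\<xi> \<in> carrier (inverse_limit_group I r G t)"
  then have \<xi>i: "\<xi> i \<in> carrier (G i)" if "i \<in> I" for i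
    using that by (auto simp: carrier_inverse_limit_group)
  have "t i j (inv\<^bsub>G i\<^esub> \<xi> i) = inv\<^bsub>G j\<^esub> \<xi> j" if "i \<in> I" "j \<in> I" "r i j" for i j
  proof -
    interpret group_hom "G i" "G j" "t i j"
      using that group t by (simp add: group_hom_def group_hom_axioms_def)
    show ?thesis using \<xi> \<xi>i that by (simp add: carrier_inverse_limit_group)
  qed
  then have "(\<lambda>i\<in>I. inv\<^bsub>G i\<^esub> \<xi> i) \<in> carrier (inverse_limit_group I r G t)"
    using \<xi>i group by (auto simp: carrier_inverse_limit_group)
  moreover have "(\<lambda>i\<in>I. (\<lambda>i\<in>I. inv\<^bsub>G i\<^esub> \<xi> i) i \<otimes>\<^bsub>G i\<^esub> \<xi> i) = (\<lambda>i\<in>I. \<one>\<^bsub>G i\<^esub>)"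
    using \<xi>i group by (auto simp: group.l_inv intro!: restrict_ext)
  ultimately show "\<exists>\<eta>\<in>carrier (inverse_limit_group I r G t).
      \<eta> \<otimes>\<^bsub>inverse_limit_group I r G t\<^esub> \<xi> = \<one>\<^bsub>inverse_limit_group I r G t\<^esub>"
    unfolding inverse_limit_group_simps by blast
  have "(\<lambda>i\<in>I. (\<lambda>i\<in>I. \<one>\<^bsub>G i\<^esub>) i \<otimes>\<^bsub>G i\<^esub> \<xi> i) = (\<lambda>i\<in>I. \<xi> i)"
    using \<xi>i monoid by (auto simp: monoid.l_one intro!: restrict_ext)
  also have "\<dots> = \<xi>" using \<xi> by (auto simp: carrier_inverse_limit_group)
  finally show "\<one>\<^bsub>inverse_limit_group I r G t\<^esub> \<otimes>\<^bsub>inverse_limit_group I r G t\<^esub> \<xi> = \<xi>" by simp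
  fix \<eta> assume \<eta>: "\<eta> \<in> carrier (inverse_limit_group I r G t)"
  then have \<eta>i: "\<eta> i \<in> carrier (G i)" if "i \<in> I" for i
    using that by (auto simp: carrier_inverse_limit_group)
  have "t i j (\<xi> i \<otimes>\<^bsub>G i\<^esub> \<eta> i) = \<xi> j \<otimes>\<^bsub>G j\<^esub> \<eta> j" if "i \<in> I" "j \<in> I" "r i j" for i j
    using t[OF that] \<xi> \<eta> \<xi>i \<eta>i that by (simp add: hom_mult carrier_inverse_limit_group)
  then show "\<xi> \<otimes>\<^bsub>inverse_limit_group I r G t\<^esub> \<eta> \<in> carrier (inverse_limit_group I r G t)"
    using \<xi>i \<eta>i monoid by (auto simp: carrier_inverse_limit_group monoid.m_closed)
  show "\<xi> \<otimes>\<^bsub>inverse_limit_group I r G t\<^esub> \<eta> = \<eta> \<otimes>\<^bsub>inverse_limit_group I r G t\<^esub> \<xi>"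
    using \<xi>i \<eta>i G by (auto simp: comm_groupE(4) intro!: restrict_ext)
  fix \<zeta> assume "\<zeta> \<in> carrier (inverse_limit_group I r G t)"
  then have \<zeta>i: "\<zeta> i \<in> carrier (G i)" if "i \<in> I" for i
    using that by (auto simp: carrier_inverse_limit_group)
  show "\<xi> \<otimes>\<^bsub>inverse_limit_group I r G t\<^esub> \<eta> \<otimes>\<^bsub>inverse_limit_group I r G t\<^esub> \<zeta>
      = \<xi> \<otimes>\<^bsub>inverse_limit_group I r G t\<^esub> (\<eta> \<otimes>\<^bsub>inverse_limit_group I r G t\<^esub> \<zeta>)"
    using \<xi>i \<eta>i \<zeta>i monoid by (auto simp: monoid.m_assoc intro!: restrict_ext)
next
  have "t i j \<one>\<^bsub>G i\<^esub> = \<one>\<^bsub>G j\<^esub>" if "i \<in> I" "j \<in> I" "r i j" for i j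
    using hom_one[OF t[OF that]] G that by (simp add: comm_group_def)
  then show "\<one>\<^bsub>inverse_limit_group I r G t\<^esub> \<in> carrier (inverse_limit_group I r G t)"
    using G by (auto simp: carrier_inverse_limit_group comm_groupE(2))
qed

section \<open>Direct systems, their limits and maps between them\<close>

locale direct_system =
  fixes I :: "'i set" and r :: "'i \<Rightarrow> 'i \<Rightarrow> bool" and G :: "'i \<Rightarrow> ('h, 'm) monoid_scheme"
    and t :: "'i \<Rightarrow> 'i \<Rightarrow> 'h \<Rightarrow> 'h"
  assumes nonempty: "I \<noteq> {}"
    and comm: "i \<in> I \<Longrightarrow> comm_group (G i)"
    and refl: "i \<in> I \<Longrightarrow> r i i"
    and trans: "i \<in> I \<Longrightarrow> j \<in> I \<Longrightarrow> k \<in> I \<Longrightarrow> r i j \<Longrightarrow> r j k \<Longrightarrow> r i k"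
    and directed: "i \<in> I \<Longrightarrow> j \<in> I \<Longrightarrow> \<exists>k\<in>I. r i k \<and> r j k"
    and t_hom: "i \<in> I \<Longrightarrow> j \<in> I \<Longrightarrow> r i j \<Longrightarrow> t i j \<in> hom (G i) (G j)"
    and t_comp: "i \<in> I \<Longrightarrow> j \<in> I \<Longrightarrow> k \<in> I \<Longrightarrow> r i j \<Longrightarrow> r j k \<Longrightarrow> a \<in> carrier (G i) \<Longrightarrow>
      t j k (t i j a) = t i k a"
begin

abbreviation limit where "limit \<equiv> direct_limit_group I r G t"
abbreviation cls where "cls \<equiv> direct_limit_class I r G t"

lemma t_closed: "i \<in> I \<Longrightarrow> j \<in> I \<Longrightarrow> r i j \<Longrightarrow> a \<in> carrier (G i) \<Longrightarrow> t i j a \<in> carrier (G j)"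
  using t_hom by (auto simp: hom_def)

lemma m_closed: "i \<in> I \<Longrightarrow> a \<in> carrier (G i) \<Longrightarrow> b \<in> carrier (G i) \<Longrightarrow> a \<otimes>\<^bsub>G i\<^esub> b \<in> carrier (G i)"
  using comm comm_groupE(1) by metis

lemma directed3:
  assumes "i \<in> I" "j \<in> I" "k \<in> I"
  obtains l where "l \<in> I" "r i l" "r j l" "r k l"
proof -
  obtain m where m: "m \<in> I" "r i m" "r j m" using directed[OF assms(1,2)] by blast
  obtain l where "l \<in> I" "r m l" "r k l" using directed[OF m(1) assms(3)] by blast
  then show ?thesis using that trans m assms by metis
qed

lemma equiv_rel: "equiv (SIGMA i:I. carrier (G i)) (direct_limit_rel I r G t)"
proof (rule equivI)
  show "direct_limit_rel I r G t \<subseteq> (SIGMA i:I. carrier (G i)) \<times> (SIGMA i:I. carrier (G i))"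
    by (auto simp: direct_limit_rel_def)
  show "refl_on (SIGMA i:I. carrier (G i)) (direct_limit_rel I r G t)"
    using refl by (auto simp: refl_on_def direct_limit_rel_def)
  show "sym (direct_limit_rel I r G t)"
    unfolding sym_def direct_limit_rel_def by (auto intro: HOL.sym)
  show "Relation.trans (direct_limit_rel I r G t)"
  proof (rule transI)
    fix x y z assume "(x, y) \<in> direct_limit_rel I r G t" "(y, z) \<in> direct_limit_rel I r G t"
    then obtain i a j b l c k m where *:
      "x = (i, a)" "y = (j, b)" "z = (l, c)" "i \<in> I" "j \<in> I" "l \<in> I" "k \<in> I" "m \<in> I"
      "a \<in> carrier (G i)" "b \<in> carrier (G j)" "c \<in> carrier (G l)"
      "r i k" "r j k" "t i k a = t j k b" "r j m" "r l m" "t j m b = t l m c"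
      by (auto simp: direct_limit_rel_def)
    \<comment> \<open>The equality at \<open>k\<close> and the equality at \<open>m\<close> are both
      pushed to a later stage.\<close>
    obtain n where n: "n \<in> I" "r k n" "r m n" using directed * by blast
    have "t i n a = t j n b" "t j n b = t l n c"
      using * n t_comp[of i k n a] t_comp[of j k n b] t_comp[of j m n b] t_comp[of l m n c] by simp_all
    moreover have "r i n" "r l n" using * n trans by blast+
    ultimately show "(x, z) \<in> direct_limit_rel I r G t"
      using * n by (auto simp: direct_limit_rel_def)
  qed
qed

lemma cls_eq_iff:
  assumes "i \<in> I" "a \<in> carrier (G i)" "j \<in> I" "b \<in> carrier (G j)"
  shows "cls i a = cls j b \<longleftrightarrow> (\<exists>k\<in>I. r i k \<and> r j k \<and> t i k a = t j k b)"
  using assms unfolding direct_limit_class_def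
  by (subst eq_equiv_class_iff[OF equiv_rel]) (auto simp: direct_limit_rel_def)

lemma mem_cls_iff:
  assumes "i \<in> I" "a \<in> carrier (G i)"
  shows "(j, b) \<in> cls i a \<longleftrightarrow> j \<in> I \<and> b \<in> carrier (G j) \<and> cls i a = cls j b"
proof -
  have "(j, b) \<in> cls i a \<longleftrightarrow> j \<in> I \<and> b \<in> carrier (G j) \<and> (\<exists>k\<in>I. r i k \<and> r j k \<and> t i k a = t j k b)"
    using assms by (auto simp: direct_limit_class_def direct_limit_rel_def)
  then show ?thesis using cls_eq_iff assms by blast
qed

lemma cls_t:
  assumes "i \<in> I" "k \<in> I" "r i k" "a \<in> carrier (G i)"
  shows "cls k (t i k a) = cls i a"
  using assms refl t_comp[of i k k a] by (subst cls_eq_iff) (auto simp: t_closed)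

lemma carrier_limit: "P \<in> carrier limit \<longleftrightarrow> (\<exists>i\<in>I. \<exists>a\<in>carrier (G i). P = cls i a)"
  by (auto simp: direct_limit_group_def direct_limit_class_def quotient_def)

text \<open>The product is defined as a union over all representatives and stages. Only one class
  occurs in it, since any two of the computations agree at a common later stage.\<close>

lemma cls_mult:
  assumes "i \<in> I" "j \<in> I" "k \<in> I" "r i k" "r j k" "a \<in> carrier (G i)" "b \<in> carrier (G j)"
  shows "cls i a \<otimes>\<^bsub>limit\<^esub> cls j b = cls k (t i k a \<otimes>\<^bsub>G k\<^esub> t j k b)"
proof -
  have indep: "cls k' (t i' k' a' \<otimes>\<^bsub>G k'\<^esub> t j' k' b') = cls k (t i k a \<otimes>\<^bsub>G k\<^esub> t j k b)"
    if i': "(i', a') \<in> cls i a" and j': "(j', b') \<in> cls j b" and k': "k' \<in> I" "r i' k'" "r j' k'"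
    for i' a' j' b' k'
  proof -
    have i'I: "i' \<in> I" "a' \<in> carrier (G i')" "cls i a = cls i' a'"
      and j'I: "j' \<in> I" "b' \<in> carrier (G j')" "cls j b = cls j' b'"
      using i' j' assms by (auto simp: mem_cls_iff)
    obtain m where m: "m \<in> I" "r i m" "r i' m" "t i m a = t i' m a'"
      using i'I assms by (auto simp: cls_eq_iff)
    obtain n where n: "n \<in> I" "r j n" "r j' n" "t j n b = t j' n b'"
      using j'I assms by (auto simp: cls_eq_iff)
    \<comment> \<open>At \<open>m\<close> and \<open>n\<close> the representatives have become
      equal. At a stage \<open>p\<close> beyond these and beyond \<open>k\<close> and
      \<open>k'\<close>, both products turn into the product of \<open>t i p a\<close> and
      \<open>t j p b\<close>.\<close>
    obtain l where l: "l \<in> I" "r m l" "r n l" "r k l" using directed3 m n assms by metis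
    obtain p where p: "p \<in> I" "r l p" "r k' p" using directed l k' by blast
    have pr: "r m p" "r n p" "r k p" using trans l p m n assms by blast+
    have "t i p a = t i' p a'"
      using t_comp[of i m p a] t_comp[of i' m p a'] m pr p i'I assms by simp
    moreover have "t j p b = t j' p b'"
      using t_comp[of j n p b] t_comp[of j' n p b'] n pr p j'I assms by simp
    moreover have "t k p (t i k a \<otimes>\<^bsub>G k\<^esub> t j k b) = t i p a \<otimes>\<^bsub>G p\<^esub> t j p b"
      using t_hom[of k p] t_comp[of i k p a] t_comp[of j k p b] pr p assms
      by (simp add: hom_mult t_closed)
    moreover have "t k' p (t i' k' a' \<otimes>\<^bsub>G k'\<^esub> t j' k' b') = t i' p a' \<otimes>\<^bsub>G p\<^esub> t j' p b'"
      using t_hom[of k' p] t_comp[of i' k' p a'] t_comp[of j' k' p b'] p k' i'I j'I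
      by (simp add: hom_mult t_closed)
    ultimately show ?thesis
      using p pr k' i'I j'I assms by (subst cls_eq_iff) (auto simp: t_closed m_closed)
  qed
  have self: "(i, a) \<in> cls i a" "(j, b) \<in> cls j b" using assms by (auto simp: mem_cls_iff)
  have "{cls k' (t i' k' a' \<otimes>\<^bsub>G k'\<^esub> t j' k' b') | i' a' j' b' k'.
      (i', a') \<in> cls i a \<and> (j', b') \<in> cls j b \<and> k' \<in> I \<and> r i' k' \<and> r j' k'}
    = {cls k (t i k a \<otimes>\<^bsub>G k\<^esub> t j k b)}" (is "?S = {?c}")
  proof (intro equalityI subsetI)
    fix c assume "c \<in> ?S" then show "c \<in> {?c}" using indep by auto
  next
    fix c assume "c \<in> {?c}"
    then show "c \<in> ?S" using self assms by blast
  qed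
  then show ?thesis by (simp add: direct_limit_group_def)
qed

text \<open>\<open>t k k\<close> is known only as a homomorphism composing correctly with the
  others, so it is absorbed by \<open>cls_t\<close> after passing to classes.\<close>

lemma cls_mult_same:
  assumes "k \<in> I" "a \<in> carrier (G k)" "b \<in> carrier (G k)"
  shows "cls k a \<otimes>\<^bsub>limit\<^esub> cls k b = cls k (a \<otimes>\<^bsub>G k\<^esub> b)"
proof -
  have "cls k a \<otimes>\<^bsub>limit\<^esub> cls k b = cls k (t k k a \<otimes>\<^bsub>G k\<^esub> t k k b)"
    using assms refl by (intro cls_mult) auto
  also have "\<dots> = cls k (t k k (a \<otimes>\<^bsub>G k\<^esub> b))"
    using t_hom[of k k] assms refl by (simp add: hom_mult)
  also have "\<dots> = cls k (a \<otimes>\<^bsub>G k\<^esub> b)" using assms refl m_closed by (intro cls_t) auto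
  finally show ?thesis .
qed

lemma cls_one_eq:
  assumes "i \<in> I" "j \<in> I" shows "cls i \<one>\<^bsub>G i\<^esub> = cls j \<one>\<^bsub>G j\<^esub>"
proof -
  obtain k where k: "k \<in> I" "r i k" "r j k" using directed assms by blast
  have "t l k \<one>\<^bsub>G l\<^esub> = \<one>\<^bsub>G k\<^esub>" if "l \<in> I" "r l k" for l
    using hom_one[OF t_hom[of l k]] comm[of l] comm[of k] that k by (simp add: comm_group_def)
  then show ?thesis using k assms comm by (subst cls_eq_iff) (auto simp: comm_groupE(2))
qed

lemma one_limit:
  assumes "k \<in> I" shows "\<one>\<^bsub>limit\<^esub> = cls k \<one>\<^bsub>G k\<^esub>"
proof -
  have "(\<lambda>i. cls i \<one>\<^bsub>G i\<^esub>) ` I = {cls k \<one>\<^bsub>G k\<^esub>}" using cls_one_eq assms by blast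
  then show ?thesis by (simp add: direct_limit_group_def)
qed

text \<open>Finitely many classes have representatives at one stage \<open>k\<close>, and the group
  axioms of the limit are inherited from \<open>G k\<close> there.\<close>

lemma common_index2:
  assumes "P \<in> carrier limit" "Q \<in> carrier limit"
  obtains k a b where "k \<in> I" "a \<in> carrier (G k)" "b \<in> carrier (G k)" "P = cls k a" "Q = cls k b"
proof -
  obtain i a j b where *: "i \<in> I" "a \<in> carrier (G i)" "P = cls i a" "j \<in> I" "b \<in> carrier (G j)" "Q = cls j b"
    using assms by (auto simp: carrier_limit)
  obtain k where "k \<in> I" "r i k" "r j k" using directed * by blast
  then show ?thesis using * that[of k "t i k a" "t j k b"] by (simp add: t_closed cls_t)
qed

lemma common_index3:
  assumes "P \<in> carrier limit" "Q \<in> carrier limit" "R \<in> carrier limit"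
  obtains k a b c where "k \<in> I" "a \<in> carrier (G k)" "b \<in> carrier (G k)" "c \<in> carrier (G k)"
    "P = cls k a" "Q = cls k b" "R = cls k c"
proof -
  obtain i a b where *: "i \<in> I" "a \<in> carrier (G i)" "b \<in> carrier (G i)" "P = cls i a" "Q = cls i b"
    using common_index2 assms by metis
  obtain j c where j: "j \<in> I" "c \<in> carrier (G j)" "R = cls j c" using assms by (auto simp: carrier_limit)
  obtain k where "k \<in> I" "r i k" "r j k" using directed * j by blast
  then show ?thesis using * j that[of k "t i k a" "t i k b" "t j k c"] by (simp add: t_closed cls_t)
qed

lemma cls_closed: "i \<in> I \<Longrightarrow> a \<in> carrier (G i) \<Longrightarrow> cls i a \<in> carrier limit"
  by (auto simp: carrier_limit)

lemma comm_group_limit: "comm_group limit"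
proof (rule comm_groupI)
  fix P Q assume "P \<in> carrier limit" "Q \<in> carrier limit"
  then obtain k a b where *: "k \<in> I" "a \<in> carrier (G k)" "b \<in> carrier (G k)" "P = cls k a" "Q = cls k b"
    by (rule common_index2)
  then show "P \<otimes>\<^bsub>limit\<^esub> Q \<in> carrier limit" by (simp add: cls_mult_same cls_closed m_closed)
  show "P \<otimes>\<^bsub>limit\<^esub> Q = Q \<otimes>\<^bsub>limit\<^esub> P"
    using * comm_groupE(4)[OF comm[OF *(1)], of a b] by (simp add: cls_mult_same)
next
  fix P Q R assume "P \<in> carrier limit" "Q \<in> carrier limit" "R \<in> carrier limit"
  then obtain k a b c where *: "k \<in> I" "a \<in> carrier (G k)" "b \<in> carrier (G k)" "c \<in> carrier (G k)"
    "P = cls k a" "Q = cls k b" "R = cls k c" by (rule common_index3)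
  then show "P \<otimes>\<^bsub>limit\<^esub> Q \<otimes>\<^bsub>limit\<^esub> R = P \<otimes>\<^bsub>limit\<^esub> (Q \<otimes>\<^bsub>limit\<^esub> R)"
    using comm_groupE(3)[OF comm[OF *(1)], of a b c] by (simp add: cls_mult_same m_closed)
next
  obtain k where "k \<in> I" using nonempty by blast
  then show "\<one>\<^bsub>limit\<^esub> \<in> carrier limit" using comm by (simp add: one_limit cls_closed comm_groupE(2))
next
  fix P assume "P \<in> carrier limit"
  then obtain k a where k: "k \<in> I" "a \<in> carrier (G k)" "P = cls k a" by (auto simp: carrier_limit)
  interpret Gk: comm_group "G k" by (rule comm) fact
  show "\<one>\<^bsub>limit\<^esub> \<otimes>\<^bsub>limit\<^esub> P = P" using k by (simp add: one_limit cls_mult_same)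
  show "\<exists>Q\<in>carrier limit. Q \<otimes>\<^bsub>limit\<^esub> P = \<one>\<^bsub>limit\<^esub>"
    using k by (intro bexI[of _ "cls k (inv\<^bsub>G k\<^esub> a)"]) (simp_all add: one_limit cls_mult_same cls_closed)
qed

end

text \<open>A map of direct systems is indexed by a relation \<open>M\<close> rather than by a function, since there is no
  canonical choice of \<open>U\<close> with \<open>f(U) \<subseteq> V\<close>.\<close>

locale direct_system_map = S: direct_system I r G t + T: direct_system J s H u
  for I :: "'i set" and r and G :: "'i \<Rightarrow> ('h, 'm) monoid_scheme" and t
    and J :: "'j set" and s and H :: "'j \<Rightarrow> ('k, 'n) monoid_scheme" and u +
  fixes M :: "'i \<Rightarrow> 'j \<Rightarrow> bool" and h :: "'j \<Rightarrow> 'h \<Rightarrow> 'k"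
  assumes M_total: "i \<in> I \<Longrightarrow> \<exists>j\<in>J. M i j"
    and M_up: "i \<in> I \<Longrightarrow> j \<in> J \<Longrightarrow> j' \<in> J \<Longrightarrow> M i j \<Longrightarrow> s j j' \<Longrightarrow> M i j'"
    and M_down: "i \<in> I \<Longrightarrow> i' \<in> I \<Longrightarrow> j \<in> J \<Longrightarrow> r i i' \<Longrightarrow> M i' j \<Longrightarrow> M i j"
    and h_hom: "i \<in> I \<Longrightarrow> j \<in> J \<Longrightarrow> M i j \<Longrightarrow> h j \<in> hom (G i) (H j)"
    and u_h: "i \<in> I \<Longrightarrow> j \<in> J \<Longrightarrow> j' \<in> J \<Longrightarrow> M i j \<Longrightarrow> s j j' \<Longrightarrow> a \<in> carrier (G i) \<Longrightarrow>
      u j j' (h j a) = h j' a"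
    and h_t: "i \<in> I \<Longrightarrow> i' \<in> I \<Longrightarrow> j \<in> J \<Longrightarrow> r i i' \<Longrightarrow> M i' j \<Longrightarrow> a \<in> carrier (G i) \<Longrightarrow>
      h j (t i i' a) = h j a"
begin

text \<open>The union mirrors \<open>vr_cohomology_map\<close>, which thereby becomes an instance by
  unfolding.\<close>

definition limit_map where
  "limit_map P = \<Union> {T.cls j (h j a) | i a j. (i, a) \<in> P \<and> j \<in> J \<and> M i j}"

lemma h_closed: "i \<in> I \<Longrightarrow> j \<in> J \<Longrightarrow> M i j \<Longrightarrow> a \<in> carrier (G i) \<Longrightarrow> h j a \<in> carrier (H j)"
  using h_hom by (auto simp: hom_def)

text \<open>Representatives \<open>a\<close> and \<open>a'\<close> of one class become equal at some
  \<open>k\<close>. Totality of \<open>M\<close> gives a target stage for \<open>k\<close>, and at a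
  stage \<open>m\<close> beyond it and beyond \<open>j\<close> and \<open>j'\<close> the two images
  agree because \<open>h m\<close> is compatible with the transition maps into
  \<open>k\<close>.\<close>

lemma limit_map_cls:
  assumes "i \<in> I" "a \<in> carrier (G i)" "j \<in> J" "M i j"
  shows "limit_map (S.cls i a) = T.cls j (h j a)"
proof -
  have indep: "T.cls j' (h j' a') = T.cls j (h j a)"
    if i': "(i', a') \<in> S.cls i a" and j': "j' \<in> J" "M i' j'" for i' a' j'
  proof -
    have i'I: "i' \<in> I" "a' \<in> carrier (G i')" "S.cls i a = S.cls i' a'"
      using i' assms by (auto simp: S.mem_cls_iff)
    obtain k where k: "k \<in> I" "r i k" "r i' k" "t i k a = t i' k a'"
      using i'I assms by (auto simp: S.cls_eq_iff)
    obtain l where l: "l \<in> J" "M k l" using M_total k by blast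
    obtain m where m: "m \<in> J" "s l m" "s j m" "s j' m" using T.directed3 l j' assms by metis
    have "M k m" using M_up k l m by blast
    then have "h m a = h m a'" using h_t[of i k m a] h_t[of i' k m a'] k m i'I assms by simp
    moreover have "T.cls m (h m a) = T.cls j (h j a)"
      using u_h[of i j m a] T.cls_t[of j m "h j a"] assms m by (simp add: h_closed)
    moreover have "T.cls m (h m a') = T.cls j' (h j' a')"
      using u_h[of i' j' m a'] T.cls_t[of j' m "h j' a'"] i'I j' m by (simp add: h_closed)
    ultimately show ?thesis by simp
  qed
  have self: "(i, a) \<in> S.cls i a" using assms by (auto simp: S.mem_cls_iff)
  have "{T.cls j' (h j' a') | i' a' j'. (i', a') \<in> S.cls i a \<and> j' \<in> J \<and> M i' j'} = {T.cls j (h j a)}"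
    using indep self assms(3,4) by blast
  then show ?thesis by (simp add: limit_map_def)
qed

lemma limit_map_hom: "limit_map \<in> hom S.limit T.limit"
proof (rule homI)
  fix P assume "P \<in> carrier S.limit"
  then obtain i a where i: "i \<in> I" "a \<in> carrier (G i)" "P = S.cls i a" by (auto simp: S.carrier_limit)
  obtain j where "j \<in> J" "M i j" using M_total i by blast
  then show "limit_map P \<in> carrier T.limit"
    using i by (simp add: limit_map_cls T.cls_closed h_closed)
next
  fix P Q assume "P \<in> carrier S.limit" "Q \<in> carrier S.limit"
  then obtain k a b where *: "k \<in> I" "a \<in> carrier (G k)" "b \<in> carrier (G k)" "P = S.cls k a" "Q = S.cls k b"
    by (rule S.common_index2)
  obtain j where "j \<in> J" "M k j" using M_total * by blast
  then show "limit_map (P \<otimes>\<^bsub>S.limit\<^esub> Q) = limit_map P \<otimes>\<^bsub>T.limit\<^esub> limit_map Q"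
    using * h_hom[of k j]
    by (simp add: limit_map_cls S.cls_mult_same T.cls_mult_same S.m_closed h_closed hom_mult)
qed

end

section \<open>Vietoris-Rips complexes\<close>

lemma sorted_wrt_remdups:
  "sorted_wrt R xs \<Longrightarrow> sorted_wrt R (remdups xs)"
  by (induction xs) auto

text \<open>\<open>f\<close> may identify vertices, so an admissible ordering can map to a list with
  repetitions. Deleting the repetitions leaves a sublist, on which the relation still holds for all
  ordered pairs.\<close>

lemma vr_complex_image:
  assumes "S \<in> vr_complex X U" "f ` X \<subseteq> Y" "rel_maps_into f U V"
  shows "f ` S \<in> vr_complex Y V"
proof -
  obtain xs where xs: "S = set xs" "xs \<noteq> []" "set xs \<subseteq> X" "sorted_wrt (\<lambda>x y. (x, y) \<in> U) xs"
    using assms(1) by (auto simp: vr_complex_def)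
  have "sorted_wrt (\<lambda>x y. (x, y) \<in> V) (map f xs)"
    unfolding sorted_wrt_map
    by (rule sorted_wrt_mono_rel[OF _ xs(4)]) (use assms(3) in \<open>auto simp: rel_maps_into_def\<close>)
  then have "sorted_wrt (\<lambda>x y. (x, y) \<in> V) (remdups (map f xs))" by (rule sorted_wrt_remdups)
  moreover have "f ` S = set (remdups (map f xs))" "set (remdups (map f xs)) \<subseteq> Y"
    "remdups (map f xs) \<noteq> []" using xs assms(2) by auto
  ultimately show ?thesis
    unfolding vr_complex_def mem_Collect_eq using distinct_remdups by blast
qed

lemma subset_closed_vr_complex: "subset_closed (vr_complex X U)"
  unfolding subset_closed_def
proof (intro ballI allI impI)
  fix S T assume "S \<in> vr_complex X U" and T: "T \<noteq> {} \<and> T \<subseteq> S"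
  then obtain xs where xs: "S = set xs" "set xs \<subseteq> X" "distinct xs" "sorted_wrt (\<lambda>x y. (x, y) \<in> U) xs"
    by (auto simp: vr_complex_def)
  have "T = set (filter (\<lambda>x. x \<in> T) xs)" using T xs by auto
  moreover from this T have "filter (\<lambda>x. x \<in> T) xs \<noteq> []" by (metis set_empty)
  moreover have "set (filter (\<lambda>x. x \<in> T) xs) \<subseteq> X" using xs by auto
  ultimately show "T \<in> vr_complex X U"
    unfolding vr_complex_def mem_Collect_eq
    using xs distinct_filter sorted_wrt_filter by blast
qed

lemma rel_maps_into_id: "U \<subseteq> V \<Longrightarrow> rel_maps_into id U V"
  by (auto simp: rel_maps_into_def)

lemma rel_maps_into_comp: "rel_maps_into f U V \<Longrightarrow> rel_maps_into g V W \<Longrightarrow> rel_maps_into (g \<circ> f) U W"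
  by (simp add: rel_maps_into_def)

lemma rel_maps_into_mono: "rel_maps_into f U V \<Longrightarrow> U' \<subseteq> U \<Longrightarrow> V \<subseteq> V' \<Longrightarrow> rel_maps_into f U' V'"
  by (auto simp: rel_maps_into_def)

abbreviation vr_subcomplex where
  "vr_subcomplex A U \<equiv> vr_complex A (rel_trace U A)"

lemma vr_simplicial_pair_map:
  assumes "f ` X \<subseteq> Y" "f ` A \<subseteq> B" "rel_maps_into f U V"
  shows "simplicial_pair_map f (vr_complex X U) (vr_subcomplex A U) (vr_complex Y V) (vr_subcomplex B V)"
proof -
  have "rel_maps_into f (rel_trace U A) (rel_trace V B)"
    using assms by (auto simp: rel_maps_into_def rel_trace_def)
  then show ?thesis
    using vr_complex_image[OF _ assms(1,3)] vr_complex_image[OF _ assms(2)]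
    by (simp add: simplicial_pair_map_def)
qed

lemma vr_simplicial_pair:
  assumes "A \<subseteq> X"
  shows "simplicial_pair (vr_complex X U) (vr_subcomplex A U)"
proof -
  \<comment> \<open>The inclusion is the case of the identity vertex map, as
    \<open>rel_trace U A\<close> is contained in \<open>U\<close>.\<close>
  have "S \<in> vr_complex X U" if "S \<in> vr_subcomplex A U" for S
    using vr_complex_image[OF that, of id X U] assms
    by (auto simp: rel_maps_into_def rel_trace_def)
  then show ?thesis by (auto simp: simplicial_pair_def subset_closed_vr_complex)
qed

lemma semi_uniform_pairD:
  assumes "semi_uniform_pair X A F"
  shows "A \<subseteq> X" "F \<noteq> {}" "U \<in> F \<Longrightarrow> V \<in> F \<Longrightarrow> U \<inter> V \<in> F"
  using assms by (auto simp: semi_uniform_pair_def semi_uniform_space_def)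

lemma semi_uniform_pair_mapD:
  assumes "semi_uniform_pair_map X A F Y B F' f"
  shows "f ` X \<subseteq> Y" "f ` A \<subseteq> B" "V \<in> F' \<Longrightarrow> \<exists>U\<in>F. rel_maps_into f U V"
  using assms by (auto simp: semi_uniform_pair_map_def semi_uniformly_continuous_def)

lemma semi_uniform_pair_map_id: "semi_uniform_pair_map X A F X A F id"
  by (auto simp: semi_uniform_pair_map_def semi_uniformly_continuous_def rel_maps_into_def)

lemma semi_uniform_pair_map_comp:
  assumes "semi_uniform_pair_map X A F Y B F' f" "semi_uniform_pair_map Y B F' Z C F'' g"
  shows "semi_uniform_pair_map X A F Z C F'' (g \<circ> f)"
proof -
  have "\<exists>U\<in>F. rel_maps_into (g \<circ> f) U W" if "W \<in> F''" for W
    using semi_uniform_pair_mapD(3)[OF assms(2) that] semi_uniform_pair_mapD(3)[OF assms(1)]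
      rel_maps_into_comp by metis
  moreover have "(g \<circ> f) ` X \<subseteq> Z" "(g \<circ> f) ` A \<subseteq> C"
    using semi_uniform_pair_mapD(1,2)[OF assms(1)] semi_uniform_pair_mapD(1,2)[OF assms(2)] by fastforce+
  ultimately show ?thesis
    by (simp add: semi_uniform_pair_map_def semi_uniformly_continuous_def)
qed

context comm_group
begin

section \<open>Maps between the homology and cohomology of single relations\<close>

lemma comm_group_vr_homology_at: "A \<subseteq> X \<Longrightarrow> comm_group (vr_homology_at G q X A U)"
  unfolding vr_homology_at_def by (intro comm_group_simplicial_homology vr_simplicial_pair)

lemma comm_group_vr_cohomology_at: "A \<subseteq> X \<Longrightarrow> comm_group (vr_cohomology_at G q X A U)"
  unfolding vr_cohomology_at_def by (intro comm_group_simplicial_cohomology vr_simplicial_pair)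

lemma vr_homology_map_at_hom:
  assumes "A \<subseteq> X" "B \<subseteq> Y" "f ` X \<subseteq> Y" "f ` A \<subseteq> B" "rel_maps_into f U V"
  shows "vr_homology_map_at G q f Y B V \<in> hom (vr_homology_at G q X A U) (vr_homology_at G q Y B V)"
  unfolding vr_homology_at_def vr_homology_map_at_def
  by (intro simplicial_homology_map_hom vr_simplicial_pair vr_simplicial_pair_map assms)

lemma vr_cohomology_map_at_hom:
  assumes "A \<subseteq> X" "B \<subseteq> Y" "f ` X \<subseteq> Y" "f ` A \<subseteq> B" "rel_maps_into f U V"
  shows "vr_cohomology_map_at G q f X A U \<in> hom (vr_cohomology_at G q Y B V) (vr_cohomology_at G q X A U)"
  unfolding vr_cohomology_at_def vr_cohomology_map_at_def
  by (intro simplicial_cohomology_map_hom vr_simplicial_pair vr_simplicial_pair_map assms)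

lemma vr_homology_map_at_comp:
  assumes "A \<subseteq> X" "B \<subseteq> Y" "C \<subseteq> Z" "f ` X \<subseteq> Y" "f ` A \<subseteq> B" "g ` Y \<subseteq> Z" "g ` B \<subseteq> C"
    and "rel_maps_into f U V" "rel_maps_into g V W" "\<xi> \<in> carrier (vr_homology_at G q X A U)"
  shows "vr_homology_map_at G q g Z C W (vr_homology_map_at G q f Y B V \<xi>)
    = vr_homology_map_at G q (g \<circ> f) Z C W \<xi>"
  using assms unfolding vr_homology_at_def vr_homology_map_at_def
  by (intro simplicial_homology_map_comp[of "vr_complex X U" "vr_subcomplex A U"]
      vr_simplicial_pair vr_simplicial_pair_map)

lemma vr_cohomology_map_at_comp:
  assumes "A \<subseteq> X" "B \<subseteq> Y" "C \<subseteq> Z" "f ` X \<subseteq> Y" "f ` A \<subseteq> B" "g ` Y \<subseteq> Z" "g ` B \<subseteq> C"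
    and "rel_maps_into f U V" "rel_maps_into g V W" "\<zeta> \<in> carrier (vr_cohomology_at G q Z C W)"
  shows "vr_cohomology_map_at G q f X A U (vr_cohomology_map_at G q g Y B V \<zeta>)
    = vr_cohomology_map_at G q (g \<circ> f) X A U \<zeta>"
  using assms unfolding vr_cohomology_at_def vr_cohomology_map_at_def
  by (intro simplicial_cohomology_map_comp[of _ _ _ _ "vr_complex Z W" "vr_subcomplex C W"]
      vr_simplicial_pair vr_simplicial_pair_map)

lemma vr_homology_map_at_id:
  "A \<subseteq> X \<Longrightarrow> \<xi> \<in> carrier (vr_homology_at G q X A U) \<Longrightarrow> vr_homology_map_at G q id X A U \<xi> = \<xi>"
  unfolding vr_homology_at_def vr_homology_map_at_def
  by (intro simplicial_homology_map_id vr_simplicial_pair)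

lemma vr_cohomology_map_at_id:
  "A \<subseteq> X \<Longrightarrow> \<eta> \<in> carrier (vr_cohomology_at G q X A U) \<Longrightarrow> vr_cohomology_map_at G q id X A U \<eta> = \<eta>"
  unfolding vr_cohomology_at_def vr_cohomology_map_at_def
  by (intro simplicial_cohomology_map_id vr_simplicial_pair)

subsection \<open>Functoriality of homology\<close>

lemma comm_group_vr_homology:
  assumes "semi_uniform_pair X A F"
  shows "comm_group (vr_homology G q X A F)"
  unfolding vr_homology_def using semi_uniform_pairD[OF assms]
  by (intro comm_group_inverse_limit_group comm_group_vr_homology_at vr_homology_map_at_hom
      rel_maps_into_id) auto

lemma vr_homologyD:
  assumes "\<xi> \<in> carrier (vr_homology G q X A F)"
  shows "U \<in> F \<Longrightarrow> \<xi> U \<in> carrier (vr_homology_at G q X A U)"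
    "U \<in> F \<Longrightarrow> U' \<in> F \<Longrightarrow> U \<subseteq> U' \<Longrightarrow> vr_homology_map_at G q id X A U' (\<xi> U) = \<xi> U'"
    "\<xi> \<in> extensional F"
  using assms by (auto simp: vr_homology_def carrier_inverse_limit_group PiE_iff)

lemma vr_homology_map_apply:
  assumes X: "semi_uniform_pair X A FX" and Y: "semi_uniform_pair Y B FY"
    and f: "semi_uniform_pair_map X A FX Y B FY f"
    and \<xi>: "\<xi> \<in> carrier (vr_homology G q X A FX)" and V: "V \<in> FY" and U: "U \<in> FX" "rel_maps_into f U V"
  shows "vr_homology_map G q FX Y B FY f \<xi> V = vr_homology_map_at G q f Y B V (\<xi> U)"
proof -
  note fD = semi_uniform_pair_mapD[OF f]
  \<comment> \<open>Used with the two relations in either order. The transition map from the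
    intersection is induced by \<open>id\<close>, so composing it with \<open>f\<close> gives the
    map of \<open>f\<close> again.\<close>
  have eq: "vr_homology_map_at G q f Y B V (\<xi> U1) = vr_homology_map_at G q f Y B V (\<xi> (U1 \<inter> U2))"
    if U12: "U1 \<in> FX" "U2 \<in> FX" and m: "rel_maps_into f U1 V" for U1 U2
  proof -
    have I: "U1 \<inter> U2 \<in> FX" using semi_uniform_pairD(3)[OF X] U12 by blast
    then have "vr_homology_map_at G q f Y B V (\<xi> U1)
        = vr_homology_map_at G q f Y B V (vr_homology_map_at G q id X A U1 (\<xi> (U1 \<inter> U2)))"
      using vr_homologyD(2)[OF \<xi> I U12(1)] by simp
    also have "\<dots> = vr_homology_map_at G q (f \<circ> id) Y B V (\<xi> (U1 \<inter> U2))"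
      by (rule vr_homology_map_at_comp[of A X A X _ _ _ _ "U1 \<inter> U2"])
        (use X Y fD(1,2) m vr_homologyD(1)[OF \<xi> I] in
          \<open>auto intro: rel_maps_into_id simp: semi_uniform_pair_def\<close>)
    finally show ?thesis by simp
  qed
  define U' where "U' = (SOME U. U \<in> FX \<and> rel_maps_into f U V)"
  have U': "U' \<in> FX" "rel_maps_into f U' V"
    using someI[of "\<lambda>U. U \<in> FX \<and> rel_maps_into f U V" U] U by (auto simp: U'_def)
  have "vr_homology_map G q FX Y B FY f \<xi> V = vr_homology_map_at G q f Y B V (\<xi> U')"
    using V by (simp add: vr_homology_map_def U'_def)
  also have "\<dots> = vr_homology_map_at G q f Y B V (\<xi> U)"
    using eq[OF U'(1) U(1) U'(2)] eq[OF U(1) U'(1) U(2)] by (simp add: Int_commute)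
  finally show ?thesis .
qed

text \<open>A relation \<open>U\<close> mapped by \<open>f\<close> into \<open>V\<close> is also
  mapped into any larger \<open>V'\<close>, so both components are images of the same
  \<open>\<xi> U\<close>; this is the compatibility of the new family.\<close>

lemma vr_homology_map_closed:
  assumes X: "semi_uniform_pair X A FX" and Y: "semi_uniform_pair Y B FY"
    and f: "semi_uniform_pair_map X A FX Y B FY f"
    and \<xi>: "\<xi> \<in> carrier (vr_homology G q X A FX)"
  shows "vr_homology_map G q FX Y B FY f \<xi> \<in> carrier (vr_homology G q Y B FY)"
proof -
  note fD = semi_uniform_pair_mapD[OF f]
  have AX: "A \<subseteq> X" "B \<subseteq> Y" using X Y by (auto simp: semi_uniform_pair_def)
  note apply_at = vr_homology_map_apply[OF X Y f \<xi>]
  have 1: "vr_homology_map G q FX Y B FY f \<xi> V \<in> carrier (vr_homology_at G q Y B V)" if "V \<in> FY" for V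
  proof -
    obtain U where U: "U \<in> FX" "rel_maps_into f U V" using fD(3) \<open>V \<in> FY\<close> by blast
    show ?thesis
      using hom_in_carrier[OF vr_homology_map_at_hom[OF AX fD(1,2) U(2)]] vr_homologyD(1)[OF \<xi> U(1)]
      by (simp add: apply_at[OF that U])
  qed
  have 2: "vr_homology_map_at G q id Y B V' (vr_homology_map G q FX Y B FY f \<xi> V)
      = vr_homology_map G q FX Y B FY f \<xi> V'" if "V \<in> FY" "V' \<in> FY" "V \<subseteq> V'" for V V'
  proof -
    obtain U where U: "U \<in> FX" "rel_maps_into f U V" using fD(3) \<open>V \<in> FY\<close> by blast
    then have U': "rel_maps_into f U V'" using rel_maps_into_mono that by blast
    have "vr_homology_map_at G q id Y B V' (vr_homology_map_at G q f Y B V (\<xi> U))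
        = vr_homology_map_at G q (id \<circ> f) Y B V' (\<xi> U)"
      by (rule vr_homology_map_at_comp[of A X B Y B Y _ _ U V])
        (use AX fD(1,2) U that vr_homologyD(1)[OF \<xi> U(1)] in \<open>auto intro: rel_maps_into_id\<close>)
    then show ?thesis using U U' that by (simp add: apply_at)
  qed
  have "vr_homology_map G q FX Y B FY f \<xi> \<in> extensional FY" by (simp add: vr_homology_map_def)
  then show ?thesis
    using 1 2 by (simp add: vr_homology_def[of G q Y] carrier_inverse_limit_group PiE_iff)
qed

lemma vr_homology_map_hom:
  assumes X: "semi_uniform_pair X A FX" and Y: "semi_uniform_pair Y B FY"
    and f: "semi_uniform_pair_map X A FX Y B FY f"
  shows "vr_homology_map G q FX Y B FY f \<in> hom (vr_homology G q X A FX) (vr_homology G q Y B FY)"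
proof (rule homI)
  fix \<xi> \<eta> assume \<xi>: "\<xi> \<in> carrier (vr_homology G q X A FX)" and \<eta>: "\<eta> \<in> carrier (vr_homology G q X A FX)"
  note fD = semi_uniform_pair_mapD[OF f]
  have AX: "A \<subseteq> X" "B \<subseteq> Y" using X Y by (auto simp: semi_uniform_pair_def)
  interpret H: comm_group "vr_homology G q X A FX" by (rule comm_group_vr_homology) fact
  have \<xi>\<eta>: "\<xi> \<otimes>\<^bsub>vr_homology G q X A FX\<^esub> \<eta> \<in> carrier (vr_homology G q X A FX)" using \<xi> \<eta> by simp
  let ?m = "vr_homology_map G q FX Y B FY f"
  show "?m (\<xi> \<otimes>\<^bsub>vr_homology G q X A FX\<^esub> \<eta>) = ?m \<xi> \<otimes>\<^bsub>vr_homology G q Y B FY\<^esub> ?m \<eta>"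
  proof
    fix V
    show "?m (\<xi> \<otimes>\<^bsub>vr_homology G q X A FX\<^esub> \<eta>) V = (?m \<xi> \<otimes>\<^bsub>vr_homology G q Y B FY\<^esub> ?m \<eta>) V"
    proof (cases "V \<in> FY")
      case True
      then obtain U where U: "U \<in> FX" "rel_maps_into f U V" using fD(3) by blast
      have "(\<xi> \<otimes>\<^bsub>vr_homology G q X A FX\<^esub> \<eta>) U = \<xi> U \<otimes>\<^bsub>vr_homology_at G q X A U\<^esub> \<eta> U"
        using U by (simp add: vr_homology_def)
      moreover have "(?m \<xi> \<otimes>\<^bsub>vr_homology G q Y B FY\<^esub> ?m \<eta>) V = ?m \<xi> V \<otimes>\<^bsub>vr_homology_at G q Y B V\<^esub> ?m \<eta> V"
        using True by (simp add: vr_homology_def)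
      ultimately show ?thesis
        using vr_homology_map_apply[OF X Y f \<xi> True U] vr_homology_map_apply[OF X Y f \<eta> True U]
          vr_homology_map_apply[OF X Y f \<xi>\<eta> True U] vr_homologyD(1)[OF \<xi> U(1)] vr_homologyD(1)[OF \<eta> U(1)]
          vr_homology_map_at_hom[OF AX fD(1,2) U(2)]
        by (simp add: hom_mult)
    next
      \<comment> \<open>Outside \<open>FY\<close> both families take the default value of a
        restricted function.\<close>
      case False
      then show ?thesis by (simp add: vr_homology_def vr_homology_map_def)
    qed
  qed
qed (rule vr_homology_map_closed[OF assms])

lemma vr_homology_map_id:
  assumes X: "semi_uniform_pair X A F" and \<xi>: "\<xi> \<in> carrier (vr_homology G q X A F)"
  shows "vr_homology_map G q F X A F id \<xi> = \<xi>"
proof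
  fix U show "vr_homology_map G q F X A F id \<xi> U = \<xi> U"
  proof (cases "U \<in> F")
    case True
    have "vr_homology_map G q F X A F id \<xi> U = vr_homology_map_at G q id X A U (\<xi> U)"
      by (rule vr_homology_map_apply[OF X X semi_uniform_pair_map_id \<xi> True True])
        (rule rel_maps_into_id, simp)
    also have "\<dots> = \<xi> U"
      by (rule vr_homology_map_at_id[OF semi_uniform_pairD(1)[OF X] vr_homologyD(1)[OF \<xi> True]])
    finally show ?thesis .
  next
    case False
    then show ?thesis
      using extensional_arb[OF vr_homologyD(3)[OF \<xi>] False] by (simp add: vr_homology_map_def)
  qed
qed

text \<open>For \<open>W\<close>, continuity of \<open>g\<close> gives \<open>V\<close>, and
  continuity of \<open>f\<close> gives \<open>U\<close> for this \<open>V\<close>. The values do not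
  depend on such choices, so the same \<open>U\<close> serves for
  \<open>g \<circ> f\<close>.\<close>

lemma vr_homology_map_comp:
  assumes X: "semi_uniform_pair X A FX" and Y: "semi_uniform_pair Y B FY" and Z: "semi_uniform_pair Z C FZ"
    and f: "semi_uniform_pair_map X A FX Y B FY f" and g: "semi_uniform_pair_map Y B FY Z C FZ g"
    and \<xi>: "\<xi> \<in> carrier (vr_homology G q X A FX)"
  shows "vr_homology_map G q FX Z C FZ (g \<circ> f) \<xi>
    = vr_homology_map G q FY Z C FZ g (vr_homology_map G q FX Y B FY f \<xi>)"
proof
  fix W
  show "vr_homology_map G q FX Z C FZ (g \<circ> f) \<xi> W
    = vr_homology_map G q FY Z C FZ g (vr_homology_map G q FX Y B FY f \<xi>) W"
  proof (cases "W \<in> FZ")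
    case True
    obtain V where V: "V \<in> FY" "rel_maps_into g V W" using semi_uniform_pair_mapD(3)[OF g True] by blast
    obtain U where U: "U \<in> FX" "rel_maps_into f U V" using semi_uniform_pair_mapD(3)[OF f V(1)] by blast
    show ?thesis
      using vr_homology_map_apply[OF X Y f \<xi> V(1) U]
        vr_homology_map_apply[OF Y Z g vr_homology_map_closed[OF X Y f \<xi>] True V]
        vr_homology_map_apply[OF X Z semi_uniform_pair_map_comp[OF f g] \<xi> True U(1)
          rel_maps_into_comp[OF U(2) V(2)]]
        vr_homology_map_at_comp[OF semi_uniform_pairD(1)[OF X] semi_uniform_pairD(1)[OF Y]
          semi_uniform_pairD(1)[OF Z] semi_uniform_pair_mapD(1,2)[OF f] semi_uniform_pair_mapD(1,2)[OF g]
          U(2) V(2) vr_homologyD(1)[OF \<xi> U(1)]]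
      by simp
  qed (simp add: vr_homology_map_def)
qed

subsection \<open>Functoriality of cohomology\<close>

text \<open>The index order is reverse inclusion: later stages are smaller relations, and a
  transition map restricts cochains to the smaller complex. Two relations have their intersection as
  a common later stage.\<close>

lemma vr_cohomology_direct_system:
  assumes "semi_uniform_pair X A F"
  shows "direct_system F (\<lambda>U' U. U \<subseteq> U') (vr_cohomology_at G q X A)
    (\<lambda>U' U. vr_cohomology_map_at G q id X A U)"
proof (rule direct_system.intro)
  note XD = semi_uniform_pairD[OF assms]
  fix U V W assume UV: "U \<in> F" "V \<in> F"
  show "\<exists>W\<in>F. W \<subseteq> U \<and> W \<subseteq> V" using XD(3)[OF UV] by blast
  assume VU: "V \<subseteq> U"
  then show "vr_cohomology_map_at G q id X A V \<in> hom (vr_cohomology_at G q X A U) (vr_cohomology_at G q X A V)"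
    using XD(1) by (intro vr_cohomology_map_at_hom rel_maps_into_id) auto
  fix \<eta> assume "W \<in> F" "W \<subseteq> V" "\<eta> \<in> carrier (vr_cohomology_at G q X A U)"
  then have "vr_cohomology_map_at G q id X A W (vr_cohomology_map_at G q id X A V \<eta>)
      = vr_cohomology_map_at G q (id \<circ> id) X A W \<eta>"
    using XD(1) VU by (intro vr_cohomology_map_at_comp[of A X A X A X _ _ W V U] rel_maps_into_id) auto
  then show "vr_cohomology_map_at G q id X A W (vr_cohomology_map_at G q id X A V \<eta>)
      = vr_cohomology_map_at G q id X A W \<eta>" by simp
qed (use semi_uniform_pairD(1,2)[OF assms] in \<open>auto intro: comm_group_vr_cohomology_at\<close>)

lemma comm_group_vr_cohomology:
  "semi_uniform_pair X A F \<Longrightarrow> comm_group (vr_cohomology G q X A F)"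
  unfolding vr_cohomology_def by (rule direct_system.comm_group_limit[OF vr_cohomology_direct_system])

lemma vr_cohomologyE:
  assumes "semi_uniform_pair X A F" "P \<in> carrier (vr_cohomology G q X A F)"
  obtains U \<eta> where "U \<in> F" "\<eta> \<in> carrier (vr_cohomology_at G q X A U)"
    "P = vr_cohomology_class G q X A F U \<eta>"
  using assms direct_system.carrier_limit[OF vr_cohomology_direct_system[OF assms(1)], of P q]
  by (auto simp: vr_cohomology_def vr_cohomology_class_def)

text \<open>Totality of the index relation is uniform continuity. Its two monotonicity conditions
  say that \<open>U\<close> may be shrunk and \<open>V\<close> enlarged, and the two compatibility
  squares are the composition law for \<open>f \<circ> id\<close> and
  \<open>id \<circ> f\<close>.\<close>

lemma vr_cohomology_direct_system_map:
  assumes X: "semi_uniform_pair X A FX" and Y: "semi_uniform_pair Y B FY"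
    and f: "semi_uniform_pair_map X A FX Y B FY f"
  shows "direct_system_map
    FY (\<lambda>V' V. V \<subseteq> V') (vr_cohomology_at G q Y B) (\<lambda>V' V. vr_cohomology_map_at G q id Y B V)
    FX (\<lambda>U' U. U \<subseteq> U') (vr_cohomology_at G q X A) (\<lambda>U' U. vr_cohomology_map_at G q id X A U)
    (\<lambda>V U. rel_maps_into f U V) (vr_cohomology_map_at G q f X A)"
proof -
  interpret S: direct_system FY "\<lambda>V' V. V \<subseteq> V'" "vr_cohomology_at G q Y B"
    "\<lambda>V' V. vr_cohomology_map_at G q id Y B V" by (rule vr_cohomology_direct_system) fact
  interpret T: direct_system FX "\<lambda>U' U. U \<subseteq> U'" "vr_cohomology_at G q X A"
    "\<lambda>U' U. vr_cohomology_map_at G q id X A U" by (rule vr_cohomology_direct_system) fact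
  note fD = semi_uniform_pair_mapD[OF f]
  have AX: "A \<subseteq> X" "B \<subseteq> Y" using X Y by (auto simp: semi_uniform_pair_def)
  show ?thesis
  proof
    fix V assume "V \<in> FY"
    then show "\<exists>U\<in>FX. rel_maps_into f U V" by (rule fD(3))
  next
    fix V U U' assume "rel_maps_into f U V" "U' \<subseteq> U"
    then show "rel_maps_into f U' V" by (rule rel_maps_into_mono) simp
  next
    fix V V' U assume "V' \<subseteq> V" "rel_maps_into f U V'"
    then show "rel_maps_into f U V" by (meson rel_maps_into_mono order_refl)
  next
    fix V U assume "rel_maps_into f U V"
    then show "vr_cohomology_map_at G q f X A U \<in> hom (vr_cohomology_at G q Y B V) (vr_cohomology_at G q X A U)"
      using AX fD by (intro vr_cohomology_map_at_hom)
  next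
    fix V U U' \<eta> assume "rel_maps_into f U V" "U' \<subseteq> U" "\<eta> \<in> carrier (vr_cohomology_at G q Y B V)"
    then have "vr_cohomology_map_at G q id X A U' (vr_cohomology_map_at G q f X A U \<eta>)
        = vr_cohomology_map_at G q (f \<circ> id) X A U' \<eta>"
      using AX fD(1,2) by (intro vr_cohomology_map_at_comp[of A X A X B Y _ _ U' U V] rel_maps_into_id) auto
    then show "vr_cohomology_map_at G q id X A U' (vr_cohomology_map_at G q f X A U \<eta>)
        = vr_cohomology_map_at G q f X A U' \<eta>" by simp
  next
    fix V V' U \<eta> assume "V' \<subseteq> V" "rel_maps_into f U V'" "\<eta> \<in> carrier (vr_cohomology_at G q Y B V)"
    then have "vr_cohomology_map_at G q f X A U (vr_cohomology_map_at G q id Y B V' \<eta>)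
        = vr_cohomology_map_at G q (id \<circ> f) X A U \<eta>"
      using AX fD(1,2) by (intro vr_cohomology_map_at_comp[of A X B Y B Y _ _ U V' V] rel_maps_into_id) auto
    then show "vr_cohomology_map_at G q f X A U (vr_cohomology_map_at G q id Y B V' \<eta>)
        = vr_cohomology_map_at G q f X A U \<eta>" by simp
  qed
qed

lemma vr_cohomology_map_eq_limit_map:
  assumes "semi_uniform_pair X A FX" "semi_uniform_pair Y B FY" "semi_uniform_pair_map X A FX Y B FY f"
  shows "vr_cohomology_map G q X A FX f
    = direct_system_map.limit_map FX (\<lambda>U' U. U \<subseteq> U') (vr_cohomology_at G q X A)
        (\<lambda>U' U. vr_cohomology_map_at G q id X A U) (\<lambda>V U. rel_maps_into f U V) (vr_cohomology_map_at G q f X A)"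
  by (rule ext) (simp add: vr_cohomology_map_def vr_cohomology_class_def
      direct_system_map.limit_map_def[OF vr_cohomology_direct_system_map[OF assms]])

lemma vr_cohomology_map_class:
  assumes "semi_uniform_pair X A FX" "semi_uniform_pair Y B FY" "semi_uniform_pair_map X A FX Y B FY f"
    and "V \<in> FY" "\<eta> \<in> carrier (vr_cohomology_at G q Y B V)" "U \<in> FX" "rel_maps_into f U V"
  shows "vr_cohomology_map G q X A FX f (vr_cohomology_class G q Y B FY V \<eta>)
    = vr_cohomology_class G q X A FX U (vr_cohomology_map_at G q f X A U \<eta>)"
  unfolding vr_cohomology_map_eq_limit_map[OF assms(1-3)] vr_cohomology_class_def
  by (rule direct_system_map.limit_map_cls[OF vr_cohomology_direct_system_map[OF assms(1-3)]])
    (use assms in auto)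

lemma vr_cohomology_map_hom:
  assumes "semi_uniform_pair X A FX" "semi_uniform_pair Y B FY" "semi_uniform_pair_map X A FX Y B FY f"
  shows "vr_cohomology_map G q X A FX f \<in> hom (vr_cohomology G q Y B FY) (vr_cohomology G q X A FX)"
  unfolding vr_cohomology_map_eq_limit_map[OF assms] vr_cohomology_def
  by (rule direct_system_map.limit_map_hom[OF vr_cohomology_direct_system_map[OF assms]])

lemma vr_cohomology_map_id:
  assumes X: "semi_uniform_pair X A F" and "P \<in> carrier (vr_cohomology G q X A F)"
  shows "vr_cohomology_map G q X A F id P = P"
proof -
  obtain U \<eta> where "U \<in> F" "\<eta> \<in> carrier (vr_cohomology_at G q X A U)"
    "P = vr_cohomology_class G q X A F U \<eta>" using assms by (rule vr_cohomologyE)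
  then show ?thesis
    using vr_cohomology_map_class[OF X X semi_uniform_pair_map_id] semi_uniform_pairD(1)[OF X]
    by (simp add: rel_maps_into_id vr_cohomology_map_at_id)
qed

lemma vr_cohomology_map_comp:
  assumes X: "semi_uniform_pair X A FX" and Y: "semi_uniform_pair Y B FY" and Z: "semi_uniform_pair Z C FZ"
    and f: "semi_uniform_pair_map X A FX Y B FY f" and g: "semi_uniform_pair_map Y B FY Z C FZ g"
    and "P \<in> carrier (vr_cohomology G q Z C FZ)"
  shows "vr_cohomology_map G q X A FX (g \<circ> f) P
    = vr_cohomology_map G q X A FX f (vr_cohomology_map G q Y B FY g P)"
proof -
  obtain W \<zeta> where W: "W \<in> FZ" "\<zeta> \<in> carrier (vr_cohomology_at G q Z C W)"
    and P: "P = vr_cohomology_class G q Z C FZ W \<zeta>" using Z assms(6) by (rule vr_cohomologyE)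
  obtain V where V: "V \<in> FY" "rel_maps_into g V W" using semi_uniform_pair_mapD(3)[OF g W(1)] by blast
  obtain U where U: "U \<in> FX" "rel_maps_into f U V" using semi_uniform_pair_mapD(3)[OF f V(1)] by blast
  note sub = semi_uniform_pairD(1)[OF X] semi_uniform_pairD(1)[OF Y] semi_uniform_pairD(1)[OF Z]
  \<comment> \<open>The class formula for \<open>f\<close> applies to the intermediate class only
    once it is known to lie in the cohomology at \<open>V\<close>.\<close>
  have "vr_cohomology_map_at G q g Y B V \<zeta> \<in> carrier (vr_cohomology_at G q Y B V)"
    using vr_cohomology_map_at_hom[OF sub(2,3) semi_uniform_pair_mapD(1,2)[OF g] V(2)] W(2)
    by (rule hom_in_carrier)
  then show ?thesis
    unfolding P
    using vr_cohomology_map_class[OF Y Z g W V] vr_cohomology_map_class[OF X Y f V(1) _ U]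
      vr_cohomology_map_class[OF X Z semi_uniform_pair_map_comp[OF f g] W U(1) rel_maps_into_comp[OF U(2) V(2)]]
      vr_cohomology_map_at_comp[OF sub semi_uniform_pair_mapD(1,2)[OF f] semi_uniform_pair_mapD(1,2)[OF g]
        U(2) V(2) W(2)]
    by simp
qed

end

text \<open>The clauses over all \<open>U\<close> and \<open>V\<close> with
  \<open>rel_maps_into f U V\<close> express well-definedness: the induced maps have the described
  values for every admissible choice. Equations between maps are stated on the carriers, where the
  maps have their meaning.\<close>

theorem theorem4p4:
  fixes G :: "('g, 'm) monoid_scheme" and q :: nat
    and X A :: "'a set" and FX :: "('a \<times> 'a) set set"
    and Y B :: "'b set" and FY :: "('b \<times> 'b) set set"
    and Z C :: "'c set" and FZ :: "('c \<times> 'c) set set"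
    and f :: "'a \<Rightarrow> 'b" and g :: "'b \<Rightarrow> 'c"
  assumes "comm_group G"
  shows
    "(semi_uniform_pair X A FX \<longrightarrow>
        comm_group (vr_homology G q X A FX) \<and>
        comm_group (vr_cohomology G q X A FX) \<and>
        (\<forall>\<xi>\<in>carrier (vr_homology G q X A FX). vr_homology_map G q FX X A FX id \<xi> = \<xi>) \<and>
        (\<forall>\<eta>\<in>carrier (vr_cohomology G q X A FX). vr_cohomology_map G q X A FX id \<eta> = \<eta>))
   \<and> (semi_uniform_pair X A FX \<and> semi_uniform_pair Y B FY \<and>
        semi_uniform_pair_map X A FX Y B FY f \<longrightarrow>
        vr_homology_map G q FX Y B FY f \<in> hom (vr_homology G q X A FX) (vr_homology G q Y B FY) \<and>
        (\<forall>\<xi>\<in>carrier (vr_homology G q X A FX). \<forall>V\<in>FY. \<forall>U\<in>FX. rel_maps_into f U V \<longrightarrow>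
           vr_homology_map G q FX Y B FY f \<xi> V = vr_homology_map_at G q f Y B V (\<xi> U)) \<and>
        vr_cohomology_map G q X A FX f \<in> hom (vr_cohomology G q Y B FY) (vr_cohomology G q X A FX) \<and>
        (\<forall>V\<in>FY. \<forall>\<eta>\<in>carrier (vr_cohomology_at G q Y B V). \<forall>U\<in>FX. rel_maps_into f U V \<longrightarrow>
           vr_cohomology_map G q X A FX f (vr_cohomology_class G q Y B FY V \<eta>)
             = vr_cohomology_class G q X A FX U (vr_cohomology_map_at G q f X A U \<eta>)))
   \<and> (semi_uniform_pair X A FX \<and> semi_uniform_pair Y B FY \<and> semi_uniform_pair Z C FZ \<and>
        semi_uniform_pair_map X A FX Y B FY f \<and> semi_uniform_pair_map Y B FY Z C FZ g \<longrightarrow>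
        (\<forall>\<xi>\<in>carrier (vr_homology G q X A FX).
           vr_homology_map G q FX Z C FZ (g \<circ> f) \<xi>
             = vr_homology_map G q FY Z C FZ g (vr_homology_map G q FX Y B FY f \<xi>)) \<and>
        (\<forall>\<zeta>\<in>carrier (vr_cohomology G q Z C FZ).
           vr_cohomology_map G q X A FX (g \<circ> f) \<zeta>
             = vr_cohomology_map G q X A FX f (vr_cohomology_map G q Y B FY g \<zeta>)))"
proof -
  interpret comm_group G by fact
  show ?thesis
  proof (intro conjI impI ballI; (elim conjE)?)
    assume X: "semi_uniform_pair X A FX"
    show "comm_group (vr_homology G q X A FX)" "comm_group (vr_cohomology G q X A FX)"
      by (rule comm_group_vr_homology[OF X] comm_group_vr_cohomology[OF X])+
  qed (rule vr_homology_map_id vr_cohomology_map_id vr_homology_map_hom vr_homology_map_apply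
      vr_cohomology_map_hom vr_cohomology_map_class vr_homology_map_comp vr_cohomology_map_comp;
      assumption)+
qed

end
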